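(* There exists a polynomial-time reduction of the necklace splitting problem to the unfairness minimisation problem for maintaining plan routing on trees; this holds even when the maintaining plan is a star with (integer) weights on its edges.
   Context: Necklace splitting: an open necklace is a path of $k\cdot n$ beads, each coloured by one of $s$ colours, with $k a_i$ beads of colour $i$ ($1\le i\le s$). A $k$-splitting is a partition of the necklace into $k$ parts, each a union of finitely many non-overlapping intervals of beads, such that each part contains exactly $a_i$ beads of colour $i$ for each $i$; its size is the number of cuts forming the intervals. The necklace splitting problem is: given a necklace $N$ and $k$, find a $k$-splitting of $N$ of minimum size. Maintaining plan routing: a maintaining plan is $(G,P,d,\alpha,z,p)$ with $G=(V,E)$ a graph, $P\subseteq E$, depot $d\in V$, edge lengths $\alpha:E\to\mathbb{Z}^+$, priorities $p:E\to\{1,\dots,z\}$. $G^s$ is the symmetric orientation of $G$ (each edge replaced by two opposite arcs). External parameters: maximum route length $L$; $f:E\to\mathbb{Z}^+$ bounding traversal frequency; $t:\{1,\dots,z\}\times\mathbb{Z}^+\to\mathbb{Q}^+$; capacity $c\le 1$. An $L,c,t,f$-vehicle route is a closed walk $w=(e_1,\dots,e_\ell)$ in $G^s$ from $d$ in which each arc appears at least once and at most $f(e)$ times, total length at most $L$, the total length between the $i$-th and $(i+1)$-th traversals of each $e\in P$ is at most $t(p(e),i)L$, and the depot is visited within every sub-route of total length bigger than $cL$. Unfairness: $d$ has degree $1$, each vertex $v$ has a fixed cyclic order $O(v)$ of its neighbours. For $w=(e_1,\dots,e_\ell)$, $i<\ell$, $e_i=(s_i,t_i)$, let $(w,i)^+$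 be the edge at $t_i$ following $\{s_i,t_i\}$ in $O(t_i)$ and $(w,i)^-$ the edge at $s_i$ preceding $\{s_i,t_i\}$ in $O(s_i)$. $(w,i)^+$ has a forward complaint if no orientation of it lies among $e_1,\dots,e_{i+1}$; $(w,i+1)^-$ has a backward complaint if no orientation of it lies among $e_1,\dots,e_{i+1}$. $Uf(w)$ is the number of edges with a forward complaint plus the number with a backward complaint. The unfairness minimisation problem asks for a vehicle route minimising $Uf(w)$. *)

theory Defs
  imports
    "HOL-Computational_Algebra.Polynomial"
    "Graph_Theory.Digraph_Component"
begin

section \<open>Polynomial-time computation\<close>

text \<open>
  The machine model is Jones' WHILE language over binary trees (N. D. Jones,
  \<^emph>\<open>Computability and Complexity: From a Programming Perspective\<close>).  Every assignment is charged
  the size of the tree that it stores, so that sharing of subtrees yields no speed-up and running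
  times are polynomially related to those of Turing machines, also for functions with long outputs.
\<close>

datatype data = Leaf | Node data data

datatype expr = Var nat | LeafE | NodeE expr expr | HdE expr | TlE expr

datatype com =
    Assign nat expr
  | Seq com com
  | Cond expr com com
  | While expr com

type_synonym store = "nat \<Rightarrow> data"

fun hd_data :: "data \<Rightarrow> data" where
  "hd_data Leaf = Leaf"
| "hd_data (Node a b) = a"

fun tl_data :: "data \<Rightarrow> data" where
  "tl_data Leaf = Leaf"
| "tl_data (Node a b) = b"

fun eval_expr :: "expr \<Rightarrow> store \<Rightarrow> data" where
  "eval_expr (Var x) s = s x"
| "eval_expr LeafE s = Leaf"
| "eval_expr (NodeE e1 e2) s = Node (eval_expr e1 s) (eval_expr e2 s)"
| "eval_expr (HdE e) s = hd_data (eval_expr e s)"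
| "eval_expr (TlE e) s = tl_data (eval_expr e s)"

text \<open>\<open>exec p s n s'\<close>: started in store \<open>s\<close>, the program \<open>p\<close> halts in store \<open>s'\<close> after time \<open>n\<close>.\<close>

inductive exec :: "com \<Rightarrow> store \<Rightarrow> nat \<Rightarrow> store \<Rightarrow> bool" where
  Assign: "exec (Assign x e) s (1 + size (eval_expr e s)) (s(x := eval_expr e s))"
| Seq: "exec p s m s' \<Longrightarrow> exec q s' n s'' \<Longrightarrow> exec (Seq p q) s (m + n) s''"
| CondTrue: "eval_expr e s \<noteq> Leaf \<Longrightarrow> exec p s n s' \<Longrightarrow> exec (Cond e p q) s (1 + n) s'"
| CondFalse: "eval_expr e s = Leaf \<Longrightarrow> exec q s n s' \<Longrightarrow> exec (Cond e p q) s (1 + n) s'"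
| WhileFalse: "eval_expr e s = Leaf \<Longrightarrow> exec (While e p) s 1 s"
| WhileTrue: "eval_expr e s \<noteq> Leaf \<Longrightarrow> exec p s m s' \<Longrightarrow> exec (While e p) s' n s'' \<Longrightarrow>
    exec (While e p) s (1 + m + n) s''"

text \<open>Input and output are passed in variable \<open>0\<close>; all other variables are initially \<open>Leaf\<close>.\<close>

definition init_store :: "data \<Rightarrow> store" where
  "init_store d = (\<lambda>_. Leaf)(0 := d)"

text \<open>
  \<open>h\<close> is computable on the set \<open>D\<close> in time polynomial in the size of the code of its argument;
  \<open>cin\<close> and \<open>cout\<close> are the encodings of arguments and results.
\<close>

definition polytime ::
  "('a \<Rightarrow> data) \<Rightarrow> ('b \<Rightarrow> data) \<Rightarrow> 'a set \<Rightarrow> ('a \<Rightarrow> 'b) \<Rightarrow> bool" where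
  "polytime cin cout D h \<longleftrightarrow> (\<exists>(p :: com) (q :: nat poly). \<forall>x\<in>D. \<exists>n s.
     exec p (init_store (cin x)) n s \<and> s 0 = cout (h x) \<and> n \<le> poly q (size (cin x)))"


section \<open>Encodings\<close>

definition code_bool :: "bool \<Rightarrow> data" where
  "code_bool b = (if b then Node Leaf Leaf else Leaf)"

fun code_data_list :: "data list \<Rightarrow> data" where
  "code_data_list [] = Leaf"
| "code_data_list (d # ds) = Node d (code_data_list ds)"

definition code_list :: "('a \<Rightarrow> data) \<Rightarrow> 'a list \<Rightarrow> data" where
  "code_list c xs = code_data_list (map c xs)"

definition code_pair :: "('a \<Rightarrow> data) \<Rightarrow> ('b \<Rightarrow> data) \<Rightarrow> 'a \<times> 'b \<Rightarrow> data" where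
  "code_pair c d xy = Node (c (fst xy)) (d (snd xy))"

text \<open>Numbers are written in binary, least significant bit first.\<close>

fun bits :: "nat \<Rightarrow> bool list" where
  "bits n = (if n = 0 then [] else odd n # bits (n div 2))"

declare bits.simps [simp del]

definition code_nat :: "nat \<Rightarrow> data" where
  "code_nat n = code_list code_bool (bits n)"

text \<open>Only used for nonnegative rationals.\<close>

definition code_rat :: "rat \<Rightarrow> data" where
  "code_rat r = code_pair (\<lambda>a. code_nat (nat a)) (\<lambda>b. code_nat (nat b)) (quotient_of r)"

lemma inj_code_bool: "inj code_bool"
  by (rule injI) (simp add: code_bool_def split: if_splits)

lemma inj_code_data_list: "inj code_data_list"
proof (rule injI)
  fix xs ys :: "data list"
  show "code_data_list xs = code_data_list ys \<Longrightarrow> xs = ys"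
  proof (induction xs arbitrary: ys)
    case Nil
    then show ?case by (cases ys) auto
  next
    case (Cons x xs)
    then show ?case by (cases ys) auto
  qed
qed

lemma inj_code_list: "inj c \<Longrightarrow> inj (code_list c)"
  unfolding code_list_def
  by (rule injI) (metis inj_code_data_list inj_eq inj_map_eq_map)

lemma inj_code_pair: "inj c \<Longrightarrow> inj d \<Longrightarrow> inj (code_pair c d)"
  by (rule injI) (simp add: code_pair_def inj_eq prod_eq_iff)

lemma inj_bits: "inj bits"
proof (rule injI)
  fix m n :: nat
  show "bits m = bits n \<Longrightarrow> m = n"
  proof (induction m arbitrary: n rule: less_induct)
    case (less m)
    show ?case
    proof (cases "m = 0 \<or> n = 0")
      case True
      with less.prems show ?thesis
        by (metis bits.simps list.distinct(1))
    next
      case False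
      with less.prems have "odd m = odd n" "bits (m div 2) = bits (n div 2)"
        by (simp_all add: bits.simps[of m] bits.simps[of n])
      moreover have "m div 2 < m" using False by simp
      ultimately have "m div 2 = n div 2" "odd m = odd n" using less.IH by blast+
      then show ?thesis by (metis odd_two_times_div_two_succ even_two_times_div_two)
    qed
  qed
qed

lemma inj_code_nat: "inj code_nat"
  unfolding code_nat_def
  by (rule injI) (metis inj_code_list[OF inj_code_bool] inj_bits inj_eq)


section \<open>Minimisation problems and reductions\<close>

record ('i, 's) min_problem =
  instances :: "'i set"
  solutions :: "'i \<Rightarrow> 's set"
  cost :: "'i \<Rightarrow> 's \<Rightarrow> nat"
  code_inst :: "'i \<Rightarrow> data"
  code_sol :: "'s \<Rightarrow> data"

definition optimal :: "('i, 's) min_problem \<Rightarrow> 'i \<Rightarrow> 's set" where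
  "optimal A x = {s \<in> solutions A x. \<forall>s' \<in> solutions A x. cost A x s \<le> cost A x s'}"

text \<open>
  The problems ask for an optimal solution.  A reduction therefore consists of a translation \<open>r\<close> of
  instances, which preserves solvability, and of a translation \<open>b\<close> of optimal solutions back, both
  computable in polynomial time.
\<close>

definition polytime_reducible :: "('i, 's) min_problem \<Rightarrow> ('j, 'w) min_problem \<Rightarrow> bool" where
  "polytime_reducible A B \<longleftrightarrow> (\<exists>(r :: 'i \<Rightarrow> 'j) (b :: 'i \<times> 'w \<Rightarrow> 's).
     polytime (code_inst A) (code_inst B) (instances A) r \<and>
     polytime (code_pair (code_inst A) (code_sol B)) (code_sol A)
       {(x, w). x \<in> instances A \<and> w \<in> optimal B (r x)} b \<and>
     (\<forall>x \<in> instances A.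
        r x \<in> instances B \<and>
        (solutions A x \<noteq> {} \<longleftrightarrow> solutions B (r x) \<noteq> {}) \<and>
        (\<forall>w \<in> optimal B (r x). b (x, w) \<in> optimal A x)))"


section \<open>Necklace splitting\<close>

text \<open>
  The colours are \<open>0, \<dots>, s - 1\<close> with \<open>s = length (shares N)\<close>; \<open>shares N ! i\<close> is the number of
  beads of colour \<open>i\<close> that each of the \<open>parts N\<close> parts has to receive.
\<close>

record necklace =
  parts :: nat
  shares :: "nat list"
  beads :: "nat list"

definition necklace_wf :: "necklace \<Rightarrow> bool" where
  "necklace_wf N \<longleftrightarrow>
     parts N \<ge> 1 \<and> beads N \<noteq> [] \<and>
     set (beads N) \<subseteq> {..<length (shares N)} \<and>
     (\<forall>i < length (shares N). count_list (beads N) i = parts N * shares N ! i)"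

text \<open>
  A splitting is the sequence of the intervals into which the necklace is cut, each one together
  with the part to which it is given.
\<close>

type_synonym splitting = "(nat \<times> nat list) list"

definition k_splitting :: "necklace \<Rightarrow> splitting \<Rightarrow> bool" where
  "k_splitting N S \<longleftrightarrow>
     concat (map snd S) = beads N \<and>
     (\<forall>(j, B) \<in> set S. j < parts N \<and> B \<noteq> []) \<and>
     (\<forall>j < parts N. \<forall>i < length (shares N).
        (\<Sum>(j', B) \<leftarrow> S. if j' = j then count_list B i else 0) = shares N ! i)"

definition splitting_size :: "splitting \<Rightarrow> nat" where
  "splitting_size S = length S - 1"

definition code_necklace :: "necklace \<Rightarrow> data" where
  "code_necklace N = code_data_list
     [code_nat (parts N), code_list code_nat (shares N), code_list code_nat (beads N)]"

definition necklace_splitting :: "(necklace, splitting) min_problem" where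
  "necklace_splitting =
     \<lparr>instances = {N. necklace_wf N},
      solutions = (\<lambda>N. {S. k_splitting N S}),
      cost = (\<lambda>_. splitting_size),
      code_inst = code_necklace,
      code_sol = code_list (code_pair code_nat (code_list code_nat))\<rparr>"


section \<open>Maintaining plan routing\<close>

text \<open>
  In the notation of the literature, a maintaining plan is \<open>(G, P, d, \<alpha>, z, p)\<close> with \<open>G = (V, E)\<close>.
  An edge is the set of its two end vertices.
\<close>

record plan =
  vertices :: "nat set"               \<comment> \<open>\<open>V\<close>\<close>
  edges :: "nat set set"              \<comment> \<open>\<open>E\<close>\<close>
  prio_edges :: "nat set set"         \<comment> \<open>\<open>P\<close>\<close>
  depot :: nat                        \<comment> \<open>\<open>d\<close>\<close>
  len :: "nat set \<Rightarrow> nat"             \<comment> \<open>\<open>\<alpha>\<close>\<close>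
  levels :: nat                       \<comment> \<open>\<open>z\<close>\<close>
  prio :: "nat set \<Rightarrow> nat"            \<comment> \<open>\<open>p\<close>\<close>

text \<open>
  The external parameters \<open>L\<close>, \<open>c\<close>, \<open>t\<close>, \<open>f\<close>, and the cyclic orders \<open>O(v)\<close>.  A cyclic order is
  given by any list that enumerates it from some starting point.
\<close>

record routing = plan +
  max_len :: nat                      \<comment> \<open>\<open>L\<close>\<close>
  capacity :: rat                     \<comment> \<open>\<open>c\<close>\<close>
  gap :: "nat \<Rightarrow> nat \<Rightarrow> rat"          \<comment> \<open>\<open>t\<close>\<close>
  freq :: "nat set \<Rightarrow> nat"            \<comment> \<open>\<open>f\<close>\<close>
  nbr_order :: "nat \<Rightarrow> nat list"      \<comment> \<open>\<open>O\<close>\<close>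

definition plan_wf :: "('m) plan_scheme \<Rightarrow> bool" where
  "plan_wf I \<longleftrightarrow>
     finite (vertices I) \<and>
     edges I \<subseteq> {e. e \<subseteq> vertices I \<and> card e = 2} \<and>
     prio_edges I \<subseteq> edges I \<and>
     depot I \<in> vertices I \<and>
     (\<forall>e \<in> edges I. len I e > 0 \<and> prio I e \<in> {1..levels I})"

definition routing_wf :: "routing \<Rightarrow> bool" where
  "routing_wf I \<longleftrightarrow>
     plan_wf I \<and>
     card {e \<in> edges I. depot I \<in> e} = 1 \<and>
     max_len I > 0 \<and>
     0 < capacity I \<and> capacity I \<le> 1 \<and>
     (\<forall>q \<in> {1..levels I}. \<forall>i \<ge> 1. gap I q i > 0) \<and>
     (\<forall>e \<in> edges I. freq I e > 0) \<and>
     (\<forall>v \<in> vertices I. distinct (nbr_order I v) \<and> set (nbr_order I v) = {u. {u, v} \<in> edges I})"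

definition sym_orientation :: "('m) plan_scheme \<Rightarrow> nat pair_pre_digraph" where
  "sym_orientation I = \<lparr>pverts = vertices I, parcs = {(u, v). {u, v} \<in> edges I}\<rparr>"

abbreviation Gs :: "('m) plan_scheme \<Rightarrow> (nat, nat \<times> nat) pre_digraph" where
  "Gs I \<equiv> with_proj (sym_orientation I)"

text \<open>
  A cycle of length at least 3 of the symmetric orientation is a cycle of the undirected graph;
  the directed 2-cycles come from single edges.
\<close>

definition is_tree :: "('m) plan_scheme \<Rightarrow> bool" where
  "is_tree I \<longleftrightarrow> Digraph_Component.connected (Gs I) \<and>
     \<not> (\<exists>p. pre_digraph.cycle (Gs I) p \<and> length p \<ge> 3)"

definition is_star :: "('m) plan_scheme \<Rightarrow> bool" where
  "is_star I \<longleftrightarrow> (\<exists>x \<in> vertices I. edges I = {{x, v} | v. v \<in> vertices I - {x}})"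

fun edge_of :: "nat \<times> nat \<Rightarrow> nat set" where
  "edge_of (u, v) = {u, v}"

definition walk_len :: "('m) plan_scheme \<Rightarrow> (nat \<times> nat) list \<Rightarrow> nat" where
  "walk_len I w = (\<Sum>a \<leftarrow> w. len I (edge_of a))"

text \<open>The arcs of \<open>w\<close> at the positions \<open>i, \<dots>, j - 1\<close>.\<close>

definition segment :: "'a list \<Rightarrow> nat \<Rightarrow> nat \<Rightarrow> 'a list" where
  "segment w i j = drop i (take j w)"

definition traversals :: "(nat \<times> nat) list \<Rightarrow> nat set \<Rightarrow> nat list" where
  "traversals w e = [m \<leftarrow> [0..<length w]. edge_of (w ! m) = e]"

text \<open>
  In the last condition, the depot has to be an inner vertex of every sub-route of total length
  greater than \<open>cL\<close>; equivalently, consecutive visits of the depot are at most \<open>cL\<close> apart.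
\<close>

definition vehicle_route :: "routing \<Rightarrow> (nat \<times> nat) list \<Rightarrow> bool" where
  "vehicle_route I w \<longleftrightarrow>
     pre_digraph.awalk (Gs I) (depot I) w (depot I) \<and>
     (\<forall>a \<in> arcs (Gs I). 1 \<le> count_list w a \<and> count_list w a \<le> freq I (edge_of a)) \<and>
     walk_len I w \<le> max_len I \<and>
     (\<forall>e \<in> prio_edges I. \<forall>i. 1 \<le> i \<and> i < length (traversals w e) \<longrightarrow>
        rat_of_nat (walk_len I
          (segment w (Suc (traversals w e ! (i - 1))) (traversals w e ! i)))
        \<le> gap I (prio I e) i * rat_of_nat (max_len I)) \<and>
     (\<forall>i j. i \<le> j \<and> j \<le> length w \<and>
        rat_of_nat (walk_len I (segment w i j)) > capacity I * rat_of_nat (max_len I) \<longrightarrow>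
        (\<exists>m. i < m \<and> m < j \<and> fst (w ! m) = depot I))"


section \<open>Unfairness\<close>

definition cyc_next :: "'a list \<Rightarrow> 'a \<Rightarrow> 'a" where
  "cyc_next xs x = (THE y. \<exists>i < length xs. xs ! i = x \<and> y = xs ! (Suc i mod length xs))"

definition cyc_prev :: "'a list \<Rightarrow> 'a \<Rightarrow> 'a" where
  "cyc_prev xs x = (THE y. \<exists>i < length xs. xs ! (Suc i mod length xs) = x \<and> y = xs ! i)"

text \<open>\<open>next_edge O (s, t)\<close> and \<open>prev_edge O (s, t)\<close> are \<open>(w, i)\<^sup>+\<close> and \<open>(w, i)\<^sup>-\<close> for \<open>e\<^sub>i = (s, t)\<close>.\<close>

fun next_edge :: "(nat \<Rightarrow> nat list) \<Rightarrow> nat \<times> nat \<Rightarrow> nat set" where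
  "next_edge ord (s, t) = {t, cyc_next (ord t) s}"

fun prev_edge :: "(nat \<Rightarrow> nat list) \<Rightarrow> nat \<times> nat \<Rightarrow> nat set" where
  "prev_edge ord (s, t) = {s, cyc_prev (ord s) t}"

text \<open>
  Positions of a list start at \<open>0\<close>: in terms of the index \<open>i = m + 1\<close> that starts at \<open>1\<close>, the arcs
  \<open>e\<^sub>i\<close> and \<open>e\<^sub>i\<^sub>+\<^sub>1\<close> are \<open>w ! m\<close> and \<open>w ! Suc m\<close>, and \<open>e\<^sub>1, \<dots>, e\<^sub>i\<^sub>+\<^sub>1\<close> is \<open>take (m + 2) w\<close>.
\<close>

definition forward_complaints :: "routing \<Rightarrow> (nat \<times> nat) list \<Rightarrow> nat set set" where
  "forward_complaints I w = {e. \<exists>m. Suc m < length w \<and> e = next_edge (nbr_order I) (w ! m) \<and>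
     e \<notin> edge_of ` set (take (m + 2) w)}"

definition backward_complaints :: "routing \<Rightarrow> (nat \<times> nat) list \<Rightarrow> nat set set" where
  "backward_complaints I w = {e. \<exists>m. Suc m < length w \<and> e = prev_edge (nbr_order I) (w ! Suc m) \<and>
     e \<notin> edge_of ` set (take (m + 2) w)}"

definition unfairness :: "routing \<Rightarrow> (nat \<times> nat) list \<Rightarrow> nat" where
  "unfairness I w = card (forward_complaints I w) + card (backward_complaints I w)"

text \<open>
  An edge \<open>e\<close> is traversed at most \<open>2 f(e)\<close> times, so only the values \<open>t(q, i)\<close> with
  \<open>i < 2 max f\<close> are relevant; the code of an instance lists exactly these.  In particular the
  number of arcs of a route is polynomially bounded in the size of the code of the instance.
\<close>

definition code_routing :: "routing \<Rightarrow> data" where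
  "code_routing I =
     (let vs = sorted_list_of_set (vertices I);
          es = [(u, v). u \<leftarrow> vs, v \<leftarrow> vs, u < v \<and> {u, v} \<in> edges I]
      in code_data_list
        [code_list code_nat vs,
         code_list (\<lambda>(u, v). code_data_list
           [code_nat u, code_nat v, code_bool ({u, v} \<in> prio_edges I), code_nat (len I {u, v}),
            code_nat (prio I {u, v}), code_nat (freq I {u, v})]) es,
         code_nat (depot I),
         code_nat (levels I),
         code_nat (max_len I),
         code_rat (capacity I),
         code_list (\<lambda>q. code_list (\<lambda>i. code_rat (gap I q i)) [1..<2 * Max (freq I ` edges I)])
           [1..<Suc (levels I)],
         code_list (\<lambda>v. code_list code_nat (nbr_order I v)) vs])"

text \<open>The unfairness minimisation problem for the maintaining plans in a class \<open>C\<close>.\<close>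

definition unfairness_minimisation ::
  "(routing \<Rightarrow> bool) \<Rightarrow> (routing, (nat \<times> nat) list) min_problem" where
  "unfairness_minimisation C =
     \<lparr>instances = {I. routing_wf I \<and> C I},
      solutions = (\<lambda>I. {w. vehicle_route I w}),
      cost = unfairness,
      code_inst = code_routing,
      code_sol = code_list (code_pair code_nat code_nat)\<rparr>"

end

theory Submission
  imports Defs
begin

text \<open>
  Each bead becomes a leaf of a star, in the cyclic order of the necklace, and each part becomes a trip
  from the depot.  The edge of a bead of colour \<open>c\<close> has length \<open>B ^ c\<close> for a large \<open>B\<close>.  The capacity and
  the frequency of the depot edge allow just as many trips as are needed if all of them are full, and
  a trip is full only if it contains the right number of beads of each colour.  Two consecutive beads
  cause exactly one complaint unless they are visited one directly after the other: a forward complaint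
  if the first one is visited earlier, and a backward complaint otherwise.  Thus complaints count cuts,
  up to a constant that a dummy leaf between the depot and the first bead makes independent of
  the splitting.

  For the running times, the functions computed by polynomial-time programs are closed under
  composition, pairing, case distinction and iteration over a list with polynomially bounded
  intermediate results.
\<close>

section \<open>Polynomial-time functions\<close>

text \<open>Every operation of the translation has to be exhibited as a program with a time bound,
  and this dictates the constants. The base \<open>B\<close> is a power of two whose exponent is the
  length of a list at hand, so that multiplying by \<open>B\<close> is a shift; binary numbers are
  only shifted, halved, incremented, compared and tested for parity. Leaves are named by powers of
  two for the same reason: the name of a leaf can be halved in step with a list, so a route is read
  back without subtraction or indexing. The base \<open>2 ^ m\<close> for \<open>m\<close> beads
  exceeds every number of beads of one colour in a trip, so digits never carry. It is also at least
  the number of trips, so it can serve as the denominator of the capacity. Edge lengths are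
  exponential, but their binary codes are short, because colours are indices into the list of
  shares. The two directions of correctness are not symmetric: every route yields a splitting with
  at least two fewer cuts than the route has complaints, whereas for a splitting only one favourable
  route is constructed. These two inequalities suffice for optimality.\<close>

lemma poly_nat_mono: "m \<le> n \<Longrightarrow> poly p m \<le> poly p n" for p :: "nat poly"
  by (induction p) (auto intro!: add_mono mult_mono)

section \<open>Functions bounded by a polynomial in the size of the argument\<close>

definition poly_bounded :: "'a set \<Rightarrow> ('a \<Rightarrow> nat) \<Rightarrow> ('a \<Rightarrow> nat) \<Rightarrow> bool" where
  "poly_bounded D g f \<longleftrightarrow> (\<exists>q :: nat poly. \<forall>x\<in>D. f x \<le> poly q (g x))"

lemma poly_boundedI: "(\<And>x. x \<in> D \<Longrightarrow> f x \<le> poly q (g x)) \<Longrightarrow> poly_bounded D g f"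
  unfolding poly_bounded_def by blast

lemma poly_bounded_le: "poly_bounded D g h \<Longrightarrow> (\<And>x. x \<in> D \<Longrightarrow> f x \<le> h x) \<Longrightarrow> poly_bounded D g f"
  unfolding poly_bounded_def by (meson order_trans)

lemma poly_bounded_const [intro]: "poly_bounded D g (\<lambda>_. k)"
  by (rule poly_boundedI[where q = "[:k:]"]) simp

lemma poly_bounded_self [intro]: "poly_bounded D g g"
  by (rule poly_boundedI[where q = "[:0, 1:]"]) simp

lemma poly_bounded_add [intro]:
  "poly_bounded D g f \<Longrightarrow> poly_bounded D g f' \<Longrightarrow> poly_bounded D g (\<lambda>x. f x + f' x)"
  unfolding poly_bounded_def by (metis add_mono poly_add)

lemma poly_bounded_mult [intro]:
  "poly_bounded D g f \<Longrightarrow> poly_bounded D g f' \<Longrightarrow> poly_bounded D g (\<lambda>x. f x * f' x)"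
  unfolding poly_bounded_def by (metis mult_mono' poly_mult zero_le)

lemma poly_bounded_trans:
  assumes "poly_bounded D g f" and "poly_bounded E f' h"
    and "\<And>x. x \<in> D \<Longrightarrow> i x \<in> E" and "\<And>x. x \<in> D \<Longrightarrow> f' (i x) \<le> f x"
  shows "poly_bounded D g (\<lambda>x. h (i x))"
proof -
  obtain q r where q: "\<forall>x\<in>D. f x \<le> poly q (g x)" and r: "\<forall>x\<in>E. h x \<le> poly r (f' x)"
    using assms(1,2) unfolding poly_bounded_def by blast
  have "h (i x) \<le> poly (pcompose r q) (g x)" if "x \<in> D" for x
  proof -
    have "f' (i x) \<le> poly q (g x)"
      using assms(4)[OF that] q that by (meson order_trans)
    then show ?thesis
      using r assms(3)[OF that] by (metis order_trans poly_nat_mono poly_pcompose)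
  qed
  then show ?thesis by (rule poly_boundedI)
qed

lemma poly_bounded_poly:
  fixes q :: "nat poly"
  assumes "poly_bounded D g f"
  shows "poly_bounded D g (\<lambda>x. poly q (f x))"
  by (rule poly_bounded_trans[OF assms, where E = UNIV and f' = id])
    (auto intro: poly_boundedI[where q = q])

section \<open>Programs as functions on a stack, and their composition\<close>

lemma exec_size_le: "exec p s n s' \<Longrightarrow> size (s' v) \<le> size (s v) + n"
proof (induction arbitrary: v rule: exec.induct)
  case (Seq p s m s' q n s'')
  show ?case using Seq.IH(1)[of v] Seq.IH(2)[of v] by simp
next
  case (CondTrue e s p n s' q)
  show ?case using CondTrue.IH[of v] by simp
next
  case (CondFalse e s q n s' p)
  show ?case using CondFalse.IH[of v] by simp
next
  case (WhileTrue e s p m s' n s'')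
  show ?case using WhileTrue.IH(1)[of v] WhileTrue.IH(2)[of v] by simp
qed auto

text \<open>Programs use the variables as a stack: the argument and the result are in variable \<open>N\<close>, the
  variables below \<open>N\<close> are kept, and those above \<open>N\<close> may initially hold anything.\<close>

definition runs :: "nat \<Rightarrow> com \<Rightarrow> nat poly \<Rightarrow> 'a set \<Rightarrow> ('a \<Rightarrow> data) \<Rightarrow> ('a \<Rightarrow> data) \<Rightarrow> bool" where
  "runs N p q D c f \<longleftrightarrow> (\<forall>x\<in>D. \<forall>s. s N = c x \<longrightarrow>
     (\<exists>n s'. exec p s n s' \<and> s' N = f x \<and> (\<forall>i<N. s' i = s i) \<and> n \<le> poly q (size (c x))))"

text \<open>Demanding a program for every base \<open>N\<close> builds relocation into the notion: a
  subprogram can be placed at any height of the stack without an argument about renaming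
  variables.\<close>

definition ptime :: "'a set \<Rightarrow> ('a \<Rightarrow> data) \<Rightarrow> ('a \<Rightarrow> data) \<Rightarrow> bool" where
  "ptime D c f \<longleftrightarrow> (\<forall>N. \<exists>p q. runs N p q D c f)"

lemma runsD:
  "runs N p q D c f \<Longrightarrow> x \<in> D \<Longrightarrow> s N = c x \<Longrightarrow>
     \<exists>n s'. exec p s n s' \<and> s' N = f x \<and> (\<forall>i<N. s' i = s i) \<and> n \<le> poly q (size (c x))"
  unfolding runs_def by blast

text \<open>The time may be given by any polynomially bounded function \<open>T\<close> of the
  argument; the polynomial itself need not be written down.\<close>

lemma ptimeI:
  assumes "\<And>N. \<exists>p T. poly_bounded D (\<lambda>x. size (c x)) T \<and> (\<forall>x\<in>D. \<forall>s. s N = c x \<longrightarrow>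
     (\<exists>n s'. exec p s n s' \<and> s' N = f x \<and> (\<forall>i<N. s' i = s i) \<and> n \<le> T x))"
  shows "ptime D c f"
  unfolding ptime_def runs_def
proof
  fix N
  obtain p T q where T: "\<forall>x\<in>D. T x \<le> poly q (size (c x))" and
    run: "\<forall>x\<in>D. \<forall>s. s N = c x \<longrightarrow>
     (\<exists>n s'. exec p s n s' \<and> s' N = f x \<and> (\<forall>i<N. s' i = s i) \<and> n \<le> T x)"
    using assms[of N] unfolding poly_bounded_def by blast
  show "\<exists>p (q :: nat poly). \<forall>x\<in>D. \<forall>s. s N = c x \<longrightarrow>
     (\<exists>n s'. exec p s n s' \<and> s' N = f x \<and> (\<forall>i<N. s' i = s i) \<and> n \<le> poly q (size (c x)))"
    proof (rule exI[of _ p], rule exI[of _ q], intro ballI allI impI)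
    fix x s assume x: "x \<in> D" "s N = c x"
    then obtain n s' where "exec p s n s'" "s' N = f x" "\<forall>i<N. s' i = s i" "n \<le> T x"
      using run by blast
    then show "\<exists>n s'. exec p s n s' \<and> s' N = f x \<and> (\<forall>i<N. s' i = s i) \<and> n \<le> poly q (size (c x))"
      using T x(1) by (intro exI[of _ n] exI[of _ s']) (auto dest: order_trans)
  qed
qed

text \<open>An assignment is charged the size of the tree that it stores, so the running time bounds
  the growth of every variable. Hence a second program that is run on the result stays polynomial in
  the original input.\<close>

lemma ptime_poly_bounded:
  assumes "ptime D c f"
  shows "poly_bounded D (\<lambda>x. size (c x)) (\<lambda>x. size (f x))"
proof -
  obtain p q where r: "runs 0 p q D c f" using assms unfolding ptime_def by blast
  have "size (f x) \<le> poly ([:0, 1:] + q) (size (c x))" if xD: "x \<in> D" for x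
  proof -
    obtain n s' where "exec p (\<lambda>_. c x) n s'" "s' 0 = f x" "n \<le> poly q (size (c x))"
      using runsD[where s = "\<lambda>_. c x", OF r xD] by blast
    then show ?thesis using exec_size_le[of p "\<lambda>_. c x" n s' 0] by simp
  qed
  then show ?thesis by (rule poly_boundedI)
qed

lemma ptime_imp_polytime: "ptime D cin (\<lambda>x. cout (h x)) \<Longrightarrow> polytime cin cout D h"
  unfolding ptime_def runs_def polytime_def init_store_def
  by (erule allE[of _ 0], elim exE, rename_tac p q, rule_tac x = p in exI, rule_tac x = q in exI)
    fastforce

text \<open>Reindexing: a program sees only codes, so it serves any family of arguments that factors
  through \<open>h\<close>.\<close>

lemma ptime_mono:
  assumes "ptime E c' f'" and "\<And>x. x \<in> D \<Longrightarrow> h x \<in> E"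
    and "\<And>x. x \<in> D \<Longrightarrow> c x = c' (h x)" and "\<And>x. x \<in> D \<Longrightarrow> f x = f' (h x)"
  shows "ptime D c f"
  unfolding ptime_def
proof
  fix N
  obtain p q where "runs N p q E c' f'" using assms(1) unfolding ptime_def by blast
  then have "runs N p q D c f" using assms(2-4) unfolding runs_def by simp
  then show "\<exists>p q. runs N p q D c f" by blast
qed

lemma ptime_subset: "ptime E c f \<Longrightarrow> D \<subseteq> E \<Longrightarrow> ptime D c f"
  by (erule ptime_mono[where h = "\<lambda>x. x"]) auto

lemma ptime_cong: "ptime D c f \<Longrightarrow> (\<And>x. x \<in> D \<Longrightarrow> f' x = f x) \<Longrightarrow> ptime D c f'"
  by (erule ptime_mono[where h = "\<lambda>x. x"]) auto

lemma ptime_trans: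
  assumes "ptime D c f" and "ptime D f g"
  shows "ptime D c g"
proof (rule ptimeI, goal_cases)
  case (1 N)
  obtain p q where p: "runs N p q D c f" using assms(1) unfolding ptime_def by blast
  obtain p' q' where p': "runs N p' q' D f g" using assms(2) unfolding ptime_def by blast
  let ?T = "\<lambda>x. poly q (size (c x)) + poly q' (size (f x))"
  have tm: "poly_bounded D (\<lambda>x. size (c x)) ?T"
    by (intro poly_bounded_add poly_bounded_poly ptime_poly_bounded[OF assms(1)] poly_bounded_self)
  have ex: "\<exists>n s'. exec (Seq p p') s n s' \<and> s' N = g x \<and> (\<forall>i<N. s' i = s i) \<and> n \<le> ?T x"
    if x: "x \<in> D" and s: "s N = c x" for x s
  proof -
    obtain n s' where 1: "exec p s n s'" "s' N = f x" "\<forall>i<N. s' i = s i" "n \<le> poly q (size (c x))"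
      using runsD[where s = s, OF p x s] by blast
    obtain n' s'' where 2: "exec p' s' n' s''" "s'' N = g x" "\<forall>i<N. s'' i = s' i"
      "n' \<le> poly q' (size (f x))"
      using runsD[where s = s', OF p' x 1(2)] by blast
    show ?thesis
      by (rule exI[of _ "n + n'"], rule exI[of _ s'']) (use 1 2 exec.Seq in \<open>force intro: add_mono\<close>)
  qed
  show ?case
    by (intro exI[of _ "Seq p p'"] exI[of _ ?T] conjI ballI allI impI tm ex)
qed

section \<open>Expressions, pairs and conditionals\<close>

fun at_var :: "nat \<Rightarrow> expr \<Rightarrow> expr" where
  "at_var N (Var _) = Var N"
| "at_var N LeafE = LeafE"
| "at_var N (NodeE a b) = NodeE (at_var N a) (at_var N b)"
| "at_var N (HdE a) = HdE (at_var N a)"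
| "at_var N (TlE a) = TlE (at_var N a)"

text \<open>A computed function has a single argument, so an expression is moved to the base
  \<open>N\<close> by redirecting all its variables there.\<close>

lemma eval_at_var: "eval_expr (at_var N e) s = eval_expr e (\<lambda>_. s N)"
  by (induction e) auto

text \<open>The polynomial may depend on the expression, which is fixed; the copies of the argument
  that \<open>NodeE\<close> makes are therefore harmless.\<close>

lemma size_eval_expr_le: "\<exists>q :: nat poly. \<forall>d. size (eval_expr e (\<lambda>_. d)) \<le> poly q (size d)"
proof (induction e)
  case (Var x)
  show ?case by (rule exI[of _ "[:0, 1:]"]) simp
next
  case LeafE
  show ?case by simp
next
  case (NodeE a b)
  then obtain q r where "\<forall>d. size (eval_expr a (\<lambda>_. d)) \<le> poly q (size d)"
    "\<forall>d. size (eval_expr b (\<lambda>_. d)) \<le> poly r (size d)" by blast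
  then have "\<forall>d. size (eval_expr (NodeE a b) (\<lambda>_. d)) \<le> poly (1 + q + r) (size d)"
    by (simp add: add_mono)
  then show ?case by blast
next
  case (HdE a)
  moreover have "size (hd_data d) \<le> size d" for d by (cases d) auto
  ultimately show ?case by (metis eval_expr.simps(4) order_trans)
next
  case (TlE a)
  moreover have "size (tl_data d) \<le> size d" for d by (cases d) auto
  ultimately show ?case by (metis eval_expr.simps(5) order_trans)
qed

lemma ptime_expr: "ptime D c (\<lambda>x. eval_expr e (\<lambda>_. c x))"
proof (rule ptimeI, goal_cases)
  case (1 N)
  let ?T = "\<lambda>x. 1 + size (eval_expr e (\<lambda>_. c x))"
  have tm: "poly_bounded D (\<lambda>x. size (c x)) ?T"
    using size_eval_expr_le[of e] unfolding poly_bounded_def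
    by (metis add_mono order_refl poly_1 poly_add)
  then show ?case
    using exec.Assign[of N "at_var N e"]
    by (intro exI[of _ "Assign N (at_var N e)"] exI[of _ ?T] conjI ballI allI impI)
      (auto simp: eval_at_var intro!: exI)
qed

lemma ptime_expr':
  assumes "ptime D c f" "\<And>x. x \<in> D \<Longrightarrow> g x = eval_expr e (\<lambda>_. f x)"
  shows "ptime D c g"
  by (rule ptime_trans[OF assms(1)], rule ptime_cong[OF ptime_expr]) (rule assms(2))

lemma ptime_id: "ptime D c c"
  by (rule ptime_cong[OF ptime_expr[where e = "Var 0"]]) simp

lemma ptime_hd: "ptime D c f \<Longrightarrow> ptime D c (\<lambda>x. hd_data (f x))"
  by (erule ptime_expr'[where e = "HdE (Var 0)"]) simp

lemma ptime_tl: "ptime D c f \<Longrightarrow> ptime D c (\<lambda>x. tl_data (f x))"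
  by (erule ptime_expr'[where e = "TlE (Var 0)"]) simp

lemma ptime_const: "ptime D c (\<lambda>_. d)"
proof -
  have "\<exists>e. \<forall>s. eval_expr e s = d"
  proof (induction d)
    case Leaf
    show ?case by (rule exI[of _ LeafE]) simp
  next
    case (Node a b)
    then obtain e1 e2 where "\<forall>s. eval_expr e1 s = a" "\<forall>s. eval_expr e2 s = b" by blast
    then show ?case by (intro exI[of _ "NodeE e1 e2"]) simp
  qed
  then obtain e where "\<forall>s. eval_expr e s = d" ..
  then show ?thesis by (intro ptime_cong[OF ptime_expr[where e = e]]) simp
qed

lemma ptime_Node:
  assumes "ptime D c f" and "ptime D c g"
  shows "ptime D c (\<lambda>x. Node (f x) (g x))"
proof (rule ptimeI, goal_cases)
  case (1 N)
  obtain p q where p: "runs (N+1) p q D c f" using assms(1) unfolding ptime_def by blast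
  obtain p' q' where p': "runs (N+2) p' q' D c g" using assms(2) unfolding ptime_def by blast
  \<comment> \<open>The argument stays in \<open>N\<close> while both components are computed above
    it; the second one starts at \<open>N+2\<close> and so preserves the first one in
    \<open>N+1\<close>.\<close>
  let ?P = "Seq (Assign (N+1) (Var N)) (Seq p (Seq (Assign (N+2) (Var N)) (Seq p'
     (Assign N (NodeE (Var (N+1)) (Var (N+2)))))))"
  let ?T = "\<lambda>x. 1 + size (c x) + (poly q (size (c x)) + (1 + size (c x) + (poly q' (size (c x)) +
     (2 + size (f x) + size (g x)))))"
  have tm: "poly_bounded D (\<lambda>x. size (c x)) ?T"
    by (intro poly_bounded_add poly_bounded_poly ptime_poly_bounded[OF assms(1)]
      ptime_poly_bounded[OF assms(2)] poly_bounded_self poly_bounded_const)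
  have ex: "\<exists>n s'. exec ?P s n s' \<and> s' N = Node (f x) (g x) \<and> (\<forall>i<N. s' i = s i) \<and> n \<le> ?T x"
    if x: "x \<in> D" and s: "s N = c x" for x s
  proof -
    let ?s1 = "s(N+1 := c x)"
    have e1: "exec (Assign (N+1) (Var N)) s (1 + size (c x)) ?s1"
      using exec.Assign[of "N+1" "Var N" s] s by simp
    obtain n2 s2 where 2: "exec p ?s1 n2 s2" "s2 (N+1) = f x" "\<forall>i<N+1. s2 i = ?s1 i"
       "n2 \<le> poly q (size (c x))"
      using runsD[where s = "?s1", OF p x] by auto
    then have s2N: "s2 N = c x" using s by simp
    let ?s3 = "s2(N+2 := c x)"
    have e3: "exec (Assign (N+2) (Var N)) s2 (1 + size (c x)) ?s3"
      using exec.Assign[of "N+2" "Var N" s2] s2N by simp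
    obtain n4 s4 where 4: "exec p' ?s3 n4 s4" "s4 (N+2) = g x" "\<forall>i<N+2. s4 i = ?s3 i"
       "n4 \<le> poly q' (size (c x))"
      using runsD[where s = "?s3", OF p' x] by auto
    have s4N: "s4 (N+1) = f x" using 4 2 by simp
    let ?s5 = "s4(N := Node (f x) (g x))"
    have e5: "exec (Assign N (NodeE (Var (N+1)) (Var (N+2)))) s4 (2 + size (f x) + size (g x)) ?s5"
      using exec.Assign[of N "NodeE (Var (N+1)) (Var (N+2))" s4] s4N 4(2) by simp
    have "exec ?P s (1 + size (c x) + (n2 + (1 + size (c x) + (n4 + (2 + size (f x) + size (g x)))))) ?s5"
      by (rule exec.Seq[OF e1 exec.Seq[OF 2(1) exec.Seq[OF e3 exec.Seq[OF 4(1) e5]]]])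
    moreover have "\<forall>i<N. ?s5 i = s i" using 2(3) 4(3) by auto
    ultimately show ?thesis using 2(4) 4(4)
      by (intro exI[of _ ?s5] exI[of _ "1 + size (c x) + (n2 + (1 + size (c x) + (n4 + (2 + size (f x) + size (g x)))))"] conjI) auto
  qed
  show ?case
    by (intro exI[of _ ?P] exI[of _ ?T] conjI ballI allI impI tm ex)
qed

text \<open>Each branch has to work only on the part of the domain where it is taken. This allows
  partial operations, such as the head of a list, behind a test.\<close>

lemma ptime_if_Leaf:
  assumes b: "ptime D c b"
    and f: "ptime {x \<in> D. b x \<noteq> Leaf} c f" and g: "ptime {x \<in> D. b x = Leaf} c g"
  shows "ptime D c (\<lambda>x. if b x \<noteq> Leaf then f x else g x)"
proof (rule ptimeI, goal_cases)
  case (1 N)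
  obtain pb qb where pb: "runs (N+1) pb qb D c b"
    using b unfolding ptime_def by blast
  obtain p q where p: "runs N p q {x \<in> D. b x \<noteq> Leaf} c f" using f unfolding ptime_def by blast
  obtain p' q' where p': "runs N p' q' {x \<in> D. b x = Leaf} c g" using g unfolding ptime_def by blast
  let ?P = "Seq (Assign (N+1) (Var N)) (Seq pb (Cond (Var (N+1)) p p'))"
  let ?T = "\<lambda>x. 1 + size (c x) + (poly qb (size (c x)) + (1 + (poly q (size (c x)) + poly q' (size (c x)))))"
  have tm: "poly_bounded D (\<lambda>x. size (c x)) ?T"
    by (intro poly_bounded_add poly_bounded_poly poly_bounded_self poly_bounded_const)
  have ex: "\<exists>n s'. exec ?P s n s' \<and> s' N = (if b x \<noteq> Leaf then f x else g x) \<and> (\<forall>i<N. s' i = s i) \<and> n \<le> ?T x"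
    if x: "x \<in> D" and s: "s N = c x" for x s
  proof -
    let ?s1 = "s(N+1 := c x)"
    have e1: "exec (Assign (N+1) (Var N)) s (1 + size (c x)) ?s1"
      using exec.Assign[of "N+1" "Var N" s] s by simp
    obtain n2 s2 where 2: "exec pb ?s1 n2 s2" "s2 (N+1) = b x" "\<forall>i<N+1. s2 i = ?s1 i"
       "n2 \<le> poly qb (size (c x))"
      using runsD[where s = "?s1", OF pb x] by auto
    then have s2N: "s2 N = c x" using s by simp
    obtain n3 s3 where 3: "exec (Cond (Var (N+1)) p p') s2 (1 + n3) s3"
      "s3 N = (if b x \<noteq> Leaf then f x else g x)" "\<forall>i<N. s3 i = s2 i"
      "n3 \<le> poly q (size (c x)) + poly q' (size (c x))"
    proof (cases "b x \<noteq> Leaf")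
      case True
      then obtain n3 s3 where "exec p s2 n3 s3" "s3 N = f x" "\<forall>i<N. s3 i = s2 i" "n3 \<le> poly q (size (c x))"
        using runsD[where x = x and s = s2, OF p] x s2N by auto
      moreover have "s2 (N+1) \<noteq> Leaf" using 2(2) True by simp
      ultimately show ?thesis using True exec.CondTrue[of "Var (N+1)" s2]
        by (intro that[of n3 s3]) simp_all
    next
      case False
      then obtain n3 s3 where "exec p' s2 n3 s3" "s3 N = g x" "\<forall>i<N. s3 i = s2 i" "n3 \<le> poly q' (size (c x))"
        using runsD[where x = x and s = s2, OF p'] x s2N by auto
      moreover have "s2 (N+1) = Leaf" using 2(2) False by simp
      ultimately show ?thesis using False exec.CondFalse[of "Var (N+1)" s2]
        by (intro that[of n3 s3]) simp_all
    qed
    have "exec ?P s (1 + size (c x) + (n2 + (1 + n3))) s3"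
      by (rule exec.Seq[OF e1 exec.Seq[OF 2(1) 3(1)]])
    then show ?thesis using 2 3
      by (intro exI[of _ s3] exI[of _ "1 + size (c x) + (n2 + (1 + n3))"] conjI) auto
  qed
  show ?case
    by (intro exI[of _ ?P] exI[of _ ?T] conjI ballI allI impI tm ex)
qed

lemma ptime_if:
  assumes "ptime D c (\<lambda>x. code_bool (b x))"
    and "ptime {x \<in> D. b x} c f" and "ptime {x \<in> D. \<not> b x} c g"
  shows "ptime D c (\<lambda>x. if b x then f x else g x)"
proof -
  have "(code_bool p \<noteq> Leaf) = p" "(code_bool p = Leaf) = (\<not> p)" for p
    by (simp_all add: code_bool_def)
  then show ?thesis using ptime_if_Leaf[of D c "\<lambda>x. code_bool (b x)" f g] assms by simp
qed

section \<open>Loops over lists\<close>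

lemma code_list_simps [simp]:
  "code_list c [] = Leaf" "code_list c (x # xs) = Node (c x) (code_list c xs)"
  by (simp_all add: code_list_def)

lemma size_code_list: "size (code_list c xs) = length xs + (\<Sum>x\<leftarrow>xs. size (c x))"
  by (induction xs) auto

lemma length_le_size_code_list: "length xs \<le> size (code_list c xs)"
  by (simp add: size_code_list)

lemma size_code_list_append: "size (code_list c (xs @ ys)) = size (code_list c xs) + size (code_list c ys)"
  by (simp add: size_code_list)

text \<open>What the body of a loop receives: the parameter of the whole loop, the current element
  and the accumulator.\<close>

definition step_code :: "('a \<Rightarrow> data) \<Rightarrow> ('e \<Rightarrow> data) \<Rightarrow> ('b \<Rightarrow> data) \<Rightarrow> 'a \<times> 'e \<times> 'b \<Rightarrow> data" where
  "step_code c ce cb y = Node (c (fst y)) (Node (ce (fst (snd y))) (cb (snd (snd y))))"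

text \<open>A loop of polynomial-time steps may double its accumulator every time, hence the
  separate bound \<open>bd\<close> on all intermediate results. Step and bound concern only states
  that occur in an actual run, so invariants of the loop may be used for them.\<close>

lemma ptime_fold:
  assumes xs: "ptime D c (\<lambda>x. code_list ce (xs x))" and a: "ptime D c (\<lambda>x. cb (a x))"
    and step: "ptime {(x, e, b). x \<in> D \<and> (\<exists>ys zs. xs x = ys @ e # zs \<and> b = fold (g x) ys (a x))}
       (step_code c ce cb) (\<lambda>y. cb (g (fst y) (fst (snd y)) (snd (snd y))))"
    and bd: "poly_bounded {(x, ys). x \<in> D \<and> (\<exists>zs. xs x = ys @ zs)} (\<lambda>y. size (c (fst y)))
       (\<lambda>y. size (cb (fold (g (fst y)) (snd y) (a (fst y)))))"
  shows "ptime D c (\<lambda>x. cb (fold (g x) (xs x) (a x)))"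
proof (rule ptimeI, goal_cases)
  case (1 N)
  obtain p1 q1 where p1: "runs (N+1) p1 q1 D c (\<lambda>x. code_list ce (xs x))"
    using xs unfolding ptime_def by blast
  obtain p2 q2 where p2: "runs (N+2) p2 q2 D c (\<lambda>x. cb (a x))"
    using a unfolding ptime_def by blast
  obtain p3 q3 where p3: "runs (N+3) p3 q3 {(x, e, b). x \<in> D \<and> (\<exists>ys zs. xs x = ys @ e # zs \<and> b = fold (g x) ys (a x))}
       (step_code c ce cb) (\<lambda>y. cb (g (fst y) (fst (snd y)) (snd (snd y))))"
    using step unfolding ptime_def by blast
  obtain Q where Q0: "\<forall>y \<in> {(x, ys). x \<in> D \<and> (\<exists>zs. xs x = ys @ zs)}.
      size (cb (fold (g (fst y)) (snd y) (a (fst y)))) \<le> poly Q (size (c (fst y)))"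
    using bd unfolding poly_bounded_def by blast
  have Q: "size (cb (fold (g x) ys (a x))) \<le> poly Q (size (c x))"
    if "x \<in> D" "xs x = ys @ zs" for x ys zs
    using bspec[OF Q0, of "(x, ys)"] that by auto
  \<comment> \<open>Layout: the parameter in \<open>N\<close>, the unread list in
    \<open>N+1\<close>, the accumulator in \<open>N+2\<close>. The step has its base at
    \<open>N+3\<close> and therefore leaves the other three alone.\<close>
  let ?B = "Seq (Assign (N+3) (NodeE (Var N) (NodeE (HdE (Var (N+1))) (Var (N+2)))))
    (Seq p3 (Seq (Assign (N+2) (Var (N+3))) (Assign (N+1) (TlE (Var (N+1))))))"
  let ?L = "While (Var (N+1)) ?B"
  let ?P = "Seq (Assign (N+1) (Var N)) (Seq p1 (Seq (Assign (N+2) (Var N)) (Seq p2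
     (Seq ?L (Assign N (Var (N+2)))))))"
  let ?l = "\<lambda>x. size (code_list ce (xs x))"
  let ?b = "\<lambda>x. poly Q (size (c x))"
  \<comment> \<open>\<open>?e\<close> bounds the input of a step and \<open>?K\<close> the cost of a
    round. Both depend on the parameter of the loop only, so they are the same in every
    round.\<close>
  let ?e = "\<lambda>x. 2 + size (c x) + ?l x + ?b x"
  let ?K = "\<lambda>x. 1 + (1 + ?e x + (poly q3 (?e x) + (1 + ?b x + (1 + ?l x))))"
  let ?T = "\<lambda>x. 1 + size (c x) + (poly q1 (size (c x)) + (1 + size (c x) + (poly q2 (size (c x)) +
     ((?l x * ?K x + 1) + (1 + ?b x)))))"
  have tm: "poly_bounded D (\<lambda>x. size (c x)) ?T"
    by (intro poly_bounded_add poly_bounded_poly ptime_poly_bounded[OF xs] poly_bounded_mult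
      poly_bounded_self poly_bounded_const)
  have ex: "\<exists>n s'. exec ?P s n s' \<and> s' N = cb (fold (g x) (xs x) (a x)) \<and> (\<forall>i<N. s' i = s i) \<and> n \<le> ?T x"
    if x: "x \<in> D" and s: "s N = c x" for x s
  proof -
    have loop: "\<exists>n s'. exec ?L s n s' \<and> s' (N+2) = cb (fold (g x) (xs x) (a x)) \<and> (\<forall>i\<le>N. s' i = s i)
        \<and> n \<le> length zs * ?K x + 1"
      if "xs x = ys @ zs" "s N = c x" "s (N+1) = code_list ce zs" "s (N+2) = cb (fold (g x) ys (a x))"
      for ys zs s
      using that
    proof (induction zs arbitrary: ys s)
      case Nil
      then have "exec ?L s 1 s" by (intro exec.WhileFalse) simp
      then show ?case using Nil by (intro exI[of _ 1] exI[of _ s] conjI) simp_all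
    next
      case (Cons e zs)
      let ?acc = "fold (g x) ys (a x)"
      let ?d = "step_code c ce cb (x, e, ?acc)"
      let ?s1 = "s(N+3 := ?d)"
      have szl: "size (ce e) + size (code_list ce zs) \<le> ?l x"
        by (simp add: Cons.prems(1) size_code_list)
      have szd: "size ?d \<le> ?e x"
        using szl Q[OF x Cons.prems(1)] by (simp add: step_code_def)
      have e1: "exec (Assign (N+3) (NodeE (Var N) (NodeE (HdE (Var (N+1))) (Var (N+2))))) s (1 + size ?d) ?s1"
        using exec.Assign[of "N+3" "NodeE (Var N) (NodeE (HdE (Var (N+1))) (Var (N+2)))" s] Cons.prems
        by (simp add: step_code_def)
      obtain n2 s2 where 2: "exec p3 ?s1 n2 s2" "s2 (N+3) = cb (g x e ?acc)" "\<forall>i<N+3. s2 i = ?s1 i"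
         "n2 \<le> poly q3 (size ?d)"
        using runsD[where x = "(x, e, ?acc)" and s = ?s1, OF p3] x Cons.prems(1) by auto
      let ?s3 = "s2(N+2 := cb (g x e ?acc))"
      have e3: "exec (Assign (N+2) (Var (N+3))) s2 (1 + size (cb (g x e ?acc))) ?s3"
        using exec.Assign[of "N+2" "Var (N+3)" s2] 2(2) by simp
      let ?s4 = "?s3(N+1 := code_list ce zs)"
      have "?s3 (N+1) = code_list ce (e # zs)" using 2(3) Cons.prems(3) by simp
      then have e4: "exec (Assign (N+1) (TlE (Var (N+1)))) ?s3 (1 + size (code_list ce zs)) ?s4"
        using exec.Assign[of "N+1" "TlE (Var (N+1))" ?s3] by simp
      have n2: "n2 \<le> poly q3 (?e x)" using 2(4) poly_nat_mono[OF szd] by (rule order_trans)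
      have sza: "size (cb (g x e ?acc)) \<le> ?b x"
        using Q[OF x, of "ys @ [e]" zs] Cons.prems(1) by simp
      have s4: "\<forall>i\<le>N. ?s4 i = s i" using 2(3) by auto
      have "\<exists>n s'. exec ?L ?s4 n s' \<and> s' (N+2) = cb (fold (g x) (xs x) (a x)) \<and> (\<forall>i\<le>N. s' i = ?s4 i)
        \<and> n \<le> length zs * ?K x + 1"
        using s4 Cons.prems by (intro Cons.IH[of "ys @ [e]" ?s4]) auto
      then obtain n5 s5 where 5: "exec ?L ?s4 n5 s5" "s5 (N+2) = cb (fold (g x) (xs x) (a x))"
         "\<forall>i\<le>N. s5 i = ?s4 i" "n5 \<le> length zs * ?K x + 1" by blast
      let ?n = "1 + size ?d + (n2 + (1 + size (cb (g x e ?acc)) + (1 + size (code_list ce zs))))"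
      have "exec ?B s ?n ?s4" by (rule exec.Seq[OF e1 exec.Seq[OF 2(1) exec.Seq[OF e3 e4]]])
      moreover have "eval_expr (Var (N+1)) s \<noteq> Leaf" using Cons.prems(3) by simp
      ultimately have "exec ?L s (1 + ?n + n5) s5" using 5(1) exec.WhileTrue by blast
      moreover have "1 + ?n + n5 \<le> length (e # zs) * ?K x + 1"
      proof -
        have "1 + ?n \<le> ?K x" using szd n2 sza szl by linarith
        then show ?thesis using 5(4) by simp
      qed
      ultimately show ?case using 5(2,3) s4 by (intro exI[of _ "1 + ?n + n5"] exI[of _ s5]) auto
    qed
    let ?s1 = "s(N+1 := c x)"
    have e1: "exec (Assign (N+1) (Var N)) s (1 + size (c x)) ?s1"
      using exec.Assign[of "N+1" "Var N" s] s by simp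
    obtain n2 s2 where 2: "exec p1 ?s1 n2 s2" "s2 (N+1) = code_list ce (xs x)" "\<forall>i<N+1. s2 i = ?s1 i"
       "n2 \<le> poly q1 (size (c x))"
      using runsD[where s = "?s1", OF p1 x] by auto
    then have s2N: "s2 N = c x" using s by simp
    let ?s3 = "s2(N+2 := c x)"
    have e3: "exec (Assign (N+2) (Var N)) s2 (1 + size (c x)) ?s3"
      using exec.Assign[of "N+2" "Var N" s2] s2N by simp
    obtain n4 s4 where 4: "exec p2 ?s3 n4 s4" "s4 (N+2) = cb (a x)" "\<forall>i<N+2. s4 i = ?s3 i"
       "n4 \<le> poly q2 (size (c x))"
      using runsD[where s = "?s3", OF p2 x] by auto
    have "\<exists>n s'. exec ?L s4 n s' \<and> s' (N+2) = cb (fold (g x) (xs x) (a x)) \<and> (\<forall>i\<le>N. s' i = s4 i)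
        \<and> n \<le> length (xs x) * ?K x + 1"
      using 2 4 s2N by (intro loop[of "[]"]) auto
    then obtain n5 s5 where 5: "exec ?L s4 n5 s5" "s5 (N+2) = cb (fold (g x) (xs x) (a x))"
       "\<forall>i\<le>N. s5 i = s4 i" "n5 \<le> length (xs x) * ?K x + 1" by blast
    let ?r = "cb (fold (g x) (xs x) (a x))"
    have e6: "exec (Assign N (Var (N+2))) s5 (1 + size ?r) (s5(N := ?r))"
      using exec.Assign[of N "Var (N+2)" s5] 5(2) by simp
    let ?n = "1 + size (c x) + (n2 + (1 + size (c x) + (n4 + (n5 + (1 + size ?r)))))"
    have ex: "exec ?P s ?n (s5(N := ?r))"
      by (rule exec.Seq[OF e1 exec.Seq[OF 2(1) exec.Seq[OF e3 exec.Seq[OF 4(1) exec.Seq[OF 5(1) e6]]]]])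
    have sr: "size ?r \<le> ?b x" using Q[OF x, of "xs x" "[]"] by simp
    have "length (xs x) * ?K x \<le> ?l x * ?K x"
      by (rule mult_right_mono[OF length_le_size_code_list]) simp
    then have "n5 \<le> ?l x * ?K x + 1" using 5(4) by linarith
    then have "?n \<le> ?T x" using 2(4) 4(4) sr by linarith
    moreover have "\<forall>i<N. (s5(N := ?r)) i = s i" using 2(3) 4(3) 5(3) by auto
    ultimately show ?thesis using ex
      by (intro exI[of _ ?n] exI[of _ "s5(N := ?r)"] conjI) auto
  qed
  show ?case
    by (intro exI[of _ ?P] exI[of _ ?T] conjI ballI allI impI tm ex)
qed

section \<open>Calls, loop bodies and truth values\<close>

lemma ptime_call:
  assumes "ptime D c (\<lambda>x. c' (h x))" and "ptime E c' f" and "\<And>x. x \<in> D \<Longrightarrow> h x \<in> E"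
  shows "ptime D c (\<lambda>x. f (h x))"
  by (rule ptime_trans[OF assms(1)], rule ptime_mono[OF assms(2), where h = h]) (use assms(3) in auto)

lemma ptime_step_input:
  assumes "ptime D c f" and "\<And>y. y \<in> E \<Longrightarrow> fst y \<in> D"
  shows "ptime E (step_code c ce cb) (\<lambda>y. f (fst y))"
proof (rule ptime_call[OF _ assms(1)])
  show "ptime E (step_code c ce cb) (\<lambda>y. c (fst y))"
    by (rule ptime_cong[OF ptime_hd[OF ptime_id]]) (simp add: step_code_def)
qed (rule assms(2))

lemma ptime_step_elem: "ptime E (step_code c ce cb) (\<lambda>y. ce (fst (snd y)))"
  by (rule ptime_cong[OF ptime_hd[OF ptime_tl[OF ptime_id]]]) (simp add: step_code_def)

lemma ptime_step_acc: "ptime E (step_code c ce cb) (\<lambda>y. cb (snd (snd y)))"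
  by (rule ptime_cong[OF ptime_tl[OF ptime_tl[OF ptime_id]]]) (simp add: step_code_def)

lemma ptime_fst: "ptime D c (\<lambda>x. code_pair ca cb (f x)) \<Longrightarrow> ptime D c (\<lambda>x. ca (fst (f x)))"
  by (drule ptime_hd) (simp add: code_pair_def)

lemma ptime_snd: "ptime D c (\<lambda>x. code_pair ca cb (f x)) \<Longrightarrow> ptime D c (\<lambda>x. cb (snd (f x)))"
  by (drule ptime_tl) (simp add: code_pair_def)

lemma ptime_Pair:
  "ptime D c (\<lambda>x. ca (f x)) \<Longrightarrow> ptime D c (\<lambda>x. cb (g x)) \<Longrightarrow> ptime D c (\<lambda>x. code_pair ca cb (f x, g x))"
  unfolding code_pair_def fst_conv snd_conv by (rule ptime_Node)

lemma ptime_pair_input: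
  assumes "ptime D c f" and "\<And>y. y \<in> E \<Longrightarrow> fst y \<in> D"
  shows "ptime E (code_pair c ce) (\<lambda>y. f (fst y))"
proof (rule ptime_call[OF _ assms(1)])
  show "ptime E (code_pair c ce) (\<lambda>y. c (fst y))"
    by (rule ptime_cong[OF ptime_hd[OF ptime_id]]) (simp add: code_pair_def)
qed (rule assms(2))

lemma ptime_pair_elem: "ptime E (code_pair c ce) (\<lambda>y. ce (snd y))"
  by (rule ptime_snd[OF ptime_id])

lemma size_code_bool: "size (code_bool b) \<le> 1"
  by (simp add: code_bool_def)

lemma ptime_True: "ptime D c (\<lambda>_. code_bool True)"
  by (rule ptime_const)

lemma ptime_False: "ptime D c (\<lambda>_. code_bool False)"
  by (rule ptime_const)

lemma ptime_not_Leaf: "ptime D c f \<Longrightarrow> ptime D c (\<lambda>x. code_bool (f x \<noteq> Leaf))"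
  by (rule ptime_cong[OF ptime_if_Leaf[OF _ ptime_True ptime_False]]) (auto simp: code_bool_def)

lemma ptime_conj:
  assumes "ptime D c (\<lambda>x. code_bool (a x))" and "ptime D c (\<lambda>x. code_bool (b x))"
  shows "ptime D c (\<lambda>x. code_bool (a x \<and> b x))"
  by (rule ptime_cong[OF ptime_if[OF assms(1) ptime_subset[OF assms(2)] ptime_False]]) auto

lemma ptime_iff:
  assumes "ptime D c (\<lambda>x. code_bool (a x))" and "ptime D c (\<lambda>x. code_bool (b x))"
  shows "ptime D c (\<lambda>x. code_bool (a x = b x))"
proof -
  have "ptime D c (\<lambda>x. if b x then code_bool False else code_bool True)"
    by (rule ptime_if[OF assms(2) ptime_False ptime_True])
  then show ?thesis
    by (intro ptime_cong[OF ptime_if[OF assms(1) ptime_subset[OF assms(2)] ptime_subset]]) auto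
qed

lemma ptime_If:
  assumes "ptime D c (\<lambda>x. code_bool (b x))"
    and "ptime D c (\<lambda>x. cb (f x))" and "ptime D c (\<lambda>x. cb (g x))"
  shows "ptime D c (\<lambda>x. cb (if b x then f x else g x))"
  by (rule ptime_cong[OF ptime_if[OF assms(1) ptime_subset[OF assms(2)] ptime_subset[OF assms(3)]]]) auto

text \<open>Growth by at most \<open>K x\<close> per step, whatever the accumulator, adds up to a
  polynomial. The step is then analysed for arbitrary accumulators, so no invariant of the loop is
  involved.\<close>

lemma ptime_fold_increment:
  assumes xs: "ptime D c (\<lambda>x. code_list ce (xs x))" and a: "ptime D c (\<lambda>x. cb (a x))"
    and step: "ptime {(x, e, b). x \<in> D \<and> e \<in> set (xs x)}
       (step_code c ce cb) (\<lambda>y. cb (g (fst y) (fst (snd y)) (snd (snd y))))"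
    and K: "poly_bounded D (\<lambda>x. size (c x)) K"
    and inc: "\<And>x e b. x \<in> D \<Longrightarrow> e \<in> set (xs x) \<Longrightarrow> size (cb (g x e b)) \<le> size (cb b) + K x"
  shows "ptime D c (\<lambda>x. cb (fold (g x) (xs x) (a x)))"
proof (rule ptime_fold[where cb = cb and ce = ce and xs = xs and a = a and g = g, OF xs a])
  show "ptime {(x, e, b). x \<in> D \<and> (\<exists>ys zs. xs x = ys @ e # zs \<and> b = fold (g x) ys (a x))}
       (step_code c ce cb) (\<lambda>y. cb (g (fst y) (fst (snd y)) (snd (snd y))))"
    by (rule ptime_subset[OF step]) auto
  have le: "size (cb (fold (g x) ys (a x))) \<le> size (cb (a x)) + length ys * K x"
    if "x \<in> D" "set ys \<subseteq> set (xs x)" for x ys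
    using that(2)
  proof (induction ys rule: rev_induct)
    case (snoc y ys)
    then show ?case using inc[OF that(1), of y "fold (g x) ys (a x)"] by simp
  qed simp
  let ?E = "{(x, ys). x \<in> D \<and> (\<exists>zs. xs x = ys @ zs)}"
  have "poly_bounded D (\<lambda>x. size (c x)) (\<lambda>x. size (cb (a x)) + size (code_list ce (xs x)) * K x)"
    by (intro poly_bounded_add poly_bounded_mult ptime_poly_bounded[OF a] ptime_poly_bounded[OF xs] K)
  then obtain Q where Q: "\<forall>x\<in>D. size (cb (a x)) + size (code_list ce (xs x)) * K x \<le> poly Q (size (c x))"
    unfolding poly_bounded_def by blast
  show "poly_bounded ?E (\<lambda>y. size (c (fst y))) (\<lambda>y. size (cb (fold (g (fst y)) (snd y) (a (fst y)))))"
  proof (rule poly_boundedI)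
    fix y assume "y \<in> ?E"
    then obtain x ys zs where y: "y = (x, ys)" "x \<in> D" "xs x = ys @ zs" by auto
    have "length ys \<le> size (code_list ce (xs x))"
      using length_le_size_code_list[of "xs x" ce] y(3) by simp
    then have "length ys * K x \<le> size (code_list ce (xs x)) * K x" by (rule mult_right_mono) simp
    moreover have "size (cb (a x)) + size (code_list ce (xs x)) * K x \<le> poly Q (size (c x))"
      using Q y(2) by blast
    moreover have "size (cb (fold (g x) ys (a x))) \<le> size (cb (a x)) + length ys * K x"
      using le[OF y(2)] y(3) by simp
    ultimately show "size (cb (fold (g (fst y)) (snd y) (a (fst y)))) \<le> poly Q (size (c (fst y)))"
      unfolding y(1) fst_conv snd_conv by linarith
  qed
qed

section \<open>Functions on lists\<close>

lemma ptime_Cons: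
  "ptime D c (\<lambda>x. ce (f x)) \<Longrightarrow> ptime D c (\<lambda>x. code_list ce (g x)) \<Longrightarrow> ptime D c (\<lambda>x. code_list ce (f x # g x))"
  by (simp add: ptime_Node)

lemma ptime_Nil: "ptime D c (\<lambda>_. code_list ce [])"
  by (rule ptime_const)

lemma size_elem_le_code_list: "x \<in> set xs \<Longrightarrow> size (c x) \<le> size (code_list c xs)"
  by (induction xs) auto

text \<open>Folding \<open>Cons\<close> reverses, so the reversing version is the primitive one, and
  appending is obtained from it by reversing twice.\<close>

lemma ptime_rev_append:
  assumes "ptime D c (\<lambda>x. code_list ce (xs x))" and "ptime D c (\<lambda>x. code_list ce (ys x))"
  shows "ptime D c (\<lambda>x. code_list ce (rev (xs x) @ ys x))"
proof -
  have "ptime D c (\<lambda>x. code_list ce (fold ((\<lambda>_. Cons) x) (xs x) (ys x)))"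
  proof (rule ptime_fold_increment[where cb = "code_list ce" and ce = ce and xs = xs and a = ys and g = "\<lambda>_. Cons"
      and K = "\<lambda>x. 1 + size (code_list ce (xs x))", OF assms])
    show "ptime {(x, e, b). x \<in> D \<and> e \<in> set (xs x)} (step_code c ce (code_list ce))
     (\<lambda>y. code_list ce (fst (snd y) # snd (snd y)))"
      by (intro ptime_Cons ptime_step_elem ptime_step_acc)
    show "poly_bounded D (\<lambda>x. size (c x)) (\<lambda>x. 1 + size (code_list ce (xs x)))"
      by (intro poly_bounded_add ptime_poly_bounded assms poly_bounded_const)
    show "size (code_list ce (e # b)) \<le> size (code_list ce b) + (1 + size (code_list ce (xs x)))"
      if "e \<in> set (xs x)" for x e b using size_elem_le_code_list[OF that, of ce] by simp
  qed
  moreover have "fold Cons xs ys = rev xs @ ys" for xs ys :: "'b list"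
    by (induction xs arbitrary: ys) auto
  ultimately show ?thesis by simp
qed

lemma ptime_rev: "ptime D c (\<lambda>x. code_list ce (xs x)) \<Longrightarrow> ptime D c (\<lambda>x. code_list ce (rev (xs x)))"
  using ptime_rev_append[OF _ ptime_Nil, of D c ce xs] by simp

lemma ptime_append:
  "ptime D c (\<lambda>x. code_list ce (xs x)) \<Longrightarrow> ptime D c (\<lambda>x. code_list ce (ys x)) \<Longrightarrow>
     ptime D c (\<lambda>x. code_list ce (xs x @ ys x))"
  using ptime_rev_append[OF ptime_rev, of D c ce xs ys] by simp

lemma ptime_map:
  assumes xs: "ptime D c (\<lambda>x. code_list ce (xs x))"
    and f: "ptime {(x, e). x \<in> D \<and> e \<in> set (xs x)} (code_pair c ce) (\<lambda>y. cd (f (fst y) (snd y)))"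
  shows "ptime D c (\<lambda>x. code_list cd (map (f x) (xs x)))"
proof -
  let ?E = "{(x, e). x \<in> D \<and> e \<in> set (xs x)}"
  \<comment> \<open>Each element lets the result grow by the size of \<open>f x e\<close>, which is
    polynomially bounded because \<open>f\<close> itself is computed in polynomial time.\<close>
  obtain Q where Q0: "\<forall>y\<in>?E. size (cd (f (fst y) (snd y))) \<le> poly Q (size (code_pair c ce y))"
    using ptime_poly_bounded[OF f] unfolding poly_bounded_def by blast
  have Q: "size (cd (f x e)) \<le> poly Q (1 + size (c x) + size (code_list ce (xs x)))"
    if "x \<in> D" "e \<in> set (xs x)" for x e
  proof -
    have "size (cd (f x e)) \<le> poly Q (size (code_pair c ce (x, e)))"
      using bspec[OF Q0, of "(x, e)"] that by simp
    also have "\<dots> \<le> poly Q (1 + size (c x) + size (code_list ce (xs x)))"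
      using size_elem_le_code_list[OF that(2), of ce] by (intro poly_nat_mono) (simp add: code_pair_def)
    finally show ?thesis .
  qed
  have "ptime D c (\<lambda>x. code_list cd (fold ((\<lambda>x e b. f x e # b) x) (xs x) []))"
  proof (rule ptime_fold_increment[where cb = "code_list cd" and ce = ce and xs = xs and a = "\<lambda>_. []" and
      g = "\<lambda>x e b. f x e # b" and K = "\<lambda>x. 1 + poly Q (1 + size (c x) + size (code_list ce (xs x)))", OF xs ptime_Nil])
    have "ptime {(x, e, b). x \<in> D \<and> e \<in> set (xs x)} (step_code c ce (code_list cd))
        (\<lambda>y. code_pair c ce (fst y, fst (snd y)))"
      by (intro ptime_Pair ptime_step_elem ptime_step_input[OF ptime_id]) auto
    from ptime_call[OF this f]
    have "ptime {(x, e, b). x \<in> D \<and> e \<in> set (xs x)} (step_code c ce (code_list cd))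
        (\<lambda>y. cd (f (fst y) (fst (snd y))))"
      by (auto simp: case_prod_unfold)
    then show "ptime {(x, e, b). x \<in> D \<and> e \<in> set (xs x)} (step_code c ce (code_list cd))
     (\<lambda>y. code_list cd (f (fst y) (fst (snd y)) # snd (snd y)))"
      by (intro ptime_Cons ptime_step_acc)
    show "poly_bounded D (\<lambda>x. size (c x)) (\<lambda>x. 1 + poly Q (1 + size (c x) + size (code_list ce (xs x))))"
      by (intro poly_bounded_add poly_bounded_poly ptime_poly_bounded xs poly_bounded_const poly_bounded_self)
    show "size (code_list cd (f x e # b))
        \<le> size (code_list cd b) + (1 + poly Q (1 + size (c x) + size (code_list ce (xs x))))"
      if "x \<in> D" "e \<in> set (xs x)" for x e b using Q[OF that] by simp
  qed
  moreover have "fold (\<lambda>e b. f x e # b) xs b = rev (map (f x) xs) @ b" for x xs b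
    by (induction xs arbitrary: b) auto
  ultimately have "ptime D c (\<lambda>x. code_list cd (rev (map (f x) (xs x))))" by simp
  from ptime_rev[OF this] show ?thesis by simp
qed

section \<open>Arithmetic on binary numbers\<close>

lemma code_nat_0 [simp]: "code_nat 0 = Leaf"
  by (simp add: code_nat_def bits.simps)

lemma code_nat_eq_Leaf [simp]: "code_nat n = Leaf \<longleftrightarrow> n = 0"
  using inj_code_nat[THEN injD, of n 0] by auto

lemma bits_0 [simp]: "bits 0 = []"
  by (simp add: bits.simps)

lemma bits_Suc_0 [simp]: "bits (Suc 0) = [True]"
  by (simp add: bits.simps)

lemma bits_double [simp]: "b \<or> n \<noteq> 0 \<Longrightarrow> bits (of_bool b + 2 * n) = b # bits n"
  by (subst bits.simps) auto

lemma code_nat_double: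
  "code_nat (of_bool b + 2 * n) = (if b \<or> n \<noteq> 0 then Node (code_bool b) (code_nat n) else Leaf)"
  by (simp add: code_nat_def del: of_bool_eq)

lemma nat_double_cases:
  fixes n :: nat
  obtains b m where "n = of_bool b + 2 * m"
  by (rule that[of "odd n" "n div 2"]) (cases "even n"; simp)

lemma code_nat_split: "n \<noteq> 0 \<Longrightarrow> code_nat n = Node (code_bool (odd n)) (code_nat (n div 2))"
  by (simp add: code_nat_def bits.simps[of n])

lemma hd_code_nat: "hd_data (code_nat n) = code_bool (odd n)"
  by (cases "n = 0") (auto simp: code_nat_split code_bool_def)

lemma tl_code_nat: "tl_data (code_nat n) = code_nat (n div 2)"
  by (cases "n = 0") (auto simp: code_nat_split)

lemma ptime_odd: "ptime D c (\<lambda>x. code_nat (n x)) \<Longrightarrow> ptime D c (\<lambda>x. code_bool (odd (n x)))"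
  by (drule ptime_hd) (simp add: hd_code_nat)

lemma ptime_div2: "ptime D c (\<lambda>x. code_nat (n x)) \<Longrightarrow> ptime D c (\<lambda>x. code_nat (n x div 2))"
  by (drule ptime_tl) (simp add: tl_code_nat)

lemma ptime_is_0: "ptime D c (\<lambda>x. code_nat (n x)) \<Longrightarrow> ptime D c (\<lambda>x. code_bool (n x = 0))"
  using ptime_iff[OF ptime_not_Leaf ptime_False, of D c "\<lambda>x. code_nat (n x)"] by simp

text \<open>Codes have no leading zeros, so a zero bit must not be attached to the empty code of
  \<open>0\<close>; this is the reason for the case distinction.\<close>

lemma ptime_double:
  assumes b: "ptime D c (\<lambda>x. code_bool (b x))" and n: "ptime D c (\<lambda>x. code_nat (n x))"
  shows "ptime D c (\<lambda>x. code_nat (of_bool (b x) + 2 * n x))"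
proof -
  have r: "ptime D c (\<lambda>x. Node (code_bool (b x)) (code_nat (n x)))" by (rule ptime_Node[OF b n])
  have "ptime D c (\<lambda>x. if n x = 0 then if b x then Node (code_bool (b x)) (code_nat (n x)) else Leaf
     else Node (code_bool (b x)) (code_nat (n x)))"
    by (intro ptime_if ptime_is_0 n ptime_subset[OF b] ptime_subset[OF r] ptime_const) auto
  then show ?thesis by (rule ptime_cong) (simp add: code_nat_double)
qed

lemma size_code_nat_double: "size (code_nat (of_bool b + 2 * n)) \<le> size (code_nat n) + 2"
  by (simp add: code_nat_double code_bool_def)

lemma size_code_nat_shift: "size (code_nat (2 ^ l * n)) \<le> size (code_nat n) + 2 * l"
proof (induction l)
  case (Suc l)
  then show ?case using size_code_nat_double[of False "2 ^ l * n"] by (simp add: mult.assoc)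
qed simp

text \<open>Each bit costs at most two units: one for the list node, and one more if the bit is
  set.\<close>

lemma size_code_nat_less: "n < 2 ^ l \<Longrightarrow> size (code_nat n) \<le> 2 * l"
proof (induction l arbitrary: n)
  case (Suc l)
  obtain b m where n: "n = of_bool b + 2 * m" by (rule nat_double_cases)
  with Suc.prems have "m < 2 ^ l" by (cases b) auto
  then show ?case using Suc.IH[of m] size_code_nat_double[of b m] n by simp
qed simp

lemma size_code_nat_le: "size (code_nat n) \<le> 2 * n"
  by (rule size_code_nat_less) simp

lemma ptime_shift:
  assumes "ptime D c (\<lambda>x. code_list ce (xs x))" and "ptime D c (\<lambda>x. code_nat (n x))"
  shows "ptime D c (\<lambda>x. code_nat (2 ^ length (xs x) * n x))"
proof -
  have "ptime D c (\<lambda>x. code_nat (fold ((\<lambda>_ _ n. of_bool False + 2 * n) x) (xs x) (n x)))"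
  proof (rule ptime_fold_increment[where cb = code_nat and ce = ce and xs = xs and a = n and
      g = "\<lambda>_ _ n. of_bool False + 2 * n" and K = "\<lambda>_. 2", OF assms])
    show "ptime {(x, e, b). x \<in> D \<and> e \<in> set (xs x)} (step_code c ce code_nat)
     (\<lambda>y. code_nat (of_bool False + 2 * snd (snd y)))"
      by (intro ptime_double ptime_False ptime_step_acc)
  qed (rule poly_bounded_const, rule size_code_nat_double)
  moreover have "fold (\<lambda>_ n. 2 * n) xs n = 2 ^ length xs * n" for xs :: "'b list" and n :: nat
    by (induction xs arbitrary: n) auto
  ultimately show ?thesis by simp
qed

text \<open>The last bit of the list becomes the least significant one, so the list is consumed with
  the most significant bit first, and the bits are placed below \<open>n\<close>.\<close>

lemma ptime_horner:
  assumes bs: "ptime D c (\<lambda>x. code_list code_bool (bs x))" and n: "ptime D c (\<lambda>x. code_nat (n x))"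
  shows "ptime D c (\<lambda>x. code_nat (fold (\<lambda>b n. of_bool b + 2 * n) (bs x) (n x)))"
  by (rule ptime_fold_increment[where cb = code_nat and ce = code_bool and xs = bs and a = n and
      g = "\<lambda>x b n. of_bool b + 2 * n" and K = "\<lambda>_. 2", OF bs n])
    (intro ptime_double ptime_step_elem ptime_step_acc poly_bounded_const size_code_nat_double)+

lemma ptime_bits: "ptime D c (\<lambda>x. code_nat (n x)) \<Longrightarrow> ptime D c (\<lambda>x. code_list code_bool (bits (n x)))"
  by (simp add: code_nat_def)

lemma bits_induct [case_names zero double]:
  assumes "P 0" and "\<And>b n. b \<or> n \<noteq> 0 \<Longrightarrow> P n \<Longrightarrow> P (of_bool b + 2 * n)"
  shows "P (n :: nat)"
proof (induction n rule: less_induct)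
  case (less n)
  show ?case
  proof (cases "n = 0")
    case False
    have "P (of_bool (odd n) + 2 * (n div 2))"
      using False less by (intro assms(2)) (auto elim: oddE)
    moreover have "of_bool (odd n) + 2 * (n div 2) = n" by simp
    ultimately show ?thesis by simp
  qed (simp add: assms(1))
qed

text \<open>No carry is propagated. Reading from the most significant bit, the value
  \<open>h\<close> of the prefix is kept together with \<open>Suc h\<close>; after a bit
  \<open>1\<close> the new successor is \<open>2 * Suc h\<close>, after a bit \<open>0\<close> it is
  \<open>1 + 2 * h\<close>.\<close>

lemma ptime_Suc:
  assumes n: "ptime D c (\<lambda>x. code_nat (n x))"
  shows "ptime D c (\<lambda>x. code_nat (Suc (n x)))"
proof -
  let ?g = "\<lambda>b (p :: nat \<times> nat). (of_bool b + 2 * fst p, if b then of_bool False + 2 * snd p else of_bool True + 2 * fst p)"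
  have inv: "\<exists>h < 2 ^ length ys. fold ?g ys (0, 1) = (h, Suc h)" for ys
  proof (induction ys rule: rev_induct)
    case (snoc b ys)
    then obtain h where "h < 2 ^ length ys" "fold ?g ys (0, 1) = (h, Suc h)" by blast
    then show ?case by (intro exI[of _ "of_bool b + 2 * h"]) auto
  qed simp
  \<comment> \<open>A step may rebuild the second component from the first, so its size is under
    control only on pairs \<open>(h, Suc h)\<close>. Hence the invariant and the general
    \<open>ptime_fold\<close>.\<close>
  have "ptime D c (\<lambda>x. code_pair code_nat code_nat (fold ((\<lambda>_. ?g) x) (rev (bits (n x))) (0, 1)))"
  proof (rule ptime_fold[where cb = "code_pair code_nat code_nat" and ce = code_bool and
      xs = "\<lambda>x. rev (bits (n x))" and a = "\<lambda>_. (0, 1)" and g = "\<lambda>_. ?g"])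
    show bs: "ptime D c (\<lambda>x. code_list code_bool (rev (bits (n x))))"
      by (intro ptime_rev ptime_bits n)
    let ?E = "{(x, ys). x \<in> D \<and> (\<exists>zs. rev (bits (n x)) = ys @ zs)}"
    obtain Q where Q: "\<forall>x\<in>D. size (code_list code_bool (rev (bits (n x)))) \<le> poly Q (size (c x))"
      using ptime_poly_bounded[OF bs] unfolding poly_bounded_def by blast
    show "poly_bounded ?E (\<lambda>y. size (c (fst y)))
        (\<lambda>y. size (code_pair code_nat code_nat (fold ?g (snd y) (0, 1))))"
    proof (rule poly_boundedI)
      fix y assume "y \<in> ?E"
      then obtain x ys zs where y: "y = (x, ys)" "x \<in> D" "rev (bits (n x)) = ys @ zs" by auto
      obtain h where h: "h < 2 ^ length ys" "fold ?g ys (0, 1) = (h, Suc h)" using inv by blast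
      have "size (code_nat (Suc h)) \<le> 2 * Suc (length ys)"
        using h(1) unfolding power_Suc by (intro size_code_nat_less) (unfold power_Suc, linarith)
      moreover have "size (code_nat h) \<le> 2 * length ys"
        using h(1) by (intro size_code_nat_less) simp
      moreover have "length ys \<le> size (code_list code_bool (rev (bits (n x))))"
        using length_le_size_code_list[of "rev (bits (n x))" code_bool] y(3) by simp
      then have "length ys \<le> poly Q (size (c x))" using Q y(2) by force
      ultimately show "size (code_pair code_nat code_nat (fold ?g (snd y) (0, 1)))
         \<le> poly (3 + 4 * Q) (size (c (fst y)))"
        unfolding y(1) fst_conv snd_conv h(2) by (simp add: code_pair_def)
    qed
  qed (intro ptime_const ptime_Pair ptime_double ptime_step_elem
      ptime_fst[where cb = code_nat] ptime_snd[where ca = code_nat] ptime_step_acc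
      ptime_If ptime_True ptime_False)+
  moreover have "fold ?g (rev (bits m)) (0, 1) = (m, Suc m)" for m
  proof (induction m rule: bits_induct)
    case (double b m)
    then show ?case by (subst bits_double) auto
  qed simp
  ultimately show ?thesis using ptime_snd[where ca = code_nat and cb = code_nat] by fastforce
qed

text \<open>The bits of \<open>a x\<close> are compared with the parities of \<open>b x\<close>
  under repeated halving; the numbers agree iff all bits match and nothing of \<open>b x\<close>
  remains.\<close>

lemma ptime_nat_eq:
  assumes a: "ptime D c (\<lambda>x. code_nat (a x))" and b: "ptime D c (\<lambda>x. code_nat (b x))"
  shows "ptime D c (\<lambda>x. code_bool (a x = b x))"
proof -
  let ?g = "\<lambda>d (p :: bool \<times> nat). (fst p \<and> d = odd (snd p), snd p div 2)"
  have "ptime D c (\<lambda>x. code_pair code_bool code_nat (fold ((\<lambda>_. ?g) x) (bits (a x)) (True, b x)))"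
  proof (rule ptime_fold_increment[where cb = "code_pair code_bool code_nat" and ce = code_bool and
      xs = "\<lambda>x. bits (a x)" and a = "\<lambda>x. (True, b x)" and g = "\<lambda>_. ?g" and K = "\<lambda>_. 0"])
    have "size (code_nat (m div 2)) \<le> size (code_nat m)" for m
      by (cases "m = 0") (auto simp: code_nat_split)
    then show "size (code_pair code_bool code_nat (?g d p)) \<le> size (code_pair code_bool code_nat p) + 0"
      for d p by (auto simp: code_pair_def code_bool_def add_mono)
  qed (intro poly_bounded_const ptime_bits a ptime_Pair ptime_True b ptime_conj ptime_iff ptime_div2 ptime_odd
      ptime_step_elem ptime_fst[where cb = code_nat] ptime_snd[where ca = code_bool] ptime_step_acc)+
  moreover have "fold ?g (bits m) (t, n) = (t' , n') \<Longrightarrow> (t' \<and> n' = 0) = (t \<and> m = n)" for m t n t' n'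
  proof (induction m arbitrary: t n rule: bits_induct)
    case (double d m)
    have "(m = n div 2 \<and> d = odd n) = (of_bool d + 2 * m = n)" by (cases d) (auto; presburger)+
    with double.IH[of "t \<and> d = odd n" "n div 2"] double.prems double.hyps show ?case
      by (subst (asm) bits_double) auto
  qed auto
  from this[of "a x" True "b x" "fst (fold ?g (bits (a x)) (True, b x))"
    "snd (fold ?g (bits (a x)) (True, b x))" for x]
  have "(fst (fold ?g (bits (a x)) (True, b x)) \<and> snd (fold ?g (bits (a x)) (True, b x)) = 0)
    \<longleftrightarrow> a x = b x" for x by simp
  ultimately show ?thesis
    using ptime_conj[OF ptime_fst[where ca = code_bool and cb = code_nat] ptime_is_0[OF ptime_snd[where ca = code_bool and cb = code_nat]]]
    by fastforce
qed

section \<open>Unary numbers, which serve as loop counters\<close>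

definition code_unary :: "nat \<Rightarrow> data" where
  "code_unary n = code_list (\<lambda>_. Leaf) (replicate n ())"

lemma size_code_unary [simp]: "size (code_unary n) = n"
  by (simp add: code_unary_def size_code_list sum_list_replicate)

lemma ptime_unary_Suc: "ptime D c (\<lambda>x. code_unary (n x)) \<Longrightarrow> ptime D c (\<lambda>x. code_unary (Suc (n x)))"
  unfolding code_unary_def replicate_Suc by (intro ptime_Cons ptime_const)

lemma ptime_unary_add:
  assumes "ptime D c (\<lambda>x. code_unary (m x))" and "ptime D c (\<lambda>x. code_unary (n x))"
  shows "ptime D c (\<lambda>x. code_unary (m x + n x))"
  using assms unfolding code_unary_def replicate_add by (rule ptime_append)

text \<open>A unary code is as large as the number, so the number itself has to be polynomially
  bounded. The accumulator holds the value of the bits read so far and the next power of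
  two.\<close>

lemma ptime_unary:
  assumes n: "ptime D c (\<lambda>x. code_nat (n x))" and bd: "poly_bounded D (\<lambda>x. size (c x)) n"
  shows "ptime D c (\<lambda>x. code_unary (n x))"
proof -
  let ?g = "\<lambda>b (p :: nat \<times> nat). (if b then fst p + snd p else fst p, snd p + snd p)"
  let ?cp = "code_pair code_unary code_unary"
  have inv: "\<exists>u < 2 ^ length ys. fold ?g ys (0, 1) = (u, 2 ^ length ys)" for ys
    by (induction ys rule: rev_induct) auto
  \<comment> \<open>Without leading zeros, the last power of two that is reached is at most twice
    the number.\<close>
  have len: "n \<noteq> 0 \<Longrightarrow> 2 ^ length (bits n) \<le> 2 * n" for n
  proof (induction n rule: bits_induct)
    case (double b n)
    then show ?case by (cases "n = 0") (simp_all add: bits.simps[of "of_bool b + 2 * n"])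
  qed simp
  have "ptime D c (\<lambda>x. ?cp (fold ((\<lambda>_. ?g) x) (bits (n x)) (0, 1)))"
  proof (rule ptime_fold[where cb = ?cp and ce = code_bool and
      xs = "\<lambda>x. bits (n x)" and a = "\<lambda>_. (0, 1)" and g = "\<lambda>_. ?g"])
    show "ptime D c (\<lambda>x. code_list code_bool (bits (n x)))" by (intro ptime_bits n)
    let ?E = "{(x, ys). x \<in> D \<and> (\<exists>zs. bits (n x) = ys @ zs)}"
    obtain Q where Q: "\<forall>x\<in>D. n x \<le> poly Q (size (c x))"
      using bd unfolding poly_bounded_def by blast
    show "poly_bounded ?E (\<lambda>y. size (c (fst y))) (\<lambda>y. size (?cp (fold ?g (snd y) (0, 1))))"
    proof (rule poly_boundedI)
      fix y assume "y \<in> ?E"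
      then obtain x ys zs where y: "y = (x, ys)" "x \<in> D" "bits (n x) = ys @ zs" by auto
      obtain u where u: "u < 2 ^ length ys" "fold ?g ys (0, 1) = (u, 2 ^ length ys)" using inv by blast
      have "(2 :: nat) ^ length ys \<le> 2 ^ length (bits (n x))" using y(3) by simp
      also have "\<dots> \<le> 1 + 2 * n x" using len[of "n x"] by (cases "n x = 0") auto
      also have "\<dots> \<le> 1 + 2 * poly Q (size (c x))" using Q y(2) by simp
      finally have "2 ^ length ys \<le> 1 + 2 * poly Q (size (c x))" .
      with u show "size (?cp (fold ?g (snd y) (0, 1))) \<le> poly (3 + 4 * Q) (size (c (fst y)))"
        by (simp add: y(1) code_pair_def)
    qed
  qed (intro ptime_const ptime_Pair ptime_step_elem ptime_unary_add
      ptime_fst[where cb = code_unary] ptime_snd[where ca = code_unary] ptime_step_acc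
      ptime_If)+
  moreover have "fst (fold ?g (bits m) (u, p)) = u + m * p" for m u p
  proof (induction m arbitrary: u p rule: bits_induct)
    case (double b m)
    then show ?case by (subst bits_double) (auto simp: algebra_simps)
  qed simp
  ultimately show ?thesis using ptime_fst[where ca = code_unary and cb = code_unary] by fastforce
qed

lemma ptime_replicate:
  assumes "ptime D c (\<lambda>x. code_unary (n x))"
  shows "ptime D c (\<lambda>x. code_list ce (replicate (n x) e))"
proof -
  have "ptime D c (\<lambda>x. code_list ce (map ((\<lambda>_ _. e) x) (replicate (n x) ())))"
    using assms unfolding code_unary_def by (rule ptime_map[where f = "\<lambda>_ _. e" and ce = "\<lambda>_. Leaf"]) (rule ptime_const)
  then show ?thesis by simp
qed

section \<open>Routes in a star\<close>

text \<open>The centre of the star is \<open>0\<close> and its leaves are the powers of two, starting with the depot;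
  the \<open>j\<close>-th entry of \<open>sp\<close> is the pair of length and frequency of the edge to \<open>2 ^ j\<close>.  The binary
  code of a leaf is thus its index in unary.\<close>

definition leaf_index :: "nat set \<Rightarrow> nat" where
  "leaf_index e = (THE j. 2 ^ j \<in> e)"

definition star_routing :: "(nat \<times> nat) list \<Rightarrow> nat \<Rightarrow> rat \<Rightarrow> routing" where
  "star_routing sp L C =
     \<lparr>vertices = insert 0 ((^) 2 ` {..<length sp}),
      edges = (\<lambda>j. {0, 2 ^ j}) ` {..<length sp},
      prio_edges = {}, depot = 1, len = (\<lambda>e. fst (sp ! leaf_index e)), levels = 1, prio = (\<lambda>_. 1),
      max_len = L, capacity = C, gap = (\<lambda>_ _. 1), freq = (\<lambda>e. snd (sp ! leaf_index e)),
      nbr_order = (\<lambda>v. if v = 0 then map ((^) 2) [0..<length sp] else [0])\<rparr>"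

lemma star_routing_simps [simp]:
  "vertices (star_routing sp L C) = insert 0 ((^) 2 ` {..<length sp})"
  "edges (star_routing sp L C) = (\<lambda>j. {0, 2 ^ j}) ` {..<length sp}"
  "prio_edges (star_routing sp L C) = {}"
  "depot (star_routing sp L C) = 1"
  "len (star_routing sp L C) e = fst (sp ! leaf_index e)"
  "levels (star_routing sp L C) = 1"
  "prio (star_routing sp L C) e = 1"
  "max_len (star_routing sp L C) = L"
  "capacity (star_routing sp L C) = C"
  "gap (star_routing sp L C) q i = 1"
  "freq (star_routing sp L C) e = snd (sp ! leaf_index e)"
  "nbr_order (star_routing sp L C) v = (if v = 0 then map ((^) 2) [0..<length sp] else [0])"
  by (simp_all add: star_routing_def)

lemma power2_inj [simp]: "(2 :: nat) ^ i = 2 ^ j \<longleftrightarrow> i = j"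
  by simp

lemma leaf_index [simp]: "leaf_index {0, 2 ^ j} = j" "leaf_index {2 ^ j, 0} = j"
  by (auto simp: leaf_index_def)

lemma leaf_index_1 [simp]: "leaf_index {0, Suc 0} = 0" "leaf_index {Suc 0, 0} = 0"
  using leaf_index[of 0] by simp_all

lemma star_edge_iff [simp]: "{0, 2 ^ j} \<in> (\<lambda>j. {0, 2 ^ j :: nat}) ` A \<longleftrightarrow> j \<in> A"
  by (auto simp: doubleton_eq_iff)

lemma star_edge_iff_arc:
  "{u, v} \<in> (\<lambda>j. {0, 2 ^ j :: nat}) ` A \<longleftrightarrow> (\<exists>j\<in>A. u = 0 \<and> v = 2 ^ j \<or> u = 2 ^ j \<and> v = 0)"
  unfolding image_iff doubleton_eq_iff by blast

lemma parcs_star: "parcs (sym_orientation (star_routing sp L C)) =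
    {(0, 2 ^ j) | j. j < length sp} \<union> {(2 ^ j, 0) | j. j < length sp}"
  unfolding sym_orientation_def pair_pre_digraph.simps star_routing_simps star_edge_iff_arc by blast

lemma ball_parcs_star: "(\<forall>a\<in>parcs (sym_orientation (star_routing sp L C)). R a) \<longleftrightarrow>
    (\<forall>j<length sp. R (0, 2 ^ j) \<and> R (2 ^ j, 0))"
  unfolding parcs_star Setcompr_eq_image by (simp add: ball_Un) blast

lemma pverts_star: "pverts (sym_orientation (star_routing sp L C)) = insert 0 ((^) 2 ` {..<length sp})"
  unfolding sym_orientation_def pair_pre_digraph.simps star_routing_simps ..

lemma star_routing_wf:
  assumes "sp \<noteq> []" and "\<forall>x\<in>set sp. fst x > 0 \<and> snd x > 0" and "L > 0" and "0 < C" and "C \<le> 1"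
  shows "routing_wf (star_routing sp L C)"
proof -
  let ?I = "star_routing sp L C" and ?n = "length sp"
  \<comment> \<open>The depot \<open>1\<close> is the leaf \<open>2 ^ 0\<close> and no other one,
    which gives it degree one.\<close>
  have "Suc 0 = 2 ^ j \<longleftrightarrow> j = 0" for j :: nat by (metis One_nat_def power2_inj power_0)
  then have "{j \<in> {..<?n}. 1 \<in> {0, 2 ^ j :: nat}} = {0}" using assms(1) by auto
  then have depots: "{e \<in> edges ?I. depot ?I \<in> e} = {{0, 2 ^ 0}}"
    unfolding star_routing_simps Compr_image_eq by (simp only: image_insert image_empty)
  have depot: "card {e \<in> edges ?I. depot ?I \<in> e} = 1" unfolding depots by simp
  have edge: "e \<subseteq> vertices ?I \<and> card e = 2 \<and> len ?I e > 0 \<and> freq ?I e > 0" if "e \<in> edges ?I" for e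
  proof -
    from that obtain j where j: "j < ?n" "e = {0, 2 ^ j}" by auto
    then have "sp ! j \<in> set sp" by simp
    with j assms(2) show ?thesis by simp
  qed
  have order: "distinct (nbr_order ?I v) \<and> set (nbr_order ?I v) = {u. {u, v} \<in> edges ?I}"
    if "v \<in> vertices ?I" for v
  proof (cases "v = 0")
    case True
    have "{u. {u, 0} \<in> edges ?I} = (^) 2 ` {..<?n}"
      unfolding star_routing_simps star_edge_iff_arc by auto
    then show ?thesis using True by (simp add: distinct_map inj_on_def atLeast0LessThan)
  next
    case False
    with that obtain j where "j < ?n" "v = 2 ^ j" by auto
    then have "{u. {u, v} \<in> edges ?I} = {0}"
      unfolding star_routing_simps star_edge_iff_arc by auto
    then show ?thesis using False by simp
  qed
  have depot': "depot ?I \<in> vertices ?I"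
    using assms(1) by (auto intro!: image_eqI[of _ _ 0])
  have "edges ?I \<subseteq> {e. e \<subseteq> vertices ?I \<and> card e = 2}" "\<forall>e\<in>edges ?I. freq ?I e > 0"
    "\<forall>e\<in>edges ?I. len ?I e > 0 \<and> prio ?I e \<in> {1..levels ?I}"
    using edge by auto
  moreover have "\<forall>v\<in>vertices ?I. distinct (nbr_order ?I v) \<and> set (nbr_order ?I v) = {u. {u, v} \<in> edges ?I}"
    using order by blast
  ultimately show ?thesis
    unfolding routing_wf_def plan_wf_def
    using depot depot' assms(3-5) by (intro conjI) simp_all
qed

lemma star_routing_is_star: "is_star (star_routing sp L C)"
  unfolding is_star_def
  by (rule bexI[of _ 0]) (auto simp: image_def)

lemma star_routing_is_tree:
  assumes "sp \<noteq> []"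
  shows "is_tree (star_routing sp L C)"
  unfolding is_tree_def
proof
  let ?I = "star_routing sp L C"
  let ?V = "insert 0 ((^) 2 ` {..<length sp})" and ?A = "parcs (sym_orientation ?I)"
  have sym: "mk_symmetric (Gs ?I) = sym_orientation ?I"
    unfolding mk_symmetric_def by (rule pair_pre_digraph.equality) (auto simp: parcs_star)
  have c: "(0, v) \<in> rtrancl_on ?V ?A \<and> (v, 0) \<in> rtrancl_on ?V ?A" if "v \<in> ?V" for v
  proof (cases "v = 0")
    case True
    then show ?thesis by (auto intro: rtrancl_on_refl)
  next
    case False
    with that have "(0, v) \<in> ?A" "(v, 0) \<in> ?A" by (auto simp: parcs_star)
    with that show ?thesis by (auto intro: rtrancl_on_into_rtrancl_on rtrancl_on_refl)
  qed
  show "Digraph_Component.connected (Gs ?I)"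
    unfolding connected_def sym strongly_connected_def reachable_def
    using c by (auto simp: pverts_star intro: rtrancl_on_trans)
  show "\<not> (\<exists>p. pre_digraph.cycle (Gs ?I) p \<and> length p \<ge> 3)"
  proof
    assume "\<exists>p. pre_digraph.cycle (Gs ?I) p \<and> length p \<ge> 3"
    then obtain p u where p: "set p \<subseteq> ?A" "pcas u p u" "distinct (tl (pawalk_verts u p))" "length p \<ge> 3"
      unfolding pre_digraph.cycle_def pre_digraph.awalk_def
      by (auto simp: cas_with_proj_eq awalk_verts_with_proj_eq)
    then obtain a b c q where q: "p = a # b # c # q"
      by (auto simp: numeral_3_eq_3 Suc_le_length_iff)
    \<comment> \<open>Arcs alternately enter and leave the centre. If the cycle starts at a leaf,
      its first and third arc both end in the centre; if it starts in the centre, its second arc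
      already closes it. Either way a vertex is repeated too early.\<close>
    have arcs: "(fst x = 0 \<and> snd x \<noteq> 0) \<or> (fst x \<noteq> 0 \<and> snd x = 0)" if "x \<in> set p" for x
      using p(1) that by (auto simp: parcs_star)
    have hd: "hd (pawalk_verts v r) = v" if "pcas v r w" for v w :: nat and r
      using that by (cases r) auto
    have ne: "pawalk_verts v r \<noteq> []" for v and r :: "(nat \<times> nat) list" by (cases r) auto
    have last: "last (pawalk_verts v r) = w" if "pcas v r w" for v w :: nat and r
      using that by (induction r arbitrary: v) (auto simp: ne)
    have *: "fst a = u" "fst b = snd a" "fst c = snd b" "pcas (snd c) q u"
      using p(2) unfolding q by auto
    have d: "distinct (snd a # snd b # pawalk_verts (snd c) q)"
      using p(3) * unfolding q by simp
    have "snd c \<in> set (pawalk_verts (snd c) q)"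
      using hd[OF *(4)] ne by (metis list.set_sel(1))
    moreover have "u \<in> set (pawalk_verts (snd c) q)"
      using last[OF *(4)] ne by (metis last_in_set)
    ultimately have "snd c \<noteq> snd a" "u \<noteq> snd b" using d by auto
    then show False
      using arcs[of a] arcs[of b] arcs[of c] * unfolding q by auto
  qed
qed

text \<open>A walk between leaves is determined by the sequence of leaf indices that it visits; each
  step of the sequence is a pair of arcs through the centre.\<close>

fun star_walk :: "nat list \<Rightarrow> (nat \<times> nat) list" where
  "star_walk (a # b # us) = (2 ^ a, 0) # (0, 2 ^ b) # star_walk (b # us)"
| "star_walk us = []"

lemma pcas_star_walk: "us \<noteq> [] \<Longrightarrow> pcas (2 ^ hd us) (star_walk us) (2 ^ last us)"
  by (induction us rule: star_walk.induct) auto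

lemma set_star_walk: "set (star_walk us) \<subseteq> {(0, 2 ^ j) | j. j \<in> set us} \<union> {(2 ^ j, 0) | j. j \<in> set us}"
  by (induction us rule: star_walk.induct) auto

lemma star_walkE:
  assumes "set w \<subseteq> parcs (sym_orientation (star_routing sp L C))" and "pcas (2 ^ a) w (2 ^ b)"
    and "a < length sp"
  shows "\<exists>us. us \<noteq> [] \<and> hd us = a \<and> last us = b \<and> set us \<subseteq> {..<length sp} \<and> w = star_walk us"
  using assms
proof (induction "length w" arbitrary: w a rule: less_induct)
  case less
  show ?case
  proof (cases w)
    case Nil
    with less.prems show ?thesis by (intro exI[of _ "[a]"]) auto
  next
    case (Cons x w')
    with less.prems have x: "x = (2 ^ a, 0)" "pcas 0 w' (2 ^ b)"
      by (auto simp: parcs_star)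
    then obtain y w'' where w': "w' = y # w''" by (cases w') auto
    with x less.prems Cons obtain c where y: "y = (0, 2 ^ c)" "c < length sp" "pcas (2 ^ c) w'' (2 ^ b)"
      by (auto simp: parcs_star)
    have "\<exists>us. us \<noteq> [] \<and> hd us = c \<and> last us = b \<and> set us \<subseteq> {..<length sp} \<and> w'' = star_walk us"
      using less.prems Cons w' y by (intro less.hyps) auto
    then obtain us where "us \<noteq> []" "hd us = c" "last us = b" "set us \<subseteq> {..<length sp}" "w'' = star_walk us"
      by blast
    then show ?thesis using x y Cons w' less.prems(3)
      by (intro exI[of _ "a # us"]) (cases us; auto)
  qed
qed

text \<open>All entries of the sequence but the first are entered and all but the last are left,
  whence \<open>tl\<close> and \<open>butlast\<close>.\<close>

lemma count_star_walk:
  "count_list (star_walk us) (0, 2 ^ j) = count_list (tl us) j"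
  "count_list (star_walk us) (2 ^ j, 0) = count_list (butlast us) j"
  by (induction us rule: star_walk.induct) auto

lemma walk_len_star_walk:
  "walk_len (star_routing sp L C) (star_walk us) =
     (\<Sum>j\<leftarrow>butlast us. fst (sp ! j)) + (\<Sum>j\<leftarrow>tl us. fst (sp ! j))"
  unfolding walk_len_def by (induction us rule: star_walk.induct) auto

lemma length_star_walk: "length (star_walk us) = 2 * (length us - 1)"
  by (induction us rule: star_walk.induct) auto

lemma nth_star_walk:
  "Suc i < length us \<Longrightarrow> star_walk us ! (2 * i) = (2 ^ (us ! i), 0)"
  "Suc i < length us \<Longrightarrow> star_walk us ! Suc (2 * i) = (0, 2 ^ (us ! Suc i))"
proof (induction us arbitrary: i rule: star_walk.induct)
  case (1 a b us)
  { case 1 then show ?case using "1.IH"(1)[of "i - 1"] by (cases i) auto }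
  { case 2 then show ?case using "1.IH"(2)[of "i - 1"] by (cases i) auto }
qed auto

lemma star_walk_take: "Suc i < length us \<Longrightarrow> take (2 * i + 2) (star_walk us) = star_walk (take (i + 2) us)"
proof (induction us arbitrary: i rule: star_walk.induct)
  case (1 a b us)
  then show ?case using "1.IH"[of "i - 1"] by (cases i) auto
qed auto

lemma edges_star_walk: "length us \<ge> 2 \<Longrightarrow> edge_of ` set (star_walk us) = (\<lambda>j. {0, 2 ^ j}) ` set us"
proof (induction us rule: star_walk.induct)
  case (1 a b us)
  have c: "{2 ^ a, 0} = {0, 2 ^ a :: nat}" by (rule insert_commute)
  show ?case using "1.IH" by (cases us) (simp_all add: c)
qed auto

text \<open>The leaf sequence of a route: index \<open>0\<close> is the depot, and visits to it
  separate the trips.\<close>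

fun flatten :: "nat list list \<Rightarrow> nat list" where
  "flatten [] = [0]"
| "flatten (t # ts) = 0 # t @ flatten ts"

lemma flatten_neq_Nil [simp]: "flatten ts \<noteq> []"
  by (cases ts) auto

lemma hd_flatten [simp]: "hd (flatten ts) = 0"
  by (cases ts) auto

lemma last_flatten [simp]: "last (flatten ts) = 0"
  by (induction ts) auto

lemma set_flatten: "set (flatten ts) = insert 0 (\<Union>t\<in>set ts. set t)"
  by (induction ts) auto

lemma count_flatten:
  "count_list (tl (flatten ts)) j = count_list (concat ts) j + (if j = 0 then length ts else 0)"
  "count_list (butlast (flatten ts)) j = count_list (concat ts) j + (if j = 0 then length ts else 0)"
proof -
  have *: "count_list (flatten ts) j = count_list (concat ts) j + (if j = 0 then Suc (length ts) else 0)"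
    by (induction ts) auto
  have "flatten ts = 0 # tl (flatten ts)" by (cases ts) auto
  then have "count_list (flatten ts) j = count_list (0 # tl (flatten ts)) j" by simp
  then show "count_list (tl (flatten ts)) j = count_list (concat ts) j + (if j = 0 then length ts else 0)"
    using * by (simp split: if_splits)
  have "flatten ts = butlast (flatten ts) @ [0]" by (metis append_butlast_last_id flatten_neq_Nil last_flatten)
  then have "count_list (flatten ts) j = count_list (butlast (flatten ts) @ [0]) j" by simp
  then show "count_list (butlast (flatten ts)) j = count_list (concat ts) j + (if j = 0 then length ts else 0)"
    using * by (simp split: if_splits)
qed

lemma sum_flatten:
  "(\<Sum>j\<leftarrow>tl (flatten ts). f j) = (\<Sum>t\<leftarrow>ts. f 0 + (\<Sum>j\<leftarrow>t. f j))"
  "(\<Sum>j\<leftarrow>butlast (flatten ts). f j) = (\<Sum>t\<leftarrow>ts. f 0 + (\<Sum>j\<leftarrow>t. f j))" for f :: "nat \<Rightarrow> nat"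
proof -
  have *: "(\<Sum>j\<leftarrow>flatten ts. f j) = (\<Sum>t\<leftarrow>ts. f 0 + (\<Sum>j\<leftarrow>t. f j)) + f 0"
    by (induction ts) auto
  have "flatten ts = 0 # tl (flatten ts)" by (cases ts) auto
  then have "(\<Sum>j\<leftarrow>flatten ts. f j) = (\<Sum>j\<leftarrow>0 # tl (flatten ts). f j)" by simp
  then show "(\<Sum>j\<leftarrow>tl (flatten ts). f j) = (\<Sum>t\<leftarrow>ts. f 0 + (\<Sum>j\<leftarrow>t. f j))"
    using * by simp
  have "flatten ts = butlast (flatten ts) @ [0]" by (metis append_butlast_last_id flatten_neq_Nil last_flatten)
  then have "(\<Sum>j\<leftarrow>flatten ts. f j) = (\<Sum>j\<leftarrow>butlast (flatten ts) @ [0]. f j)" by simp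
  then show "(\<Sum>j\<leftarrow>butlast (flatten ts). f j) = (\<Sum>t\<leftarrow>ts. f 0 + (\<Sum>j\<leftarrow>t. f j))"
    using * by simp
qed

text \<open>Every trip begins and ends at the depot, so the walk falls into closed blocks, to which
  the capacity condition will be applied.\<close>

lemma star_walk_flatten: "star_walk (flatten ts) = concat (map (\<lambda>t. star_walk (0 # t @ [0])) ts)"
proof (induction ts)
  case (Cons t ts)
  have "star_walk (x # t @ flatten ts) = star_walk (x # t @ [0]) @ star_walk (flatten ts)" for x
  proof (induction t arbitrary: x)
    case Nil
    show ?case by (cases ts) auto
  qed simp
  then show ?case using Cons by simp
qed simp

lemma flattenE:
  assumes "us \<noteq> []" and "hd us = 0" and "last us = 0"
  obtains ts where "us = flatten ts" and "\<forall>t\<in>set ts. 0 \<notin> set t"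
proof -
  have "\<exists>ts. 0 # vs = flatten ts \<and> (\<forall>t\<in>set ts. 0 \<notin> set t)" if "vs = [] \<or> last vs = 0" for vs :: "nat list"
    using that
  proof (induction vs)
    case Nil
    show ?case by (rule exI[of _ "[]"]) simp
  next
    case (Cons x vs)
    then obtain ts where ts: "0 # vs = flatten ts" "\<forall>t\<in>set ts. 0 \<notin> set t"
      by (auto split: if_splits)
    show ?case
    proof (cases "x = 0")
      case True
      with ts show ?thesis by (intro exI[of _ "[] # ts"]) auto
    next
      case False
      with Cons.prems have "vs \<noteq> []" by auto
      with ts(1) obtain t ts' where t: "ts = t # ts'" by (cases ts) auto
      with ts False show ?thesis by (intro exI[of _ "(x # t) # ts'"]) auto
    qed
  qed
  from this[of "tl us"] assms that show thesis
    by (cases us) (auto split: if_splits)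
qed

text \<open>\<open>P\<close> marks the beginnings of blocks. A segment without a marked position
  strictly inside is contained in one block; its own first position may be marked, which is why only
  positions \<open>m\<close> with \<open>i < m\<close> are tested.\<close>

lemma sum_segment_concat_le:
  fixes f :: "'a \<Rightarrow> nat"
  assumes "\<forall>b\<in>set bs. b \<noteq> [] \<and> P (hd b) \<and> (\<Sum>x\<leftarrow>b. f x) \<le> T"
    and "i \<le> j" and "j \<le> length (concat bs)"
    and "\<forall>m. i < m \<and> m < j \<longrightarrow> \<not> P (concat bs ! m)"
  shows "(\<Sum>x\<leftarrow>drop i (take j (concat bs)). f x) \<le> T"
  using assms
proof (induction bs arbitrary: i j)
  case (Cons b bs)
  show ?case
  proof (cases "length b \<le> i")
    case True
    have "(\<Sum>x\<leftarrow>drop (i - length b) (take (j - length b) (concat bs)). f x) \<le> T"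
    proof (rule Cons.IH)
      show "\<forall>m. i - length b < m \<and> m < j - length b \<longrightarrow> \<not> P (concat bs ! m)"
      proof (intro allI impI)
        fix m assume "i - length b < m \<and> m < j - length b"
        then show "\<not> P (concat bs ! m)"
          using Cons.prems(4)[rule_format, of "m + length b"] True by (simp add: nth_append less_diff_conv less_diff_conv2)
      qed
    qed (use Cons.prems in auto)
    moreover have "drop i (take j (concat (b # bs))) = drop (i - length b) (take (j - length b) (concat bs))"
      using True Cons.prems(2) by (simp add: min_absorb1)
    ultimately show ?thesis by metis
  next
    case False
    have j: "j \<le> length b"
    proof (rule ccontr)
      assume "\<not> j \<le> length b"
      moreover from this Cons.prems(3) obtain b' bs' where bs: "bs = b' # bs'" by (cases bs) auto
      ultimately have "\<not> P (concat (b # bs) ! length b)" using False Cons.prems(4) by simp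
      then show False using Cons.prems(1) by (auto simp: bs nth_append hd_conv_nth)
    qed
    have "(\<Sum>x\<leftarrow>drop i (take j b). f x) \<le> (\<Sum>x\<leftarrow>b. f x)"
    proof -
      have "(\<Sum>x\<leftarrow>b. f x) = (\<Sum>x\<leftarrow>take j b. f x) + (\<Sum>x\<leftarrow>drop j b. f x)"
        by (metis append_take_drop_id map_append sum_list_append)
      moreover have "(\<Sum>x\<leftarrow>take j b. f x) = (\<Sum>x\<leftarrow>take i (take j b). f x) + (\<Sum>x\<leftarrow>drop i (take j b). f x)"
        by (metis append_take_drop_id map_append sum_list_append)
      ultimately show ?thesis by linarith
    qed
    also have "\<dots> \<le> T" using Cons.prems(1) by simp
    finally show ?thesis using j False by simp
  qed
qed simp

section \<open>Vehicle routes as feasible lists of trips\<close>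

definition trips_ok :: "(nat \<times> nat) list \<Rightarrow> nat \<Rightarrow> nat \<Rightarrow> nat list list \<Rightarrow> bool" where
  "trips_ok sp L T ts \<longleftrightarrow>
     (\<forall>t\<in>set ts. set t \<subseteq> {1..<length sp} \<and> 2 * (fst (sp ! 0) + (\<Sum>j\<leftarrow>t. fst (sp ! j))) \<le> T) \<and>
     1 \<le> length ts \<and> length ts \<le> snd (sp ! 0) \<and>
     (\<forall>j\<in>{1..<length sp}. 1 \<le> count_list (concat ts) j \<and> count_list (concat ts) j \<le> snd (sp ! j)) \<and>
     (\<Sum>t\<leftarrow>ts. 2 * (fst (sp ! 0) + (\<Sum>j\<leftarrow>t. fst (sp ! j)))) \<le> L"

lemma walk_len_trip:
  "walk_len (star_routing sp L C) (star_walk (0 # t @ [0])) = 2 * (fst (sp ! 0) + (\<Sum>j\<leftarrow>t. fst (sp ! j)))"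
  by (simp add: walk_len_star_walk butlast_append)

lemma fst_tl_trip: "0 \<notin> set t \<Longrightarrow> x \<in> set (tl (star_walk (a # t @ [0]))) \<Longrightarrow> fst x \<noteq> 1"
proof (induction t arbitrary: a)
  case (Cons b t)
  have "(2::nat) ^ b \<noteq> 2 ^ 0" using Cons.prems(1) by (subst power2_inj) simp
  with Cons show ?case by (cases t) auto
qed simp

text \<open>Visits to the depot cut a route into trips. A trip is a sub-route without an inner visit
  to the depot, and every sub-route of this kind lies within a trip, so the capacity condition says
  that no trip is longer than \<open>T\<close>. The frequencies bound the number of trips and the
  number of visits to each leaf.\<close>

lemma vehicle_route_star_iff:
  assumes C: "C * rat_of_nat L = rat_of_nat T" and sp: "sp \<noteq> []"
  shows "vehicle_route (star_routing sp L C) w \<longleftrightarrow>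
    (\<exists>ts. (\<forall>t\<in>set ts. 0 \<notin> set t) \<and> trips_ok sp L T ts \<and> w = star_walk (flatten ts))"
    (is "_ \<longleftrightarrow> ?R")
proof -
  let ?I = "star_routing sp L C"
  let ?cnt = "\<lambda>w. \<forall>j<length sp. 1 \<le> count_list w (0, 2 ^ j) \<and> count_list w (0, 2 ^ j) \<le> snd (sp ! j) \<and>
        1 \<le> count_list w (2 ^ j, 0) \<and> count_list w (2 ^ j, 0) \<le> snd (sp ! j)"
  let ?cap = "\<lambda>w. \<forall>i j. i \<le> j \<and> j \<le> length w \<and> walk_len ?I (segment w i j) > T \<longrightarrow>
        (\<exists>m. i < m \<and> m < j \<and> fst (w ! m) = 1)"
  have route: "vehicle_route ?I w \<longleftrightarrow>
     set w \<subseteq> parcs (sym_orientation ?I) \<and> pcas (2 ^ 0) w (2 ^ 0) \<and>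
     ?cnt w \<and>
     walk_len ?I w \<le> L \<and> ?cap w"
  proof -
    have "(\<forall>a\<in>parcs (sym_orientation ?I). Q a (snd (sp ! leaf_index (edge_of a)))) \<longleftrightarrow>
       (\<forall>j<length sp. Q (0, 2 ^ j) (snd (sp ! j)) \<and> Q (2 ^ j, 0) (snd (sp ! j)))" for Q
      unfolding ball_parcs_star by simp
    from this[of "\<lambda>a f. 1 \<le> count_list w a \<and> count_list w a \<le> f"]
    show ?thesis unfolding vehicle_route_def pre_digraph.awalk_def cas_with_proj_eq
      using sp by (auto simp: C pverts_star simp del: One_nat_def)
  qed
  have cap: "?cap (star_walk (flatten ts)) \<longleftrightarrow>
      (\<forall>t\<in>set ts. 2 * (fst (sp ! 0) + (\<Sum>j\<leftarrow>t. fst (sp ! j))) \<le> T)"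
    if ts: "\<forall>t\<in>set ts. 0 \<notin> set t" for ts
  proof
    assume cap: "?cap (star_walk (flatten ts))"
    show "\<forall>t\<in>set ts. 2 * (fst (sp ! 0) + (\<Sum>j\<leftarrow>t. fst (sp ! j))) \<le> T"
    proof (rule ballI, rule ccontr)
      fix t assume t: "t \<in> set ts" "\<not> 2 * (fst (sp ! 0) + (\<Sum>j\<leftarrow>t. fst (sp ! j))) \<le> T"
      then obtain A B where AB: "ts = A @ t # B" by (meson split_list)
      let ?b = "star_walk (0 # t @ [0])"
      obtain x y where xy: "star_walk (flatten ts) = x @ ?b @ y"
        by (simp add: star_walk_flatten AB)
      have "\<exists>m. length x < m \<and> m < length x + length ?b \<and> fst (star_walk (flatten ts) ! m) = 1"
        using cap[rule_format, of "length x" "length x + length ?b"] t(2) walk_len_trip[of sp L C t]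
        by (simp add: xy segment_def)
      then obtain m where m: "length x < m" "m < length x + length ?b" "fst ((x @ ?b @ y) ! m) = 1"
        unfolding xy by blast
      obtain i where i: "m = length x + Suc i" using m(1) less_imp_Suc_add by fastforce
      have il: "Suc i < length ?b" using m(2) i by simp
      have "fst (?b ! Suc i) = 1" using m(3) il by (simp add: i nth_append)
      moreover have "?b ! Suc i \<in> set (tl ?b)"
        using nth_mem[of i "tl ?b"] il by (simp add: nth_tl)
      ultimately show False using fst_tl_trip[of t _ 0] ts t(1) by blast
    qed
  next
    assume le: "\<forall>t\<in>set ts. 2 * (fst (sp ! 0) + (\<Sum>j\<leftarrow>t. fst (sp ! j))) \<le> T"
    show "?cap (star_walk (flatten ts))"
    proof (intro allI impI, rule ccontr)
      fix i j
      let ?w = "star_walk (flatten ts)"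
      assume ij: "i \<le> j \<and> j \<le> length ?w \<and> T < walk_len ?I (segment ?w i j)"
        and no: "\<not> (\<exists>m. i < m \<and> m < j \<and> fst (?w ! m) = 1)"
      have hd: "star_walk (0 # t @ [0]) \<noteq> [] \<and> fst (hd (star_walk (0 # t @ [0]))) = 1" for t
        by (cases t) auto
      have "(\<Sum>a\<leftarrow>drop i (take j ?w). len ?I (edge_of a)) \<le> T"
        unfolding star_walk_flatten
        by (rule sum_segment_concat_le[where P = "\<lambda>a. fst a = 1"])
          (use ij no le hd walk_len_trip[of sp L C] in \<open>auto simp: star_walk_flatten walk_len_def\<close>)
      then show False using ij by (simp add: walk_len_def segment_def)
    qed
  qed
  have counts: "?cnt (star_walk (flatten ts)) \<longleftrightarrow>
     1 \<le> length ts \<and> length ts \<le> snd (sp ! 0) \<and>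
     (\<forall>j\<in>{1..<length sp}. 1 \<le> count_list (concat ts) j \<and> count_list (concat ts) j \<le> snd (sp ! j))"
    (is "?P \<longleftrightarrow> ?Q") if ts: "\<forall>t\<in>set ts. 0 \<notin> set t" for ts
  proof -
    \<comment> \<open>Index \<open>0\<close> occurs only as a separator, so the frequency of the
      depot edge limits the number of trips.\<close>
    have 0: "count_list (concat ts) 0 = 0" using ts by (simp add: count_list_0_iff)
    have "?P \<longleftrightarrow> (\<forall>j<length sp. 1 \<le> count_list (tl (flatten ts)) j \<and> count_list (tl (flatten ts)) j \<le> snd (sp ! j))"
      unfolding count_star_walk count_flatten by blast
    also have "\<dots> \<longleftrightarrow> ?Q"
    proof -
      have "(\<forall>j<length sp. R j) \<longleftrightarrow> R 0 \<and> (\<forall>j\<in>{1..<length sp}. R j)" for R :: "nat \<Rightarrow> bool"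
      proof -
        have "{..<length sp} = insert 0 {1..<length sp}" using sp by auto
        moreover have "(\<forall>j<length sp. R j) \<longleftrightarrow> (\<forall>j\<in>{..<length sp}. R j)" by (simp only: Ball_def lessThan_iff)
        ultimately show ?thesis by simp
      qed
      then show ?thesis using 0 by (simp add: count_flatten)
    qed
    finally show ?thesis .
  qed
  have len: "walk_len ?I (star_walk (flatten ts)) =
      (\<Sum>t\<leftarrow>ts. 2 * (fst (sp ! 0) + (\<Sum>j\<leftarrow>t. fst (sp ! j))))" for ts
    by (simp add: walk_len_star_walk sum_flatten flip: mult_2 sum_list_const_mult)
  show ?thesis
  proof
    assume "vehicle_route ?I w"
    then have r: "set w \<subseteq> parcs (sym_orientation ?I)" "pcas (2 ^ 0) w (2 ^ 0)"
     "?cnt w"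
     "walk_len ?I w \<le> L" "?cap w"
      unfolding route by blast+
    from star_walkE[OF r(1,2)] sp obtain us where us: "us \<noteq> []" "hd us = 0" "last us = 0"
      "set us \<subseteq> {..<length sp}" "w = star_walk us" by auto
    from flattenE[OF us(1-3)] obtain ts where ts: "us = flatten ts" "\<forall>t\<in>set ts. 0 \<notin> set t" by blast
    have "set t \<subseteq> {1..<length sp}" if "t \<in> set ts" for t
    proof
      fix j assume "j \<in> set t"
      then have "j \<noteq> 0" using that ts(2) by metis
      moreover have "j \<in> set (flatten ts)" using \<open>j \<in> set t\<close> that by (auto simp: set_flatten)
      ultimately show "j \<in> {1..<length sp}" using us(4) ts(1) by auto
    qed
    then have "trips_ok sp L T ts"
      using r(3-5) cap[OF ts(2)] counts[OF ts(2)] len[of ts]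
      unfolding trips_ok_def us(5) ts(1) by simp
    then show ?R using us(5) ts by blast
  next
    assume ?R
    then obtain ts where ts: "\<forall>t\<in>set ts. 0 \<notin> set t" "trips_ok sp L T ts" "w = star_walk (flatten ts)"
      by blast
    have "set w \<subseteq> parcs (sym_orientation ?I)"
    proof -
      have "set (flatten ts) \<subseteq> {..<length sp}"
        using ts(2) sp unfolding trips_ok_def set_flatten by force
      then show ?thesis using set_star_walk[of "flatten ts"] unfolding parcs_star ts(3) by blast
    qed
    moreover have "pcas (2 ^ 0) w (2 ^ 0)"
      using pcas_star_walk[of "flatten ts"] unfolding ts(3) by simp
    moreover note tok = ts(2)[unfolded trips_ok_def]
    then have "walk_len ?I w \<le> L" unfolding ts(3) len by blast
    moreover have "?cap w" unfolding ts(3) by (rule iffD2[OF cap[OF ts(1)]]) (use tok in blast)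
    moreover have "?cnt w"
      unfolding ts(3) by (rule iffD2[OF counts[OF ts(1)]]) (use tok in blast)
    ultimately show "vehicle_route ?I w"
      unfolding route by (intro conjI)
  qed
qed

text \<open>The complaints of a route that visits the leaves in the order \<open>us\<close>; there are \<open>n\<close> leaves.\<close>

definition forward_set :: "nat \<Rightarrow> nat list \<Rightarrow> nat set" where
  "forward_set n us = {Suc (us ! i) mod n | i. Suc i < length us \<and> Suc (us ! i) mod n \<notin> set (take (i + 2) us)}"

definition backward_set :: "nat \<Rightarrow> nat list \<Rightarrow> nat set" where
  "backward_set n us = {j. j < n \<and> (\<exists>i. Suc i < length us \<and> Suc j mod n = us ! Suc i \<and> j \<notin> set (take (i + 2) us))}"

lemma Suc_mod_inj: "i < n \<Longrightarrow> j < n \<Longrightarrow> Suc i mod n = Suc j mod n \<Longrightarrow> i = j" for n :: nat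
  by (auto simp: mod_Suc split: if_splits)

lemma cyc_next_powers: "j < n \<Longrightarrow> cyc_next (map ((^) 2) [0..<n]) ((2::nat) ^ j) = 2 ^ (Suc j mod n)"
  unfolding cyc_next_def by (rule the_equality) auto

lemma cyc_prev_powers: "j < n \<Longrightarrow> cyc_prev (map ((^) 2) [0..<n]) ((2::nat) ^ (Suc j mod n)) = 2 ^ j"
  unfolding cyc_prev_def by (rule the_equality) (auto dest: Suc_mod_inj)

lemma cyc_single: "cyc_next [x] x = x" "cyc_prev [x] x = x"
  unfolding cyc_next_def cyc_prev_def by (rule the_equality; auto)+

text \<open>Arcs at even positions of a route enter the centre and those at odd positions leave it;
  the two kinds of turn are treated separately.\<close>

lemma ex_pair_index: "(\<exists>m. Suc m < 2 * k \<and> Q m) \<longleftrightarrow> (\<exists>i<k. Q (2 * i)) \<or> (\<exists>i. Suc i < k \<and> Q (Suc (2 * i)))"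
  for k :: nat
proof
  assume "\<exists>m. Suc m < 2 * k \<and> Q m"
  then obtain m where m: "Suc m < 2 * k" "Q m" by blast
  show "(\<exists>i<k. Q (2 * i)) \<or> (\<exists>i. Suc i < k \<and> Q (Suc (2 * i)))"
  proof (cases "even m")
    case True
    then obtain i where "m = 2 * i" by (auto elim: evenE)
    with m show ?thesis by (intro disjI1 exI[of _ i]) simp
  next
    case False
    then obtain i where "m = Suc (2 * i)" by (auto elim: oddE)
    with m show ?thesis by (intro disjI2 exI[of _ i]) simp
  qed
next
  assume "(\<exists>i<k. Q (2 * i)) \<or> (\<exists>i. Suc i < k \<and> Q (Suc (2 * i)))"
  then show "\<exists>m. Suc m < 2 * k \<and> Q m"
  proof
    assume "\<exists>i<k. Q (2 * i)"
    then obtain i where "i < k" "Q (2 * i)" by blast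
    then show ?thesis by (intro exI[of _ "2 * i"]) simp
  next
    assume "\<exists>i. Suc i < k \<and> Q (Suc (2 * i))"
    then obtain i where "Suc i < k" "Q (Suc (2 * i))" by blast
    then show ?thesis by (intro exI[of _ "Suc (2 * i)"]) simp
  qed
qed

text \<open>A leaf has one neighbour, so at a turn at a leaf the edge in question has just been
  traversed and does not complain. Only turns at the centre count, and there the cyclic order is
  that of the leaf indices modulo their number.\<close>

lemma unfairness_star_walk:
  assumes us: "set us \<subseteq> {..<length sp}"
  shows "unfairness (star_routing sp L C) (star_walk us) =
    card (forward_set (length sp) us) + card (backward_set (length sp) us)"
proof -
  let ?n = "length sp" and ?e = "\<lambda>j. {0, 2 ^ j :: nat}"
  let ?I = "star_routing sp L C" and ?w = "star_walk us"
  have inj: "inj ?e" by (rule inj_on_inverseI[where g = leaf_index]) simp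
  have ltn: "us ! i < ?n" if "i < length us" for i using us nth_mem[OF that] by blast
  have ex: "(\<exists>m. Suc m < length ?w \<and> Q m) \<longleftrightarrow>
     (\<exists>i. Suc i < length us \<and> Q (2 * i)) \<or> (\<exists>i. Suc (Suc i) < length us \<and> Q (Suc (2 * i)))" for Q
    unfolding length_star_walk ex_pair_index by (auto simp: less_diff_conv)
  have seen: "edge_of ` set (take (2 * i + 2) ?w) = ?e ` set (take (i + 2) us)" if "Suc i < length us" for i
    using that by (simp only: star_walk_take, intro edges_star_walk) simp
  have seen': "edge_of ` set (take (2 * i + 2) ?w) \<subseteq> edge_of ` set (take (Suc (2 * i) + 2) ?w)" for i
    by (intro image_mono set_take_subset_set_take) simp
  have "forward_complaints ?I ?w = ?e ` forward_set ?n us"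
  proof -
    have "e \<in> forward_complaints ?I ?w \<longleftrightarrow> e \<in> ?e ` forward_set ?n us" for e
    proof -
      have no: "\<not> (Suc (Suc i) < length us \<and> e = next_edge (nbr_order ?I) (?w ! Suc (2 * i)) \<and>
        e \<notin> edge_of ` set (take (Suc (2 * i) + 2) ?w))"
        (is "\<not> ?P i") for i
      proof
        assume *: "?P i"
        then have "e = ?e (us ! Suc i)"
          using nth_star_walk(2)[of i us] by (simp add: cyc_single insert_commute)
        moreover have "us ! Suc i \<in> set (take (i + 2) us)"
          using * nth_mem[of "Suc i" "take (i + 2) us"] by simp
        ultimately have "e \<in> ?e ` set (take (i + 2) us)" by (rule image_eqI)
        moreover have "Suc i < length us" using * by simp
        ultimately have "e \<in> edge_of ` set (take (2 * i + 2) ?w)" by (simp only: seen)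
        with seen'[of i] have "e \<in> edge_of ` set (take (Suc (2 * i) + 2) ?w)" by (rule subsetD)
        with conjunct2[OF conjunct2[OF *]] show False by contradiction
      qed
      have nx: "next_edge (nbr_order ?I) (?w ! (2 * i)) = ?e (Suc (us ! i) mod ?n)" if "Suc i < length us" for i
        using nth_star_walk(1)[OF that] ltn[of i] that by (simp add: cyc_next_powers)
      show ?thesis
      proof
        assume "e \<in> forward_complaints ?I ?w"
        then obtain i where "Suc i < length us" "e = next_edge (nbr_order ?I) (?w ! (2 * i))"
          "e \<notin> edge_of ` set (take (2 * i + 2) ?w)"
          unfolding forward_complaints_def mem_Collect_eq ex using no by blast
        note i = this
        have e: "e = ?e (Suc (us ! i) mod ?n)" using i(2) nx[OF i(1)] by (rule trans)
        have "Suc (us ! i) mod ?n \<notin> set (take (i + 2) us)"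
          using i(3) unfolding seen[OF i(1)] e star_edge_iff .
        with i(1) have "Suc (us ! i) mod ?n \<in> forward_set ?n us" unfolding forward_set_def by blast
        with e show "e \<in> ?e ` forward_set ?n us" by (rule image_eqI)
      next
        assume "e \<in> ?e ` forward_set ?n us"
        then obtain i where i: "Suc i < length us" "Suc (us ! i) mod ?n \<notin> set (take (i + 2) us)"
          "e = ?e (Suc (us ! i) mod ?n)" unfolding forward_set_def by blast
        have "e = next_edge (nbr_order ?I) (?w ! (2 * i))" unfolding i(3) nx[OF i(1)] ..
        moreover have "e \<notin> edge_of ` set (take (2 * i + 2) ?w)"
          unfolding seen[OF i(1)] i(3) star_edge_iff by (rule i(2))
        ultimately show "e \<in> forward_complaints ?I ?w"
          unfolding forward_complaints_def mem_Collect_eq ex using i(1) by (intro disjI1 exI[of _ i] conjI)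
      qed
    qed
    then show ?thesis by blast
  qed
  moreover have "backward_complaints ?I ?w = ?e ` backward_set ?n us"
  proof -
    have "e \<in> backward_complaints ?I ?w \<longleftrightarrow> e \<in> ?e ` backward_set ?n us" for e
    proof -
      have no: "\<not> (Suc (Suc i) < length us \<and> e = prev_edge (nbr_order ?I) (?w ! Suc (Suc (2 * i))) \<and>
        e \<notin> edge_of ` set (take (Suc (2 * i) + 2) ?w))"
        (is "\<not> ?P i") for i
      proof
        assume *: "?P i"
        then have "e = ?e (us ! Suc i)"
          using nth_star_walk(1)[of "Suc i" us] by (simp add: cyc_single insert_commute)
        moreover have "us ! Suc i \<in> set (take (i + 2) us)"
          using * nth_mem[of "Suc i" "take (i + 2) us"] by simp
        ultimately have "e \<in> ?e ` set (take (i + 2) us)" by (rule image_eqI)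
        moreover have "Suc i < length us" using * by simp
        ultimately have "e \<in> edge_of ` set (take (2 * i + 2) ?w)" by (simp only: seen)
        with seen'[of i] have "e \<in> edge_of ` set (take (Suc (2 * i) + 2) ?w)" by (rule subsetD)
        with conjunct2[OF conjunct2[OF *]] show False by contradiction
      qed
      have pv: "prev_edge (nbr_order ?I) (?w ! Suc (2 * i)) = ?e j"
        if "Suc i < length us" "j < ?n" "Suc j mod ?n = us ! Suc i" for i j
        using nth_star_walk(2)[OF that(1)] that cyc_prev_powers[OF that(2)] by simp
      \<comment> \<open>The witness is the cyclic predecessor, which wraps from \<open>0\<close> to
        the last leaf.\<close>
      have ej: "\<exists>j<?n. Suc j mod ?n = us ! Suc i" if "Suc i < length us" for i
        using ltn[OF that] by (intro exI[of _ "if us ! Suc i = 0 then ?n - 1 else us ! Suc i - 1"]) auto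
      show ?thesis
      proof
        assume "e \<in> backward_complaints ?I ?w"
        then obtain i where i: "Suc i < length us" "e = prev_edge (nbr_order ?I) (?w ! Suc (2 * i))"
          "e \<notin> edge_of ` set (take (2 * i + 2) ?w)"
          unfolding backward_complaints_def mem_Collect_eq ex using no by blast
        obtain j where "j < ?n" "Suc j mod ?n = us ! Suc i" using ej[OF i(1)] by blast
        note j = this
        have e: "e = ?e j" using i(2) pv[OF i(1) j] by (rule trans)
        have "j \<notin> set (take (i + 2) us)"
          using i(3) unfolding seen[OF i(1)] e star_edge_iff .
        with i(1) j have "j \<in> backward_set ?n us" unfolding backward_set_def by blast
        with e show "e \<in> ?e ` backward_set ?n us" by (rule image_eqI)
      next
        assume "e \<in> ?e ` backward_set ?n us"
        then obtain i j where i: "Suc i < length us" "j < ?n" "Suc j mod ?n = us ! Suc i"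
          "j \<notin> set (take (i + 2) us)" "e = ?e j" unfolding backward_set_def by blast
        have "e = prev_edge (nbr_order ?I) (?w ! Suc (2 * i))" unfolding i(5) pv[OF i(1-3)] ..
        moreover have "e \<notin> edge_of ` set (take (2 * i + 2) ?w)"
          unfolding seen[OF i(1)] i(5) star_edge_iff by (rule i(4))
        ultimately show "e \<in> backward_complaints ?I ?w"
          unfolding backward_complaints_def mem_Collect_eq ex using i(1) by (intro disjI1 exI[of _ i] conjI)
      qed
    qed
    then show ?thesis by blast
  qed
  ultimately show ?thesis
    unfolding unfairness_def by (simp add: card_image[OF inj_on_subset[OF inj]])
qed

section \<open>Combinatorics of splittings and routes\<close>

fun changes :: "'a list \<Rightarrow> nat" where
  "changes (a # b # xs) = (if a = b then 0 else 1) + changes (b # xs)"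
| "changes _ = 0"

lemma changes_append: "changes (xs @ ys) \<le> changes xs + 1 + changes ys"
proof (induction xs rule: changes.induct)
  case ("2_2" v)
  show ?case by (cases ys) auto
qed auto

lemma changes_replicate: "changes (replicate n a) = 0"
proof (induction n)
  case (Suc n)
  then show ?case by (cases n) auto
qed simp

lemma card_changes: "card {j. Suc j < length xs \<and> xs ! j \<noteq> xs ! Suc j} = changes xs"
proof (induction xs rule: changes.induct)
  case (1 a b xs)
  let ?A = "\<lambda>xs. {j. Suc j < length xs \<and> xs ! j \<noteq> xs ! Suc j}"
  have "j \<in> ?A (a # b # xs) \<longleftrightarrow> j \<in> (if a = b then {} else {0}) \<union> Suc ` ?A (b # xs)" for j
    by (cases j) auto
  then have eq: "?A (a # b # xs) = (if a = b then {} else {0}) \<union> Suc ` ?A (b # xs)" by blast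
  have "finite (?A (b # xs))" by (rule finite_subset[of _ "{..<length (b # xs)}"]) auto
  then show ?case unfolding eq using 1 by (simp add: card_image card_insert_if)
qed auto

definition add_run :: "'l \<times> 'c \<Rightarrow> ('l \<times> 'c list) list \<Rightarrow> ('l \<times> 'c list) list" where
  "add_run e S = (if S \<noteq> [] \<and> fst e = fst (hd S) then (fst e, snd e # snd (hd S)) # tl S
     else (fst e, [snd e]) # S)"

text \<open>Maximal runs of equal labels: the fewest intervals into which a necklace can be cut once
  each bead has been assigned to a part.\<close>

definition runs_of :: "('l \<times> 'c) list \<Rightarrow> ('l \<times> 'c list) list" where
  "runs_of es = foldr add_run es []"

lemma runs_of_simps [simp]: "runs_of [] = []" "runs_of (e # es) = add_run e (runs_of es)"
  by (simp_all add: runs_of_def)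

lemma concat_runs_of: "concat (map snd (runs_of es)) = map snd es"
proof (induction es)
  case (Cons e es)
  then show ?case by (cases "runs_of es") (auto simp: add_run_def)
qed simp

lemma runs_of_elem: "r \<in> set (runs_of es) \<Longrightarrow> fst r \<in> fst ` set es \<and> snd r \<noteq> []"
proof (induction es arbitrary: r)
  case (Cons e es)
  have "r \<in> set (runs_of es) \<or> fst r = fst e \<and> snd r \<noteq> []"
    using Cons.prems by (auto simp: add_run_def split: if_splits dest: list.set_sel(2))
  then show ?case using Cons.IH[of r] by auto
qed simp

lemma length_runs_of:
  "es \<noteq> [] \<Longrightarrow> runs_of es \<noteq> [] \<and> fst (hd (runs_of es)) = fst (hd es) \<and>
     length (runs_of es) = Suc (changes (map fst es))"
proof (induction es)
  case (Cons e es)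
  show ?case
  proof (cases es)
    case Nil
    then show ?thesis by (simp add: add_run_def)
  next
    case (Cons e' es')
    with Cons.IH obtain r rs where "runs_of es = r # rs" by (cases "runs_of es") auto
    with Cons.IH Cons show ?thesis by (auto simp: add_run_def)
  qed
qed simp

lemma count_runs_of:
  "(\<Sum>(l', B)\<leftarrow>runs_of es. if l' = l then count_list B c else 0) = count_list es (l, c)"
proof (induction es)
  case (Cons e es)
  then show ?case by (cases e; cases "runs_of es") (auto simp: add_run_def split: prod.splits)
qed simp

definition bead_parts :: "('l \<times> 'c list) list \<Rightarrow> 'l list" where
  "bead_parts S = concat (map (\<lambda>(p, B). replicate (length B) p) S)"

lemma length_bead_parts: "length (bead_parts S) = length (concat (map snd S))"
  by (induction S) (auto simp: bead_parts_def)

text \<open>Only an inequality, since neighbouring intervals of a splitting may go to the same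
  part.\<close>

lemma changes_bead_parts: "changes (bead_parts S) \<le> length S - 1"
proof (induction S)
  case (Cons r S)
  show ?case
  proof (cases "S = []")
    case True
    then show ?thesis by (cases r) (simp add: bead_parts_def changes_replicate)
  next
    case False
    then have "Suc (length S - 1) = length S" by simp
    with Cons changes_append[of "replicate (length (snd r)) (fst r)" "bead_parts S"] show ?thesis
      by (cases r) (simp add: bead_parts_def changes_replicate)
  qed
qed (simp add: bead_parts_def)

lemma count_zip_bead_parts:
  "count_list (zip (bead_parts S) (concat (map snd S))) (p, c) =
     (\<Sum>(p', B)\<leftarrow>S. if p' = p then count_list B c else 0)"
proof (induction S)
  case (Cons r S)
  obtain q B where r: "r = (q, B)" by (cases r)
  have "count_list (zip (replicate (length B) q) B) (p, c) = (if q = p then count_list B c else 0)"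
    by (induction B) auto
  with Cons show ?case by (simp add: r bead_parts_def zip_append)
qed (simp add: bead_parts_def)

lemma count_map_snd_filter:
  "count_list (map snd (filter (\<lambda>x. fst x = p) xs)) c = count_list xs (p, c)"
  by (induction xs) auto

section \<open>Numbers in base \<open>B\<close>\<close>

lemma digits_unique:
  fixes x y :: "nat \<Rightarrow> nat"
  assumes "(\<Sum>i<s. x i * B ^ i) = (\<Sum>i<s. y i * B ^ i)" and "\<forall>i<s. x i < B \<and> y i < B"
  shows "\<forall>i<s. x i = y i"
  using assms
proof (induction s arbitrary: x y)
  case (Suc s)
  have split: "(\<Sum>i<Suc s. z i * B ^ i) = z 0 + B * (\<Sum>i<s. z (Suc i) * B ^ i)" for z :: "nat \<Rightarrow> nat"
    by (simp add: sum.lessThan_Suc_shift sum_distrib_left algebra_simps del: sum.lessThan_Suc)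
  have eq: "x 0 + B * (\<Sum>i<s. x (Suc i) * B ^ i) = y 0 + B * (\<Sum>i<s. y (Suc i) * B ^ i)"
    using Suc.prems(1) by (simp only: split)
  have lt: "x 0 < B" "y 0 < B" using Suc.prems(2) by auto
  have 0: "x 0 = y 0" using arg_cong[OF eq, of "\<lambda>n. n mod B"] lt by simp
  moreover have "(\<Sum>i<s. x (Suc i) * B ^ i) = (\<Sum>i<s. y (Suc i) * B ^ i)" using eq 0 lt by simp
  then have "\<forall>i<s. x (Suc i) = y (Suc i)" using Suc.prems(2) by (intro Suc.IH) auto
  ultimately show ?case by (auto simp: less_Suc_eq_0_disj)
qed simp

text \<open>Horner's rule. Its step has the form \<open>a mod B + B * w\<close> because, for
  \<open>B\<close> a power of two, a program performs it by placing a fixed number of low bits of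
  \<open>a\<close> below \<open>w\<close>, without carries.\<close>

lemma foldr_digits:
  fixes as :: "nat list"
  assumes "\<forall>a\<in>set as. a < B"
  shows "foldr (\<lambda>a w. a mod B + B * w) as 0 = (\<Sum>i<length as. as ! i * B ^ i)"
  using assms
proof (induction as)
  case (Cons a as)
  then show ?case
    by (simp add: sum.lessThan_Suc_shift sum_distrib_left algebra_simps del: sum.lessThan_Suc)
qed simp

lemma sum_powers_count:
  fixes B :: nat
  assumes "set cs \<subseteq> {..<s}"
  shows "(\<Sum>c\<leftarrow>cs. B ^ c) = (\<Sum>i<s. count_list cs i * B ^ i)"
  using assms
proof (induction cs)
  case (Cons c cs)
  have "(\<Sum>i<s. count_list (c # cs) i * B ^ i) =
      (\<Sum>i<s. (if i = c then B ^ i else 0) + count_list cs i * B ^ i)"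
    by (rule sum.cong) auto
  with Cons show ?case by (simp add: sum.distrib)
qed simp

section \<open>Positions in the leaf sequence of a route\<close>

lemma nth_inj_filter:
  assumes "distinct (filter P xs)" and "i < length xs" and "j < length xs" and "xs ! i = xs ! j" and "P (xs ! i)"
  shows "i = j"
proof -
  have False if "distinct (filter P xs)" "i < j" "j < length xs" "xs ! i = xs ! j" "P (xs ! i)" for i j
  proof -
    have "xs = take j xs @ xs ! j # drop (Suc j) xs" by (rule id_take_nth_drop[OF that(3)])
    then have "distinct (filter P (take j xs) @ xs ! j # filter P (drop (Suc j) xs))"
      using that(1,4,5) by (metis filter.simps(2) filter_append)
    moreover have "xs ! i \<in> set (take j xs)"
      using that(2,3) nth_mem[of i "take j xs"] by simp
    ultimately show False using that(4,5) by auto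
  qed
  then show ?thesis using assms by (metis linorder_neqE_nat)
qed

lemma filter_flatten: "\<forall>t\<in>set ts. 0 \<notin> set t \<Longrightarrow> filter (\<lambda>x. x \<noteq> 0) (flatten ts) = concat ts"
proof (induction ts)
  case (Cons t ts)
  moreover have "\<forall>x\<in>set t. x \<noteq> 0" using Cons.prems by (metis list.set_intros(1))
  then have "filter (\<lambda>x. x \<noteq> 0) t = t" by (rule filter_True)
  ultimately show ?case by simp
qed simp

lemma flatten_nth_inj:
  assumes "distinct (concat ts)" and "0 \<notin> set (concat ts)" and "i < length (flatten ts)"
    and "j < length (flatten ts)" and "flatten ts ! i = flatten ts ! j" and "flatten ts ! i \<noteq> 0"
  shows "i = j"
  by (rule nth_inj_filter[where P = "\<lambda>x. x \<noteq> 0" and xs = "flatten ts"])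
    (use assms filter_flatten[of ts] in auto)

text \<open>Consecutive trips are separated by a visit to the depot, so adjacent entries other than
  the depot come from one trip.\<close>

lemma flatten_adjacent:
  assumes "Suc i < length (flatten ts)" and "flatten ts ! i \<noteq> 0" and "flatten ts ! Suc i \<noteq> 0"
  shows "\<exists>t\<in>set ts. flatten ts ! i \<in> set t \<and> flatten ts ! Suc i \<in> set t"
proof -
  let ?P = "\<lambda>ts a b. a = 0 \<or> b = 0 \<or> (\<exists>t\<in>set ts. a \<in> set t \<and> b \<in> set t)"
  have "successively (?P ts) (flatten ts)"
  proof (induction ts)
    case (Cons t ts)
    have "successively (?P (t # ts)) t"
      unfolding successively_conv_nth by (metis Suc_lessD list.set_intros(1) nth_mem)
    moreover have "successively (?P (t # ts)) (flatten ts)"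
      by (rule successively_mono[OF Cons]) auto
    ultimately have "successively (?P (t # ts)) (t @ flatten ts)"
      by (simp add: successively_append_iff)
    then show ?case by (simp add: successively_Cons)
  qed simp
  from successively_nth[OF this assms(1)] assms show ?thesis by auto
qed

section \<open>Complaints and separated neighbours\<close>

lemma finite_forward_set: "finite (forward_set n us)"
proof (rule finite_subset)
  show "forward_set n us \<subseteq> (\<lambda>i. Suc (us ! i) mod n) ` {..<length us}"
    unfolding forward_set_def by auto
qed simp

lemma finite_backward_set: "finite (backward_set n us)"
  unfolding backward_set_def by simp

text \<open>If \<open>j\<close> comes first, the leaves seen at the turn after \<open>j\<close>
  include one leaf beyond \<open>j\<close>; it is not \<open>Suc j\<close>, because no trip contains
  both. If \<open>Suc j\<close> comes first, the leaves seen at the turn into it end with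
  \<open>Suc j\<close> itself, and \<open>j\<close> is later.\<close>

lemma complaint_pair:
  assumes d: "distinct (concat ts)" and ts: "set (concat ts) = {1..<n}"
    and j: "1 \<le> j" "Suc j < n" and sep: "\<not> (\<exists>t\<in>set ts. j \<in> set t \<and> Suc j \<in> set t)"
  shows "Suc j \<in> forward_set n (flatten ts) \<or> j \<in> backward_set n (flatten ts)"
proof -
  let ?us = "flatten ts"
  have z: "0 \<notin> set (concat ts)" using ts by simp
  have "j \<in> set ?us" "Suc j \<in> set ?us"
    using j ts by (auto simp: set_flatten)
  then obtain p p' where p: "p < length ?us" "?us ! p = j" and p': "p' < length ?us" "?us ! p' = Suc j"
    by (meson in_set_conv_nth)
  have uniq: "i = i'" if "i < length ?us" "i' < length ?us" "?us ! i = ?us ! i'" "?us ! i \<noteq> 0" for i i'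
    using flatten_nth_inj[OF d z that] .
  have nadj: "p' \<noteq> Suc p" using flatten_adjacent[of p ts] p p' j sep by auto
  consider "p < p'" | "p' < p" using p p' by (cases p p' rule: linorder_cases) auto
  then show ?thesis
  proof cases
    case 1
    have "Suc j \<notin> set (take (p + 2) ?us)"
    proof
      assume "Suc j \<in> set (take (p + 2) ?us)"
      then obtain i where "i < p + 2" "i < length ?us" "?us ! i = Suc j" by (auto simp: in_set_conv_nth)
      moreover from this have "i = p'" using p' by - (rule uniq, simp_all)
      ultimately show False using 1 nadj by linarith
    qed
    moreover have "Suc j = Suc (?us ! p) mod n" "Suc p < length ?us" using p p' 1 j by auto
    ultimately have "Suc j \<in> forward_set n ?us"
      unfolding forward_set_def by (intro CollectI exI[of _ p]) simp
    then show ?thesis ..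
  next
    case 2
    \<comment> \<open>The route starts at the depot, so there is a turn into \<open>Suc j\<close>
      that can cause the complaint.\<close>
    have "?us ! 0 = 0" using hd_conv_nth[of ?us] by simp
    then have "p' \<noteq> 0" using p' by (metis nat.distinct(1))
    then obtain q where q: "p' = Suc q" by (cases p') auto
    have "j \<notin> set (take (q + 2) ?us)"
    proof
      assume "j \<in> set (take (q + 2) ?us)"
      then obtain i where "i < q + 2" "i < length ?us" "?us ! i = j" by (auto simp: in_set_conv_nth)
      moreover from this have "i = p" using p j by - (rule uniq, simp_all)
      ultimately show False using 2 q by linarith
    qed
    then have "j \<in> backward_set n ?us"
      unfolding backward_set_def using p' q j by (intro CollectI conjI exI[of _ q]) auto
    then show ?thesis ..
  qed
qed

text \<open>This is what the dummy is for: without it, the contribution of the neighbours of the depot would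
  depend on whether the first and the last bead go to the same part.\<close>

lemma complaint_depot:
  assumes d: "distinct (concat ts)" and ts: "set (concat ts) = {1..<n}" and q: "[1] \<in> set ts" and n: "3 \<le> n"
  shows "1 \<in> forward_set n (flatten ts) \<or> n - 1 \<in> backward_set n (flatten ts)"
proof -
  obtain t ts' where t: "ts = t # ts'" using q by (cases ts) auto
  have nth: "flatten ts ! 0 = 0" "1 < length (flatten ts)" unfolding t by (cases ts'; simp)+
  show ?thesis
  proof (cases "flatten ts ! 1 = 1")
    \<comment> \<open>The first trip begins with the dummy, hence it is the dummy trip. The route is
      back at the depot, at position \<open>2\<close>, before it has seen the last leaf
      \<open>n - 1\<close>, which therefore complains backward.\<close>
    case True
    then have "\<exists>t'. t = 1 # t'" unfolding t by (cases t; cases ts') auto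
    then obtain t' where t': "t = 1 # t'" ..
    have "t = [1]"
    proof (rule ccontr)
      assume "t \<noteq> [1]"
      then have "[1] \<in> set ts'" using q t by auto
      then show False using d unfolding t t' by auto
    qed
    then have us: "flatten ts = 0 # 1 # flatten ts'" unfolding t by simp
    obtain vs where "flatten ts' = 0 # vs" by (cases ts') auto
    then have "flatten ts = 0 # 1 # 0 # vs" unfolding us by simp
    then have "n - 1 \<in> backward_set n (flatten ts)"
      unfolding backward_set_def using n by (intro CollectI conjI exI[of _ 1]) auto
    then show ?thesis ..
  next
    \<comment> \<open>The very first turn leads from the depot to something other than leaf
      \<open>1\<close>, which thereby gets a forward complaint.\<close>
    case False
    have "take 2 (flatten ts) = [0, flatten ts ! 1]"
      using nth by (cases "flatten ts"; cases "tl (flatten ts)") (auto simp: numeral_2_eq_2)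
    then have "1 \<in> forward_set n (flatten ts)"
      unfolding forward_set_def using False nth n by (intro CollectI exI[of _ 0]) (simp add: numeral_2_eq_2)
    then show ?thesis ..
  qed
qed

text \<open>The forward complaint of \<open>1\<close> or the backward complaint of
  \<open>n - 1\<close> comes on top: pairs in \<open>X\<close> are charged to forward complaints of
  leaves from \<open>2\<close> on and to backward complaints of leaves below
  \<open>n - 1\<close>.\<close>

lemma unfairness_lower_bound:
  assumes d: "distinct (concat ts)" and ts: "set (concat ts) = {1..<n}" and q: "[1] \<in> set ts" and n: "3 \<le> n"
    and X: "X \<subseteq> {1..<n - 1}" "\<forall>j\<in>X. \<not> (\<exists>t\<in>set ts. j \<in> set t \<and> Suc j \<in> set t)"
  shows "card X + 1 \<le> card (forward_set n (flatten ts)) + card (backward_set n (flatten ts))"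
proof -
  let ?F = "forward_set n (flatten ts)" and ?B = "backward_set n (flatten ts)"
  let ?X1 = "{j \<in> X. Suc j \<in> ?F}" and ?X2 = "{j \<in> X. j \<in> ?B}"
  have fin: "finite ?F" "finite ?B" "finite X"
    using finite_forward_set finite_backward_set finite_subset[OF X(1)] by auto
  have "X = ?X1 \<union> ?X2"
  proof -
    have "Suc j \<in> ?F \<or> j \<in> ?B" if "j \<in> X" for j
    proof (rule complaint_pair[OF d ts])
      have "j \<in> {1..<n - 1}" using that X(1) by blast
      then show "1 \<le> j" "Suc j < n" by auto
      show "\<not> (\<exists>t\<in>set ts. j \<in> set t \<and> Suc j \<in> set t)" using that X(2) by blast
    qed
    then show ?thesis by auto
  qed
  then have le: "card X \<le> card ?X1 + card ?X2" using card_Un_le[of ?X1 ?X2] by simp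
  from complaint_depot[OF d ts q n] show ?thesis
  proof
    assume 1: "1 \<in> ?F"
    have "1 \<notin> Suc ` ?X1" using X(1) by auto
    then have "card ?X1 + 1 = card (insert 1 (Suc ` ?X1))"
      using fin by (simp add: card_image)
    also have "\<dots> \<le> card ?F" using 1 fin by (intro card_mono) auto
    finally have "card ?X1 + 1 \<le> card ?F" .
    moreover have "card ?X2 \<le> card ?B" using fin by (intro card_mono) auto
    ultimately show ?thesis using le by linarith
  next
    assume 1: "n - 1 \<in> ?B"
    have "n - 1 \<notin> ?X2" using X(1) by auto
    then have "card ?X2 + 1 = card (insert (n - 1) ?X2)"
      using fin by simp
    also have "\<dots> \<le> card ?B" using 1 fin by (intro card_mono) auto
    finally have "card ?X2 + 1 \<le> card ?B" .
    moreover have "card ?X1 = card (Suc ` ?X1)" by (simp add: card_image)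
    moreover have "card (Suc ` ?X1) \<le> card ?F" using fin by (intro card_mono) auto
    ultimately show ?thesis using le by linarith
  qed
qed

text \<open>With the dummy trip in front, depot and dummy have been seen from the first turn on, so
  next to the pairs in \<open>X\<close> only the backward complaint of \<open>n - 1\<close> can
  occur. A pair in \<open>X\<close> counts at most once: a forward complaint means that
  \<open>j\<close> is visited before \<open>Suc j\<close>, a backward one means the
  opposite.\<close>

lemma unfairness_upper_bound:
  assumes d: "distinct (concat ts)" and ts: "set (concat ts) = {1..<n}" and n: "3 \<le> n"
    and q: "ts = [1] # ts'"
    and X: "finite X" "\<And>j. 1 \<le> j \<Longrightarrow> Suc j < n \<Longrightarrow> j \<notin> X \<Longrightarrow>
      \<exists>i. Suc i < length (flatten ts) \<and> flatten ts ! i = j \<and> flatten ts ! Suc i = Suc j"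
  shows "card (forward_set n (flatten ts)) + card (backward_set n (flatten ts)) \<le> card X + 1"
proof -
  let ?us = "flatten ts"
  let ?F = "forward_set n ?us" and ?B = "backward_set n ?us"
  have z: "0 \<notin> set (concat ts)" using ts by simp
  have uniq: "i = i'" if "i < length ?us" "i' < length ?us" "?us ! i = ?us ! i'" "?us ! i \<noteq> 0" for i i'
    using flatten_nth_inj[OF d z that] .
  have us01: "take 2 ?us = [0, 1]" unfolding q by (simp add: numeral_2_eq_2)
  have in_take: "x \<in> set (take (i + 2) ?us)" if "x \<in> {0, 1}" for x i
  proof -
    have "set (take 2 ?us) \<subseteq> set (take (i + 2) ?us)" by (rule set_take_subset_set_take) simp
    then show ?thesis using that us01 by auto
  qed
  have usn: "?us ! i < n" if "i < length ?us" for i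
  proof -
    have "set ?us \<subseteq> insert 0 {1..<n}" using ts by (auto simp: set_flatten)
    then show ?thesis using nth_mem[OF that] n by auto
  qed
  have F: "\<exists>j\<in>X. x = Suc j \<and> (\<exists>i. Suc i < length ?us \<and> ?us ! i = j \<and> Suc j \<notin> set (take (i + 2) ?us))"
    if x: "x \<in> ?F" for x
  proof -
    obtain i where i: "x = Suc (?us ! i) mod n" "Suc i < length ?us" "x \<notin> set (take (i + 2) ?us)"
      using x unfolding forward_set_def by auto
    let ?j = "?us ! i"
    have "x \<notin> {0, 1}" using in_take[of x i] i(3) by blast
    then have x0: "x \<noteq> 0" "x \<noteq> 1" by auto
    have jn: "Suc ?j < n"
      using usn[of i] i x0 by (auto simp: mod_Suc split: if_splits)
    then have xj: "x = Suc ?j" using i(1) by simp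
    then have j1: "1 \<le> ?j" using x0 by simp
    have "?j \<in> X"
    proof (rule ccontr)
      assume "?j \<notin> X"
      then obtain i' where i': "Suc i' < length ?us" "?us ! i' = ?j" "?us ! Suc i' = Suc ?j"
        using X(2)[OF j1 jn] by blast
      then have "i' = i" using i(2) j1 by - (rule uniq, simp_all)
      then have "take (i + 2) ?us ! Suc i = x" using i' xj by simp
      then have "x \<in> set (take (i + 2) ?us)"
        using nth_mem[of "Suc i" "take (i + 2) ?us"] i(2) by simp
      then show False using i(3) by contradiction
    qed
    then show ?thesis using xj i by auto
  qed
  have B: "j \<noteq> n - 1 \<Longrightarrow> j \<in> X \<and> (\<exists>i. Suc i < length ?us \<and> ?us ! Suc i = Suc j \<and> j \<notin> set (take (i + 2) ?us))"
    if j: "j \<in> ?B" for j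
  proof -
    assume jn: "j \<noteq> n - 1"
    obtain i where i: "j < n" "Suc i < length ?us" "Suc j mod n = ?us ! Suc i" "j \<notin> set (take (i + 2) ?us)"
      using j unfolding backward_set_def by auto
    have "j \<notin> {0, 1}" using in_take[of j i] i(4) by blast
    then have j0: "j \<noteq> 0" by auto
    have sj: "Suc j < n" using i(1) jn by simp
    then have us: "?us ! Suc i = Suc j" using i(3) by simp
    have "j \<in> X"
    proof (rule ccontr)
      assume "j \<notin> X"
      then obtain i' where i': "Suc i' < length ?us" "?us ! i' = j" "?us ! Suc i' = Suc j"
        using X(2)[OF _ sj] j0 by auto
      then have "Suc i' = Suc i" using i(2) us by - (rule uniq, simp_all)
      then have "take (i + 2) ?us ! i = j" using i' by simp
      then have "j \<in> set (take (i + 2) ?us)"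
        using nth_mem[of i "take (i + 2) ?us"] i(2) by simp
      then show False using i(4) by contradiction
    qed
    then show ?thesis using us i by auto
  qed
  let ?F' = "{j \<in> X. Suc j \<in> ?F}" and ?B' = "?B - {n - 1}"
  have "?F \<subseteq> Suc ` ?F'" using F by force
  then have "card ?F \<le> card (Suc ` ?F')" using X(1) by (intro card_mono) auto
  also have "\<dots> = card ?F'" by (simp add: card_image)
  finally have cF: "card ?F \<le> card ?F'" .
  have "card ?B \<le> card (insert (n - 1) ?B')" using finite_backward_set by (intro card_mono) auto
  also have "\<dots> \<le> card ?B' + 1" by (subst card_insert_disjoint) (simp_all add: finite_backward_set)
  finally have cB: "card ?B \<le> card ?B' + 1" .
  have "?F' \<inter> ?B' = {}"
  proof (rule ccontr)
    assume "?F' \<inter> ?B' \<noteq> {}"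
    then obtain j where j: "Suc j \<in> ?F" "j \<in> ?B" "j \<noteq> n - 1" by auto
    obtain i where i: "Suc i < length ?us" "?us ! i = j" "Suc j \<notin> set (take (i + 2) ?us)"
      using F[OF j(1)] by auto
    obtain i' where i': "Suc i' < length ?us" "?us ! Suc i' = Suc j" "j \<notin> set (take (i' + 2) ?us)"
      using B[OF j(2,3)] by auto
    have "\<not> Suc i' < i + 2"
    proof
      assume "Suc i' < i + 2"
      then have "Suc j \<in> set (take (i + 2) ?us)"
        using nth_mem[of "Suc i'" "take (i + 2) ?us"] i' by simp
      then show False using i(3) by contradiction
    qed
    moreover have "\<not> i < i' + 2"
    proof
      assume "i < i' + 2"
      then have "j \<in> set (take (i' + 2) ?us)"
        using nth_mem[of i "take (i' + 2) ?us"] i by simp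
      then show False using i'(3) by contradiction
    qed
    ultimately show False by linarith
  qed
  then have "card ?F' + card ?B' = card (?F' \<union> ?B')"
    using X(1) finite_backward_set by (intro card_Un_disjoint[symmetric]) auto
  also have "\<dots> \<le> card X" using X(1) B by (intro card_mono) auto
  finally show ?thesis using cF cB by linarith
qed

section \<open>The reduction\<close>

text \<open>Beads of colour \<open>c\<close> have weight \<open>B ^ c\<close> with \<open>B = 2 ^ length (beads N)\<close>, so that the weight of a
  trip determines the number of its beads of each colour.  The leaf \<open>2 ^ 1\<close> is a dummy that fills a
  trip of its own, and the leaf \<open>2 ^ (j + 2)\<close> stands for the \<open>j\<close>-th bead.\<close>

definition share_weight :: "necklace \<Rightarrow> nat" where
  "share_weight N =
     foldr (\<lambda>a w. a mod 2 ^ length (beads N) + 2 ^ length (beads N) * w) (shares N) 0"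

text \<open>The depot edge admits one trip per part and one more for the dummy, which weighs as much
  as the share of a part. All other edges have frequency one, so that their leaves are visited
  exactly once.\<close>

definition leaf_specs :: "necklace \<Rightarrow> (nat \<times> nat) list" where
  "leaf_specs N = (1, Suc (parts N)) # (share_weight N, 1) #
     map (\<lambda>c. ((2 ^ length (beads N)) ^ c, 1)) (beads N)"

text \<open>The depot edge has length one and every edge is traversed in both directions, so a trip
  of weight \<open>share_weight N\<close> has length \<open>2 * Suc (share_weight N)\<close>.
  Capacity times maximum length is exactly this number. The factor
  \<open>2 ^ length (beads N)\<close> is at least the number of trips, which makes room for all of
  them.\<close>

definition plan_of_necklace :: "necklace \<Rightarrow> routing" where
  "plan_of_necklace N = star_routing (leaf_specs N)
     (2 ^ length (beads N) * (2 * Suc (share_weight N))) (1 / of_nat (2 ^ length (beads N)))"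

text \<open>The state consists of the number of the current part, a flag for the trip of the dummy, which
  does not count as a part, and the table of the parts and colours of all beads.\<close>

definition mark :: "nat \<Rightarrow> nat \<Rightarrow> (nat \<times> nat) list \<Rightarrow> (nat \<times> nat) list" where
  "mark v p tab = rev (snd (fold (\<lambda>e st. (fst st div 2, (if odd (fst st) then (p, snd e) else e) # snd st))
     tab (v, [])))"

text \<open>The target of the arc is recognised by its bits: bit \<open>0\<close> is the depot, bit
  \<open>1\<close> the dummy, and two halvings turn a bead leaf \<open>2 ^ (j + 2)\<close> into
  \<open>2 ^ j\<close>. An arc into the centre \<open>0\<close> has no effect. A part is complete
  when the depot is reached.\<close>

definition read_arc ::
  "nat \<times> nat \<Rightarrow> nat \<times> bool \<times> (nat \<times> nat) list \<Rightarrow> nat \<times> bool \<times> (nat \<times> nat) list" where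
  "read_arc a st =
     (if odd (snd a) \<and> \<not> fst (snd st) then Suc (fst st) else fst st,
      if odd (snd a) then False else if odd (snd a div 2) then True else fst (snd st),
      mark (snd a div 2 div 2) (fst st) (snd (snd st)))"

definition splitting_of_route :: "necklace \<Rightarrow> (nat \<times> nat) list \<Rightarrow> splitting" where
  "splitting_of_route N w = runs_of (snd (snd (fold read_arc w (0, False, map (Pair 0) (beads N)))))"

text \<open>Halving along the table brings the only bit of \<open>2 ^ j\<close> to the lowest place
  exactly at entry \<open>j\<close>.\<close>

lemma mark_fold:
  "snd (fold (\<lambda>e st. (fst st div 2, (if odd (fst st) then (p, snd e) else e) # snd st)) tab (0 :: nat, out))
     = rev tab @ out"
  "snd (fold (\<lambda>e st. (fst st div 2, (if odd (fst st) then (p, snd e) else e) # snd st)) tab (2 ^ j :: nat, out))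
     = rev (if j < length tab then tab[j := (p, snd (tab ! j))] else tab) @ out"
proof -
  have 0: "snd (fold (\<lambda>e st. (fst st div 2, (if odd (fst st) then (p, snd e) else e) # snd st)) tab (0 :: nat, out))
     = rev tab @ out" for tab out
    by (induction tab arbitrary: out) auto
  show "snd (fold (\<lambda>e st. (fst st div 2, (if odd (fst st) then (p, snd e) else e) # snd st)) tab (0 :: nat, out))
     = rev tab @ out" by (rule 0)
  show "snd (fold (\<lambda>e st. (fst st div 2, (if odd (fst st) then (p, snd e) else e) # snd st)) tab (2 ^ j :: nat, out))
     = rev (if j < length tab then tab[j := (p, snd (tab ! j))] else tab) @ out"
  proof (induction tab arbitrary: j out)
    case (Cons e tab)
    then show ?case by (cases j) (auto simp: 0)
  qed simp
qed

lemma mark_0 [simp]: "mark 0 p tab = tab"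
  by (simp add: mark_def mark_fold)

lemma mark_power: "j < length tab \<Longrightarrow> mark (2 ^ j) p tab = tab[j := (p, snd (tab ! j))]"
  by (simp add: mark_def mark_fold)

lemma read_arc_centre [simp]: "read_arc (u, 0) st = st"
  by (simp add: read_arc_def)

lemma read_arc_depot: "read_arc (0, 2 ^ 0) (p, f, tab) = (if f then p else Suc p, False, tab)"
  by (simp add: read_arc_def)

lemma read_arc_dummy: "read_arc (0, 2 ^ 1) (p, f, tab) = (p, True, tab)"
  by (simp add: read_arc_def)

lemma read_arc_bead:
  "j < length tab \<Longrightarrow> read_arc (0, 2 ^ (j + 2)) (p, f, tab) = (p, f, tab[j := (p, snd (tab ! j))])"
  by (simp add: read_arc_def mark_power)

lemma fold_read_star_walk:
  "fold read_arc (star_walk us) st = fold (\<lambda>j. read_arc (0, 2 ^ j)) (tl us) st"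
  by (induction us arbitrary: st rule: star_walk.induct) auto

lemma tl_flatten: "tl (flatten ts) = concat (map (\<lambda>t. t @ [0]) ts)"
proof (induction ts)
  case (Cons t ts)
  have "flatten ts = 0 # tl (flatten ts)" by (cases ts) auto
  then show ?case using Cons by simp
qed simp

lemma read_trip:
  assumes "set t \<subseteq> {2..<length tab + 2}"
  shows "\<exists>tab'. fold (\<lambda>j. read_arc (0, 2 ^ j)) (t @ [0]) (p, False, tab) = (Suc p, False, tab') \<and>
    map snd tab' = map snd tab \<and>
    (\<forall>j<length tab. tab' ! j = (if j + 2 \<in> set t then (p, snd (tab ! j)) else tab ! j))"
  using assms
proof (induction t arbitrary: tab)
  case Nil
  show ?case using read_arc_depot by (intro exI[of _ tab]) simp
next
  case (Cons x t)
  define y where "y = x - 2"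
  have x: "x = y + 2" "y < length tab" using Cons.prems by (auto simp: y_def)
  let ?tab = "tab[y := (p, snd (tab ! y))]"
  obtain tab' where tab': "fold (\<lambda>j. read_arc (0, 2 ^ j)) (t @ [0]) (p, False, ?tab) = (Suc p, False, tab')"
    "map snd tab' = map snd ?tab"
    "\<forall>j<length ?tab. tab' ! j = (if j + 2 \<in> set t then (p, snd (?tab ! j)) else ?tab ! j)"
    using Cons.IH[of ?tab] Cons.prems by auto
  have "map snd ?tab = map snd tab"
    using x(2) by (simp add: map_update list_update_same_conv)
  moreover have "tab' ! j = (if j + 2 \<in> set (x # t) then (p, snd (tab ! j)) else tab ! j)"
    if "j < length tab" for j
    using tab'(3) that x by (cases "j = y") auto
  ultimately show ?case
    using tab'(1,2) read_arc_bead[OF x(2), of p False] x(1) by (intro exI[of _ tab']) simp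
qed

text \<open>Trips are disjoint, so no later trip overwrites the number that an earlier one has
  entered.\<close>

lemma read_trips:
  assumes "distinct (concat ts)" and "set (concat ts) \<subseteq> {2..<length tab + 2}"
  shows "\<exists>tab'. fold (\<lambda>j. read_arc (0, 2 ^ j)) (concat (map (\<lambda>t. t @ [0]) ts)) (p, False, tab) =
      (p + length ts, False, tab') \<and> map snd tab' = map snd tab \<and>
    (\<forall>i<length ts. \<forall>j<length tab. j + 2 \<in> set (ts ! i) \<longrightarrow> fst (tab' ! j) = p + i) \<and>
    (\<forall>j<length tab. j + 2 \<notin> set (concat ts) \<longrightarrow> tab' ! j = tab ! j)"
  using assms
proof (induction ts arbitrary: p tab)
  case (Cons t ts)
  obtain tab1 where tab1: "fold (\<lambda>j. read_arc (0, 2 ^ j)) (t @ [0]) (p, False, tab) = (Suc p, False, tab1)"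
    "map snd tab1 = map snd tab"
    "\<forall>j<length tab. tab1 ! j = (if j + 2 \<in> set t then (p, snd (tab ! j)) else tab ! j)"
    using read_trip[of t tab p] Cons.prems by auto
  have len: "length tab1 = length tab" using tab1(2) by (metis length_map)
  obtain tab' where tab': "fold (\<lambda>j. read_arc (0, 2 ^ j)) (concat (map (\<lambda>t. t @ [0]) ts)) (Suc p, False, tab1) =
      (Suc p + length ts, False, tab')" "map snd tab' = map snd tab1"
    "\<forall>i<length ts. \<forall>j<length tab1. j + 2 \<in> set (ts ! i) \<longrightarrow> fst (tab' ! j) = Suc p + i"
    "\<forall>j<length tab1. j + 2 \<notin> set (concat ts) \<longrightarrow> tab' ! j = tab1 ! j"
    using Cons.IH[of tab1 "Suc p"] Cons.prems len by auto
  have "fst (tab' ! j) = p + i"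
    if "i < length (t # ts)" "j < length tab" "j + 2 \<in> set ((t # ts) ! i)" for i j
  proof (cases i)
    case 0
    then have "j + 2 \<in> set t" using that(3) by simp
    moreover from this have "j + 2 \<notin> set (concat ts)" using Cons.prems(1) by auto
    ultimately show ?thesis using tab1(3) tab'(4) that(2) len 0 by simp
  next
    case (Suc i')
    then show ?thesis using tab'(3) that len by simp
  qed
  moreover have "tab' ! j = tab ! j" if "j < length tab" "j + 2 \<notin> set (concat (t # ts))" for j
    using tab1(3) tab'(4) that len by simp
  ultimately show ?case using tab1(1,2) tab'(1,2) by (intro exI[of _ tab']) simp
qed simp

lemma distinct_if_count_1: "(\<And>x. x \<in> set xs \<Longrightarrow> count_list xs x = 1) \<Longrightarrow> distinct xs"
proof (induction xs)
  case (Cons x xs)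
  have "x \<notin> set xs" using Cons.prems[of x] by (simp add: count_list_0_iff)
  moreover have "count_list xs y = 1" if "y \<in> set xs" for y
    using Cons.prems[of y] that \<open>x \<notin> set xs\<close> by (auto split: if_splits)
  ultimately show ?case using Cons.IH by simp
qed simp

lemma sum_list_tight:
  fixes g :: "'a \<Rightarrow> nat"
  assumes "\<forall>x\<in>set xs. g x \<le> W"
  shows "(\<Sum>x\<leftarrow>xs. g x) \<le> length xs * W"
    and "(\<Sum>x\<leftarrow>xs. g x) = length xs * W \<Longrightarrow> \<forall>x\<in>set xs. g x = W"
  using assms
proof (induction xs)
  case (Cons x xs)
  { case 1 then show ?case using Cons.IH(1) by (simp add: add_mono) }
  { case 2
    then have "(\<Sum>x\<leftarrow>xs. g x) \<le> length xs * W" "g x \<le> W" using Cons.IH(1) by auto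
    moreover have "g x + (\<Sum>x\<leftarrow>xs. g x) = W + length xs * W" using 2(1) by simp
    ultimately have *: "g x = W" "(\<Sum>x\<leftarrow>xs. g x) = length xs * W" by linarith+
    have "\<forall>y\<in>set xs. g y \<le> W" using 2(2) by simp
    with *(2) have "\<forall>y\<in>set xs. g y = W" by (rule Cons.IH(2))
    with *(1) show ?case by simp }
qed auto

lemma flatten_append: "flatten (ts @ t # ts') = flatten ts @ t @ flatten ts'"
  by (induction ts) auto

section \<open>The trips of a route for a given necklace\<close>

locale necklace_instance =
  fixes N :: necklace
  assumes wf: "necklace_wf N"
begin

abbreviation "m \<equiv> length (beads N)"
abbreviation "k \<equiv> parts N"
abbreviation "s \<equiv> length (shares N)"
abbreviation "B \<equiv> 2 ^ m :: nat"
abbreviation "W \<equiv> share_weight N"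
abbreviation "wt j \<equiv> fst (leaf_specs N ! j)"
abbreviation "colours t \<equiv> map (\<lambda>j. beads N ! (j - 2)) t"

lemma k_pos: "1 \<le> k" and m_pos: "1 \<le> m" and colour: "set (beads N) \<subseteq> {..<s}"
  and count: "i < s \<Longrightarrow> count_list (beads N) i = k * shares N ! i"
  using wf by (auto simp: necklace_wf_def Suc_le_eq)

lemma share_le: "i < s \<Longrightarrow> shares N ! i \<le> m"
proof -
  assume i: "i < s"
  have "1 * shares N ! i \<le> k * shares N ! i" using k_pos by (rule mult_right_mono) simp
  also have "\<dots> \<le> m" using count[OF i] count_le_length[of "beads N" i] by simp
  finally show ?thesis by simp
qed

lemma m_less: "m < B"
  by (rule less_exp)

lemma W_eq: "W = (\<Sum>i<s. shares N ! i * B ^ i)"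
proof -
  have "\<forall>a\<in>set (shares N). a < B"
    using share_le m_less by (metis in_set_conv_nth le_less_trans)
  then show ?thesis unfolding share_weight_def by (rule foldr_digits)
qed

lemma sum_beads: "(\<Sum>c\<leftarrow>beads N. B ^ c) = k * W"
proof -
  have "(\<Sum>c\<leftarrow>beads N. B ^ c) = (\<Sum>i<s. k * shares N ! i * B ^ i)"
    unfolding sum_powers_count[OF colour] by (rule sum.cong) (simp_all add: count)
  then show ?thesis by (simp add: W_eq sum_distrib_left mult.assoc)
qed

lemma W_pos: "0 < W"
proof -
  obtain c cs where "beads N = c # cs" using m_pos by (cases "beads N") auto
  then have "0 < (\<Sum>c\<leftarrow>beads N. B ^ c)" by simp
  then show ?thesis unfolding sum_beads by simp
qed

text \<open>A colour that occurs has a positive share and hence at least \<open>k\<close> beads.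
  This keeps \<open>k\<close> polynomial although it is coded in binary; the code of the plan lists
  a number of gaps that grows linearly with \<open>k\<close>.\<close>

lemma k_le_m: "k \<le> m"
proof -
  obtain c cs where c: "beads N = c # cs" using m_pos by (cases "beads N") auto
  then have "0 < count_list (beads N) c" by simp
  moreover have cs: "c < s" using c colour by simp
  ultimately have "0 < shares N ! c" using count[OF cs] by simp
  then have "k * 1 \<le> k * shares N ! c" by (intro mult_left_mono) auto
  also have "\<dots> \<le> m" using count[OF cs] count_le_length[of "beads N" c] by simp
  finally show ?thesis by simp
qed

lemma length_specs [simp]: "length (leaf_specs N) = m + 2"
  by (simp add: leaf_specs_def)

lemma specs: "leaf_specs N ! 0 = (1, Suc k)" "leaf_specs N ! Suc 0 = (W, 1)"
  "2 \<le> j \<Longrightarrow> j < m + 2 \<Longrightarrow> leaf_specs N ! j = (B ^ (beads N ! (j - 2)), 1)"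
proof -
  show "leaf_specs N ! 0 = (1, Suc k)" "leaf_specs N ! Suc 0 = (W, 1)" by (simp_all add: leaf_specs_def)
  assume "2 \<le> j" "j < m + 2"
  then obtain i where "j = Suc (Suc i)" "i < m" by (metis add_2_eq_Suc' le_Suc_ex less_add_eq_less Suc_less_SucD add_2_eq_Suc)
  then show "leaf_specs N ! j = (B ^ (beads N ! (j - 2)), 1)" by (simp add: leaf_specs_def)
qed

lemma specs_1: "1 \<le> j \<Longrightarrow> j < m + 2 \<Longrightarrow> 0 < wt j \<and> snd (leaf_specs N ! j) = 1"
  using specs(2) specs(3)[of j] W_pos by (cases "j = 1") auto

lemma sum_trip:
  assumes "set t \<subseteq> {2..<m + 2}"
  shows "(\<Sum>j\<leftarrow>t. wt j) = (\<Sum>i<s. count_list (colours t) i * B ^ i)"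
proof -
  have "(\<Sum>j\<leftarrow>t. wt j) = (\<Sum>c\<leftarrow>colours t. B ^ c)"
    unfolding map_map by (rule arg_cong[where f = sum_list], rule map_cong) (use assms specs(3) in auto)
  moreover have "set (colours t) \<subseteq> {..<s}"
  proof
    fix c assume "c \<in> set (colours t)"
    then obtain j where "j \<in> set t" "c = beads N ! (j - 2)" by auto
    moreover from this assms have "j \<in> {2..<m + 2}" by blast
    then have "j - 2 < m" by auto
    ultimately have "c \<in> set (beads N)" by simp
    then show "c \<in> {..<s}" using colour by blast
  qed
  ultimately show ?thesis by (simp only: sum_powers_count)
qed

text \<open>The beads of a trip are distinct, so their counts, like the shares, are at most
  \<open>m\<close> and thus proper digits in base \<open>2 ^ m\<close>; equal weights then have
  equal digits.\<close>

lemma trip_colours: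
  assumes t: "set t \<subseteq> {2..<m + 2}" and d: "distinct t" and w: "(\<Sum>j\<leftarrow>t. wt j) = W"
  shows "\<forall>i<s. count_list (colours t) i = shares N ! i"
proof (rule digits_unique)
  show "(\<Sum>i<s. count_list (colours t) i * B ^ i) = (\<Sum>i<s. shares N ! i * B ^ i)"
    using sum_trip[OF t] w W_eq by simp
  have "length t \<le> m"
    using card_mono[OF _ t] distinct_card[OF d] by simp
  then have "count_list (colours t) i \<le> m" for i
    using count_le_length[of "colours t" i] by simp
  then show "\<forall>i<s. count_list (colours t) i < B \<and> shares N ! i < B"
    using share_le m_less by (meson le_less_trans)
qed

lemma sum_leaves: "(\<Sum>j\<in>{1..<m + 2}. wt j) = Suc k * W"
proof -
  have "{1..<m + 2} = insert 1 ((\<lambda>j. j + 2) ` {..<m})"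
  proof -
    have "j \<in> insert 1 ((\<lambda>j. j + 2) ` {..<m})" if "j \<in> {1..<m + 2}" for j
      using that by (cases "j = 1") (auto intro!: image_eqI[of _ _ "j - 2"])
    then have "{1..<m + 2} \<subseteq> insert 1 ((\<lambda>j. j + 2) ` {..<m})" by blast
    moreover have "insert 1 ((\<lambda>j. j + 2) ` {..<m}) \<subseteq> {1..<m + 2}" by auto
    ultimately show ?thesis by (rule equalityI)
  qed
  then have "(\<Sum>j\<in>{1..<m + 2}. wt j) = (\<Sum>j\<in>insert 1 ((\<lambda>j. j + 2) ` {..<m}). wt j)" by (rule arg_cong)
  also have "\<dots> = wt 1 + (\<Sum>j\<in>(\<lambda>j. j + 2) ` {..<m}. wt j)" by (rule sum.insert) auto
  also have "(\<Sum>j\<in>(\<lambda>j. j + 2) ` {..<m}. wt j) = (\<Sum>j<m. wt (j + 2))"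
    by (subst sum.reindex) (simp_all add: inj_on_def)
  also have "(\<Sum>j<m. wt (j + 2)) = (\<Sum>j<m. B ^ (beads N ! j))"
    using specs(3) by (intro sum.cong) auto
  also have "(\<Sum>j<m. B ^ (beads N ! j)) = k * W" using sum_beads by (simp add: sum_list_sum_nth atLeast0LessThan)
  finally show ?thesis using specs(2) by simp
qed

abbreviation "T \<equiv> 2 * Suc W"
abbreviation "L \<equiv> B * T"

lemma route_iff: "vehicle_route (plan_of_necklace N) w \<longleftrightarrow>
    (\<exists>ts. trips_ok (leaf_specs N) L T ts \<and> w = star_walk (flatten ts))"
proof -
  have "1 / x * (x * y) = y" if "x \<noteq> 0" for x y :: rat using that by simp
  from this[of "rat_of_nat B" "rat_of_nat T"]
  have "(1 / of_nat B) * rat_of_nat L = rat_of_nat T" by (simp only: of_nat_mult) simp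
  moreover have "leaf_specs N \<noteq> []" by (simp add: leaf_specs_def)
  moreover have "trips_ok (leaf_specs N) L T ts \<Longrightarrow> \<forall>t\<in>set ts. 0 \<notin> set t" for ts
    unfolding trips_ok_def by fastforce
  ultimately show ?thesis
    unfolding plan_of_necklace_def using vehicle_route_star_iff by blast
qed

text \<open>The leaves weigh \<open>Suc k * W\<close> together, and at most \<open>Suc k\<close>
  trips carry at most \<open>W\<close> each, so there is no slack: every trip is full. The dummy
  alone already weighs \<open>W\<close> and all weights are positive, hence it travels
  alone.\<close>

lemma trips_structure:
  assumes ok: "trips_ok (leaf_specs N) L T ts"
  shows "distinct (concat ts)" "set (concat ts) = {1..<m + 2}" "length ts = Suc k"
    "\<forall>t\<in>set ts. (\<Sum>j\<leftarrow>t. wt j) = W" "[1] \<in> set ts"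
proof -
  have sub: "set t \<subseteq> {1..<m + 2}" and le: "(\<Sum>j\<leftarrow>t. wt j) \<le> W" if "t \<in> set ts" for t
    using ok that unfolding trips_ok_def by (auto simp: specs)
  have c1: "count_list (concat ts) j = 1" if "j \<in> {1..<m + 2}" for j
  proof -
    have "1 \<le> count_list (concat ts) j \<and> count_list (concat ts) j \<le> snd (leaf_specs N ! j)"
      using ok that unfolding trips_ok_def length_specs by blast
    then show ?thesis using specs_1[of j] that by simp
  qed
  have len: "length ts \<le> Suc k" using ok unfolding trips_ok_def by (simp add: specs)
  show set: "set (concat ts) = {1..<m + 2}"
  proof
    show "set (concat ts) \<subseteq> {1..<m + 2}" using sub by auto
    show "{1..<m + 2} \<subseteq> set (concat ts)" using c1 by (metis count_list_0_iff subsetI zero_neq_one)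
  qed
  show d: "distinct (concat ts)" by (rule distinct_if_count_1) (use c1 set in blast)
  have "(\<Sum>t\<leftarrow>ts. \<Sum>j\<leftarrow>t. wt j) = (\<Sum>j\<leftarrow>concat ts. wt j)" by (induction ts) auto
  also have "\<dots> = Suc k * W"
    unfolding sum_list_distinct_conv_sum_set[OF d] set by (rule sum_leaves)
  finally have sum: "(\<Sum>t\<leftarrow>ts. \<Sum>j\<leftarrow>t. wt j) = Suc k * W" .
  then have "Suc k * W \<le> length ts * W"
    using sum_list_tight(1)[of ts "\<lambda>t. \<Sum>j\<leftarrow>t. wt j" W] le by simp
  then have "Suc k \<le> length ts" using W_pos mult_le_cancel2[of "Suc k" W "length ts"] by blast
  then show len: "length ts = Suc k" using len by simp
  show w: "\<forall>t\<in>set ts. (\<Sum>j\<leftarrow>t. wt j) = W"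
    by (rule sum_list_tight(2)) (use le sum len in auto)
  have "1 \<in> set (concat ts)" using set by simp
  then obtain t where t: "t \<in> set ts" "1 \<in> set t" by auto
  then obtain u v where uv: "t = u @ 1 # v" by (meson split_list)
  have "(\<Sum>j\<leftarrow>u @ v. wt j) = 0" using w t(1) specs(2) by (auto simp: uv)
  moreover have "0 < wt j \<and> wt j \<le> (\<Sum>j\<leftarrow>u @ v. wt j)" if "j \<in> set (u @ v)" for j
  proof
    show "0 < wt j" using sub[OF t(1)] specs_1[of j] that uv by auto
    show "wt j \<le> (\<Sum>j\<leftarrow>u @ v. wt j)" by (rule member_le_sum_list) (use that in auto)
  qed
  ultimately have "\<forall>j. j \<notin> set (u @ v)" by (metis leD)
  then have "set (u @ v) = {}" by (auto simp del: set_append)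
  then have "u @ v = []" by simp
  then show "[1] \<in> set ts" using t(1) uv by simp
qed

text \<open>The extra element \<open>1\<close> stands for the dummy and the first bead, which are
  never in the same trip. Bead \<open>i\<close> has leaf index \<open>i + 2\<close>, whence the
  shift by two.\<close>

lemma card_separations:
  assumes "length ls = m"
  shows "card (insert 1 {j. 2 \<le> j \<and> Suc j < m + 2 \<and> ls ! (j - 2) \<noteq> ls ! (Suc j - 2)}) = Suc (changes ls)"
proof -
  let ?A = "{j. Suc j < length ls \<and> ls ! j \<noteq> ls ! Suc j}" and ?f = "\<lambda>j :: nat. Suc (Suc j)"
  have "{j. 2 \<le> j \<and> Suc j < m + 2 \<and> ls ! (j - 2) \<noteq> ls ! (Suc j - 2)} = ?f ` ?A"
  proof (rule set_eqI)
    fix j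
    show "j \<in> {j. 2 \<le> j \<and> Suc j < m + 2 \<and> ls ! (j - 2) \<noteq> ls ! (Suc j - 2)} \<longleftrightarrow> j \<in> ?f ` ?A"
    proof (cases "\<exists>i. j = ?f i")
      case True
      then obtain i where "j = ?f i" ..
      then show ?thesis using assms by auto
    next
      case False
      then have "\<not> 2 \<le> j" using le_Suc_ex[of 2 j] by auto
      then show ?thesis using False by auto
    qed
  qed
  moreover have "card (insert 1 (?f ` ?A)) = Suc (card (?f ` ?A))"
  proof (rule card_insert_disjoint)
    show "finite (?f ` ?A)" by (rule finite_imageI, rule finite_subset[of _ "{..<length ls}"]) auto
  qed auto
  moreover have "card (?f ` ?A) = card ?A" by (rule card_image) (simp add: inj_on_def)
  ultimately show ?thesis by (simp only: card_changes)
qed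

lemma unfairness_plan: "set us \<subseteq> {..<m + 2} \<Longrightarrow> unfairness (plan_of_necklace N) (star_walk us) =
    card (forward_set (m + 2) us) + card (backward_set (m + 2) us)"
  unfolding plan_of_necklace_def by (subst unfairness_star_walk) simp_all

lemma set_flatten_trips:
  "set (concat ts) = {1..<m + 2} \<Longrightarrow> set (flatten ts) \<subseteq> {..<m + 2}"
  by (auto simp: set_flatten)

text \<open>Without the dummy trip, the remaining \<open>k\<close> trips in the order of the route
  are the parts. Cuts are made only where the part changes, so each cut is a separated pair with its
  own complaint. The pair of dummy and first bead and the complaint at the depot account for the
  constant \<open>2\<close>.\<close>

lemma splitting_of_route:
  assumes "vehicle_route (plan_of_necklace N) w"
  shows "k_splitting N (splitting_of_route N w)"
    and "2 + splitting_size (splitting_of_route N w) \<le> unfairness (plan_of_necklace N) w"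
proof -
  obtain ts where ok: "trips_ok (leaf_specs N) L T ts" and w: "w = star_walk (flatten ts)"
    using assms unfolding route_iff by blast
  note str = trips_structure[OF ok]
  obtain ts1 ts2 where ts: "ts = ts1 @ [1] # ts2" using str(5) by (meson split_list)
  define vs where "vs = ts1 @ ts2"
  have d: "distinct (concat vs)" and n1: "1 \<notin> set (concat vs)" using str(1) unfolding ts vs_def by auto
  have set: "set (concat vs) = {2..<m + 2}"
  proof -
    have "insert 1 (set (concat vs)) = {1..<m + 2}" using str(2) unfolding ts vs_def by auto
    then have "set (concat vs) = {1..<m + 2} - {1}" using n1 by blast
    also have "\<dots> = {2..<m + 2}" by auto
    finally show ?thesis .
  qed
  have len: "length vs = k" using str(3) unfolding ts vs_def by simp
  let ?tab0 = "map (Pair (0 :: nat)) (beads N)"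
  have sub: "set (concat vs) \<subseteq> {2..<length ?tab0 + 2}" unfolding set by simp
  obtain tab where tab: "fold (\<lambda>j. read_arc (0, 2 ^ j)) (concat (map (\<lambda>t. t @ [0]) vs)) (0, False, ?tab0) =
      (0 + length vs, False, tab)" "map snd tab = map snd ?tab0"
    "\<forall>i<length vs. \<forall>j<length ?tab0. j + 2 \<in> set (vs ! i) \<longrightarrow> fst (tab ! j) = 0 + i"
    using read_trips[OF d sub, of 0] by blast
  have snd_tab: "map snd tab = beads N" using tab(2) by (simp add: comp_def)
  have len_tab: "length tab = m" using snd_tab by (metis length_map)
  have part: "fst (tab ! (j - 2)) = i" if "i < k" "j \<in> set (vs ! i)" for i j
  proof -
    have "vs ! i \<in> set vs" using that(1) len by simp
    then have "j \<in> set (concat vs)" using that(2) by auto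
    then have "j - 2 < length ?tab0" "j - 2 + 2 = j" unfolding set by auto
    then show ?thesis using tab(3)[rule_format, of i "j - 2"] that len by simp
  qed
  \<comment> \<open>The dummy trip may come anywhere: its flag suppresses the increase of the part
    number, so reading it leaves the state unchanged.\<close>
  have S: "splitting_of_route N w = runs_of tab"
  proof -
    have "fold (\<lambda>j. read_arc (0, 2 ^ j)) (concat (map (\<lambda>t. t @ [0]) ts)) st =
        fold (\<lambda>j. read_arc (0, 2 ^ j)) (concat (map (\<lambda>t. t @ [0]) vs)) st"
      if "fst (snd st) = False" and "set (concat ts1) \<subseteq> {2..<length (snd (snd st)) + 2}" for st
    proof -
      have "distinct (concat ts1)" using d unfolding vs_def by simp
      from read_trips[OF this that(2), of "fst st"] that(1) obtain p tab1 where
        1: "fold (\<lambda>j. read_arc (0, 2 ^ j)) (concat (map (\<lambda>t. t @ [0]) ts1)) st = (p, False, tab1)"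
        by (cases st) auto
      have "fold (\<lambda>j. read_arc (0, 2 ^ j)) [1, 0] (p, False, tab1) = (p, False, tab1)"
        using read_arc_dummy read_arc_depot by simp
      with 1 show ?thesis unfolding ts vs_def by simp
    qed
    moreover have "set (concat ts1) \<subseteq> {2..<length ?tab0 + 2}" using sub unfolding vs_def by simp
    ultimately have "fold (\<lambda>j. read_arc (0, 2 ^ j)) (concat (map (\<lambda>t. t @ [0]) ts)) (0, False, ?tab0) =
        (0 + length vs, False, tab)" unfolding tab(1)[symmetric] by simp
    then show ?thesis
      unfolding splitting_of_route_def w fold_read_star_walk tl_flatten by simp
  qed
  have trip_colour: "count_list (colours (vs ! p)) i = shares N ! i" if "p < k" "i < s" for p i
  proof -
    have t: "vs ! p \<in> set vs" using that(1) len by simp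
    have "set (vs ! p) \<subseteq> {2..<m + 2}" unfolding set[symmetric] using t by auto
    moreover have "distinct (vs ! p)" using d t by (simp only: distinct_concat_iff)
    moreover have "(\<Sum>j\<leftarrow>vs ! p. wt j) = W" using str(4) t unfolding ts vs_def by auto
    ultimately show ?thesis using trip_colours that(2) by blast
  qed
  have count: "count_list tab (p, i) = shares N ! i" if p: "p < k" and i: "i < s" for p i
  proof -
    let ?f = "\<lambda>j. tab ! (j - 2)"
    \<comment> \<open>Every bead leaf is visited once, so the table may be counted trip by trip
      instead of in the order of the necklace.\<close>
    have "mset (concat vs) = mset [2..<m + 2]"
      using d set by (intro set_eq_iff_mset_eq_distinct[THEN iffD1]) auto
    then have "mset (map ?f (concat vs)) = mset (map ?f [2..<m + 2])" by (simp only: mset_map)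
    also have "map ?f [2..<m + 2] = tab"
      by (rule nth_equalityI) (auto simp: len_tab simp del: upt_Suc)
    finally have "count_list tab (p, i) = count_list (map ?f (concat vs)) (p, i)"
      by (metis count_mset)
    also have "\<dots> = (\<Sum>t\<leftarrow>vs. count_list (map ?f t) (p, i))"
      by (induction vs) auto
    also have "\<dots> = (\<Sum>q<k. count_list (map ?f (vs ! q)) (p, i))"
      using len by (auto simp: sum_list_sum_nth atLeast0LessThan intro!: sum.cong)
    also have "\<dots> = (\<Sum>q<k. if q = p then shares N ! i else 0)"
    proof (rule sum.cong[OF refl])
      fix q assume "q \<in> {..<k}"
      then have q: "q < k" by simp
      have eq: "map ?f (vs ! q) = map (\<lambda>c. (q, c)) (colours (vs ! q))"
      proof -
        have "?f j = (q, beads N ! (j - 2))" if j: "j \<in> set (vs ! q)" for j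
        proof -
          have "vs ! q \<in> set vs" using q len by simp
          then have "j \<in> set (concat vs)" using j by auto
          then have "j - 2 < length tab" unfolding set len_tab by auto
          then have "snd (?f j) = beads N ! (j - 2)" unfolding snd_tab[symmetric] by simp
          then show ?thesis using part[OF q j] by (simp add: prod_eq_iff)
        qed
        then show ?thesis by simp
      qed
      have cnt: "count_list (map (\<lambda>c. (q, c)) cs) (p, i) = (if q = p then count_list cs i else 0)" for cs
        by (induction cs) auto
      show "count_list (map ?f (vs ! q)) (p, i) = (if q = p then shares N ! i else 0)"
        unfolding eq cnt using trip_colour[OF p i] by simp
    qed
    also have "\<dots> = shares N ! i" using p by simp
    finally show ?thesis .
  qed
  have fst_tab: "fst e < k" if "e \<in> set tab" for e
  proof -
    from that obtain j where j: "j < m" "e = tab ! j" unfolding in_set_conv_nth len_tab by blast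
    then have "j + 2 \<in> set (concat vs)" unfolding set by simp
    then obtain t where t: "t \<in> set vs" "j + 2 \<in> set t" unfolding set_concat by blast
    from t(1) obtain i where "i < k" "t = vs ! i" unfolding in_set_conv_nth len by blast
    then show ?thesis using part[of i "j + 2"] j t(2) by simp
  qed
  show "k_splitting N (splitting_of_route N w)"
    unfolding k_splitting_def S
  proof (intro conjI)
    show "concat (map snd (runs_of tab)) = beads N" by (simp add: concat_runs_of snd_tab)
    show "\<forall>(j, C)\<in>set (runs_of tab). j < k \<and> C \<noteq> []"
    proof
      fix r assume "r \<in> set (runs_of tab)"
      then have "fst r \<in> fst ` set tab" "snd r \<noteq> []" using runs_of_elem[of r tab] by auto
      then show "case r of (j, C) \<Rightarrow> j < k \<and> C \<noteq> []" using fst_tab by (cases r) auto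
    qed
    show "\<forall>j<k. \<forall>i<s. (\<Sum>(j', C)\<leftarrow>runs_of tab. if j' = j then count_list C i else 0) = shares N ! i"
      by (simp add: count_runs_of count)
  qed
  let ?ls = "map fst tab"
  let ?X = "insert 1 {j. 2 \<le> j \<and> Suc j < m + 2 \<and> ?ls ! (j - 2) \<noteq> ?ls ! (Suc j - 2)}"
  \<comment> \<open>Beads of one trip carry one label, so a change of label separates them; the trip
    of the dummy contains nothing else.\<close>
  have X: "\<not> (\<exists>t\<in>set ts. j \<in> set t \<and> Suc j \<in> set t)" if "j \<in> ?X" for j
  proof
    assume "\<exists>t\<in>set ts. j \<in> set t \<and> Suc j \<in> set t"
    then obtain t where t: "t \<in> set ts" "j \<in> set t" "Suc j \<in> set t" by blast
    show False
    proof (cases "t = [1]")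
      case True
      then show False using t that by auto
    next
      case False
      then have t': "t \<in> set vs" using t(1) unfolding ts vs_def by auto
      then have "set t \<subseteq> {2..<m + 2}" unfolding set[symmetric] by auto
      then have j2: "2 \<le> j" "Suc j < m + 2" using t(2,3) by auto
      from t' obtain i where i: "i < k" "t = vs ! i" unfolding in_set_conv_nth len by blast
      have "fst (tab ! (j - 2)) = i" "fst (tab ! (Suc j - 2)) = i"
        using part[OF i(1)] t(2,3) i(2) by blast+
      moreover have "j - 2 < m" "Suc j - 2 < m" using j2 by auto
      ultimately have "?ls ! (j - 2) = ?ls ! (Suc j - 2)" using len_tab by simp
      then show False using that j2 by auto
    qed
  qed
  have "tab \<noteq> []" using len_tab m_pos by auto
  then have "2 + splitting_size (runs_of tab) = card ?X + 1"
    using length_runs_of[of tab] card_separations[of ?ls] len_tab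
    unfolding splitting_size_def by simp
  also have "\<dots> \<le> card (forward_set (m + 2) (flatten ts)) + card (backward_set (m + 2) (flatten ts))"
  proof (rule unfairness_lower_bound[OF str(1,2,5)])
    show "3 \<le> m + 2" using m_pos by simp
    show "?X \<subseteq> {1..<m + 2 - 1}" using m_pos by auto
    show "\<forall>j\<in>?X. \<not> (\<exists>t\<in>set ts. j \<in> set t \<and> Suc j \<in> set t)" using X by blast
  qed
  also have "\<dots> = unfairness (plan_of_necklace N) w"
    unfolding w by (rule unfairness_plan[symmetric, OF set_flatten_trips[OF str(2)]])
  finally show "2 + splitting_size (splitting_of_route N w) \<le> unfairness (plan_of_necklace N) w"
    unfolding S .
qed

text \<open>The dummy goes first, then each part gets one trip through its beads in the order of the
  necklace. In this order, neighbouring beads of one part are visited directly after one another and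
  cause no complaint.\<close>

lemma route_of_splitting:
  assumes S: "k_splitting N S"
  shows "\<exists>w. vehicle_route (plan_of_necklace N) w \<and>
    unfairness (plan_of_necklace N) w \<le> 2 + splitting_size S"
proof -
  let ?ls = "bead_parts S"
  have beads: "concat (map snd S) = beads N"
    and part_lt: "\<forall>(j, C)\<in>set S. j < k"
    and share: "\<And>p i. p < k \<Longrightarrow> i < s \<Longrightarrow> (\<Sum>(p', C)\<leftarrow>S. if p' = p then count_list C i else 0) = shares N ! i"
    using S unfolding k_splitting_def by auto
  have len: "length ?ls = m" using length_bead_parts[of S] beads by simp
  have lsk: "?ls ! j < k" if "j < m" for j
  proof -
    have "set ?ls \<subseteq> {..<k}" using part_lt unfolding bead_parts_def by auto
    moreover have "?ls ! j \<in> set ?ls" using that len by simp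
    ultimately show ?thesis by blast
  qed
  define tp where "tp = (\<lambda>p. filter (\<lambda>j. ?ls ! (j - 2) = p) [2..<m + 2])"
  have set_tp: "set (tp p) = {j \<in> {2..<m + 2}. ?ls ! (j - 2) = p}" for p
    unfolding tp_def by (auto simp del: upt_Suc)
  let ?ts = "[1] # map tp [0..<k]"
  have dtp: "distinct (tp p)" for p unfolding tp_def by simp
  have set: "set (concat ?ts) = {1..<m + 2}"
  proof -
    have "j \<in> set (concat ?ts)" if "j \<in> {1..<m + 2}" for j
    proof (cases "j = 1")
      case False
      with that have "j \<in> set (tp (?ls ! (j - 2)))" "?ls ! (j - 2) < k" using lsk[of "j - 2"] by (auto simp: set_tp)
      then show ?thesis by auto
    qed simp
    moreover have "set (concat ?ts) \<subseteq> {1..<m + 2}" by (auto simp: set_tp)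
    ultimately show ?thesis by blast
  qed
  have count: "count_list (concat ?ts) j = 1" if j: "j \<in> {1..<m + 2}" for j
  proof (cases "j = 1")
    case True
    then show ?thesis by (auto simp: count_list_0_iff set_tp)
  next
    case False
    with j have j2: "2 \<le> j" "j < m + 2" by auto
    have "count_list (concat (map f ps)) j = (\<Sum>p\<leftarrow>ps. count_list (f p) j)" for f :: "nat \<Rightarrow> nat list" and ps
      by (induction ps) auto
    moreover have "count_list (tp p) j = (if ?ls ! (j - 2) = p then 1 else 0)" for p
    proof -
      have "count_list xs x = 1" if "distinct xs" "x \<in> set xs" for xs :: "nat list" and x
        using that by (induction xs) (auto simp: count_list_0_iff)
      from this[of "tp p" j] show ?thesis
        using j2 dtp by (auto simp: count_list_0_iff set_tp)
    qed
    ultimately have "count_list (concat ?ts) j = (\<Sum>p\<leftarrow>[0..<k]. if ?ls ! (j - 2) = p then 1 else 0)"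
      using False by simp
    also have "\<dots> = (\<Sum>p<k. if ?ls ! (j - 2) = p then 1 else 0)"
      by (simp add: interv_sum_list_conv_sum_set_nat atLeast0LessThan)
    also have "\<dots> = 1" using lsk[of "j - 2"] j2 by simp
    finally show ?thesis .
  qed
  have d: "distinct (concat ?ts)"
    by (rule distinct_if_count_1) (use count set in blast)
  have zip: "map (\<lambda>j. (?ls ! (j - 2), beads N ! (j - 2))) [2..<m + 2] = zip ?ls (beads N)"
    by (rule nth_equalityI) (auto simp: len simp del: upt_Suc)
  have w: "(\<Sum>j\<leftarrow>tp p. wt j) = W" if p: "p < k" for p
  proof -
    have "count_list (colours (tp p)) i = shares N ! i" if i: "i < s" for i
    proof -
      have "colours (tp p) = map snd (filter (\<lambda>x. fst x = p)
          (map (\<lambda>j. (?ls ! (j - 2), beads N ! (j - 2))) [2..<m + 2]))"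
        by (simp add: tp_def filter_map comp_def del: upt_Suc)
      then have "count_list (colours (tp p)) i = count_list (zip ?ls (beads N)) (p, i)"
        unfolding zip by (simp add: count_map_snd_filter)
      then show ?thesis
        using count_zip_bead_parts[of S p i] share[OF p i] beads by simp
    qed
    then have cnt: "\<And>i. i < s \<Longrightarrow> count_list (colours (tp p)) i = shares N ! i" .
    have "(\<Sum>j\<leftarrow>tp p. wt j) = (\<Sum>i<s. count_list (colours (tp p)) i * B ^ i)"
      by (rule sum_trip) (auto simp: set_tp)
    also have "\<dots> = (\<Sum>i<s. shares N ! i * B ^ i)"
      by (rule sum.cong[OF refl]) (simp only: lessThan_iff cnt)
    also have "\<dots> = W" by (rule W_eq[symmetric])
    finally show ?thesis .
  qed
  have wts: "(\<Sum>j\<leftarrow>t. wt j) = W" if "t \<in> set ?ts" for t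
    using that w specs(2) by auto
  have "trips_ok (leaf_specs N) L T ?ts"
    unfolding trips_ok_def
  proof (intro conjI ballI)
    fix t assume t: "t \<in> set ?ts"
    show "set t \<subseteq> {1..<length (leaf_specs N)}" unfolding length_specs set[symmetric] set_concat using t by blast
    show "2 * (wt 0 + (\<Sum>j\<leftarrow>t. wt j)) \<le> T" unfolding wts[OF t] specs(1) by simp
  next
    show "1 \<le> length ?ts" "length ?ts \<le> snd (leaf_specs N ! 0)" by (simp_all add: specs)
  next
    fix j assume "j \<in> {1..<length (leaf_specs N)}"
    then show "1 \<le> count_list (concat ?ts) j" "count_list (concat ?ts) j \<le> snd (leaf_specs N ! j)"
      using count[of j] specs_1[of j] by (simp_all only: length_specs atLeastLessThan_iff order_refl)
  next
    have "(\<Sum>t\<leftarrow>?ts. 2 * (wt 0 + (\<Sum>j\<leftarrow>t. wt j))) = (\<Sum>t\<leftarrow>?ts. T)"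
      by (rule arg_cong[where f = sum_list], rule map_cong[OF refl]) (simp only: wts specs(1), simp)
    also have "\<dots> = length ?ts * T" unfolding sum_list_triv of_nat_id ..
    also have "\<dots> = Suc k * T" by simp
    also have "\<dots> \<le> B * T"
    proof (rule mult_right_mono)
      show "Suc k \<le> B" using k_le_m m_less by linarith
    qed simp
    finally show "(\<Sum>t\<leftarrow>?ts. 2 * (wt 0 + (\<Sum>j\<leftarrow>t. wt j))) \<le> L" .
  qed
  then have "vehicle_route (plan_of_necklace N) (star_walk (flatten ?ts))"
    unfolding route_iff by blast
  moreover have "unfairness (plan_of_necklace N) (star_walk (flatten ?ts)) \<le> 2 + splitting_size S"
  proof -
    let ?X = "insert 1 {j. 2 \<le> j \<and> Suc j < m + 2 \<and> ?ls ! (j - 2) \<noteq> ?ls ! (Suc j - 2)}"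
    have "unfairness (plan_of_necklace N) (star_walk (flatten ?ts)) =
        card (forward_set (m + 2) (flatten ?ts)) + card (backward_set (m + 2) (flatten ?ts))"
      by (rule unfairness_plan[OF set_flatten_trips[OF set]])
    also have "\<dots> \<le> card ?X + 1"
    proof (rule unfairness_upper_bound[OF d set _ refl])
      show "3 \<le> m + 2" using m_pos by simp
      show "finite ?X" by simp
      fix j assume j: "1 \<le> j" "Suc j < m + 2" "j \<notin> ?X"
      let ?p = "?ls ! (j - 2)"
      have j2: "2 \<le> j" and eq: "?ls ! (Suc j - 2) = ?p" using j by auto
      have pk: "?p < k" using lsk[of "j - 2"] j by auto
      \<comment> \<open>Nothing lies between \<open>j\<close> and \<open>Suc j\<close>, so they
        remain adjacent when the index interval is filtered by their common label.\<close>
      have "[2..<m + 2] = [2..<j] @ [j..<m + 2]"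
        using upt_add_eq_append[OF j2, of "m + 2 - j"] j(2) by simp
      also have "[j..<m + 2] = j # Suc j # [Suc (Suc j)..<m + 2]"
        using upt_conv_Cons[of j "m + 2"] upt_conv_Cons[of "Suc j" "m + 2"] j(2) by simp
      finally have upt: "[2..<m + 2] = [2..<j] @ j # Suc j # [Suc (Suc j)..<m + 2]" .
      have "\<exists>u v. tp ?p = u @ j # Suc j # v"
        unfolding tp_def upt filter_append filter.simps eq by simp blast
      then obtain u v where t: "tp ?p = u @ j # Suc j # v" by blast
      obtain C D where "map tp [0..<k] = C @ tp ?p # D"
      proof -
        have "tp ?p \<in> set (map tp [0..<k])" using pk by simp
        then show thesis using that by (meson split_list)
      qed
      then have "flatten ?ts = (flatten ([1] # C) @ u) @ j # Suc j # v @ flatten D"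
        using flatten_append[of "[1] # C" "tp ?p" D] t by simp
      then show "\<exists>i. Suc i < length (flatten ?ts) \<and> flatten ?ts ! i = j \<and> flatten ?ts ! Suc i = Suc j"
        by (intro exI[of _ "length (flatten ([1] # C) @ u)"]) (simp only: nth_append_length nth_append_length_plus, simp add: nth_append)
    qed
    also have "\<dots> \<le> 2 + splitting_size S"
      using card_separations[OF len] changes_bead_parts[of S] unfolding splitting_size_def by simp
    finally show ?thesis .
  qed
  ultimately show ?thesis by blast
qed

lemma plan_wf: "routing_wf (plan_of_necklace N)"
  unfolding plan_of_necklace_def
proof (rule star_routing_wf)
  show "\<forall>x\<in>set (leaf_specs N). 0 < fst x \<and> 0 < snd x" using W_pos by (auto simp: leaf_specs_def)
qed (simp_all add: leaf_specs_def)

end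

section \<open>The reduction is computable in polynomial time\<close>

lemma size_code_nat_add_shift: "r < 2 ^ l \<Longrightarrow> size (code_nat (r + 2 ^ l * n)) \<le> size (code_nat n) + 2 * l"
proof (induction l arbitrary: r)
  case (Suc l)
  obtain b q where r: "r = of_bool b + 2 * q" by (rule nat_double_cases)
  with Suc.prems have "q < 2 ^ l" by (cases b) auto
  then have IH: "size (code_nat (q + 2 ^ l * n)) \<le> size (code_nat n) + 2 * l" by (rule Suc.IH)
  have eq: "r + 2 ^ Suc l * n = of_bool b + 2 * (q + 2 ^ l * n)" by (simp add: r)
  show ?case unfolding eq by (rule order_trans[OF size_code_nat_double]) (use IH in simp)
qed simp

text \<open>The inner loop pushes the bits of \<open>a\<close> with the least significant one first,
  so they come out in the order that Horner's rule expects. The list \<open>xs\<close> merely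
  supplies the number of bits.\<close>

lemma horner_low_bits:
  "fold (\<lambda>b n. of_bool b + 2 * n)
     (snd (fold (\<lambda>_ st. (fst st div 2, odd (fst st) # snd st)) xs (a, out))) n =
   fold (\<lambda>b n. of_bool b + 2 * n) out (a mod 2 ^ length xs + 2 ^ length xs * n)" for a n :: nat
proof (induction xs arbitrary: a out)
  case (Cons x xs)
  have "a mod 2 ^ length (x # xs) = of_bool (odd a) + 2 * (a div 2 mod 2 ^ length xs)"
    by (simp add: mod_mult2_eq mod_2_eq_odd)
  then have "of_bool (odd a) + 2 * (a div 2 mod 2 ^ length xs + 2 ^ length xs * n) =
      a mod 2 ^ length (x # xs) + 2 ^ length (x # xs) * n"
    by simp
  with Cons.IH[of "a div 2" "odd a # out"] show ?case by (simp only: fold_simps fst_conv snd_conv)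
qed simp

lemma size_code_nat_div2: "size (code_nat (n div 2)) \<le> size (code_nat n)"
  by (cases "n = 0") (auto simp: code_nat_split)

lemma ptime_add_shift:
  assumes xs: "ptime D c (\<lambda>x. code_list ce (xs x))" and a: "ptime D c (\<lambda>x. code_nat (a x))"
    and n: "ptime D c (\<lambda>x. code_nat (n x))"
  shows "ptime D c (\<lambda>x. code_nat (a x mod 2 ^ length (xs x) + 2 ^ length (xs x) * n x))"
proof -
  let ?g = "\<lambda>_ (st :: nat \<times> bool list). (fst st div 2, odd (fst st) # snd st)"
  let ?cb = "code_pair code_nat (code_list code_bool)"
  have "ptime D c (\<lambda>x. ?cb (fold ((\<lambda>_. ?g) x) (xs x) (a x, [])))"
  proof (rule ptime_fold_increment[where cb = ?cb and ce = ce and xs = xs and a = "\<lambda>x. (a x, [])" and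
      g = "\<lambda>_. ?g" and K = "\<lambda>_. 2", OF xs])
    show "size (?cb (?g e st)) \<le> size (?cb st) + 2" for e st
      using size_code_nat_div2[of "fst st"] size_code_bool[of "odd (fst st)"] by (simp add: code_pair_def)
  qed (intro poly_bounded_const ptime_Pair a ptime_Nil ptime_Cons ptime_div2 ptime_odd
      ptime_fst[where cb = "code_list code_bool"] ptime_snd[where ca = code_nat] ptime_step_acc)+
  from ptime_horner[OF ptime_snd[OF this] n] show ?thesis by (simp add: horner_low_bits)
qed

text \<open>The number of bits of the result is about \<open>length (xs x) * u x\<close>, which is
  polynomial because the exponent is given in unary.\<close>

lemma ptime_power_shift:
  assumes xs: "ptime D c (\<lambda>x. code_list ce (xs x))" and u: "ptime D c (\<lambda>x. code_unary (u x))"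
  shows "ptime D c (\<lambda>x. code_nat ((2 ^ length (xs x)) ^ u x))"
proof -
  let ?g = "\<lambda>x (_ :: unit) n. 2 ^ length (xs x) * n"
  have "ptime D c (\<lambda>x. code_nat (fold (?g x) (replicate (u x) ()) 1))"
  proof (rule ptime_fold_increment[where cb = code_nat and ce = "\<lambda>_. Leaf" and xs = "\<lambda>x. replicate (u x) ()" and
      a = "\<lambda>_. 1" and g = ?g and K = "\<lambda>x. 2 * size (code_list ce (xs x))"])
    show "ptime D c (\<lambda>x. code_list (\<lambda>_. Leaf) (replicate (u x) ()))"
      using u unfolding code_unary_def .
    show "poly_bounded D (\<lambda>x. size (c x)) (\<lambda>x. 2 * size (code_list ce (xs x)))"
      by (intro poly_bounded_mult poly_bounded_const ptime_poly_bounded xs)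
    show "size (code_nat (?g x e b)) \<le> size (code_nat b) + 2 * size (code_list ce (xs x))" for x e b
      using size_code_nat_shift[of "length (xs x)" b] length_le_size_code_list[of "xs x" ce] by linarith
    show "ptime {(x, e, b). x \<in> D \<and> e \<in> set (replicate (u x) ())} (step_code c (\<lambda>_. Leaf) code_nat)
        (\<lambda>y. code_nat (2 ^ length (xs (fst y)) * snd (snd y)))"
      by (rule ptime_shift[where ce = ce], rule ptime_step_input[OF xs], auto intro: ptime_step_acc)
  qed (rule ptime_const)
  moreover have "fold (\<lambda>_ n. B * n) (replicate u ()) n = B ^ u * n" for B u n :: nat
    by (induction u arbitrary: n) auto
  ultimately show ?thesis by simp
qed

section \<open>The code of the star\<close>

abbreviation enum_leaves :: "'e list \<Rightarrow> (nat \<times> 'e) list" where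
  "enum_leaves xs \<equiv> zip (map ((^) 2) [0..<length xs]) xs"

lemma enum_leaves_snoc: "enum_leaves (xs @ [x]) = enum_leaves xs @ [(2 ^ length xs, x)]"
  by simp

lemma size_enum_leaves:
  "size (code_list (code_pair code_nat ce) (enum_leaves xs)) \<le>
     length xs * (2 * length xs + 4) + size (code_list ce xs)"
proof (induction xs rule: rev_induct)
  case (snoc x xs)
  have "size (code_nat (2 ^ length xs)) \<le> 2 * Suc (length xs)" by (rule size_code_nat_less) simp
  with snoc show ?case
    unfolding enum_leaves_snoc by (simp add: size_code_list_append code_pair_def algebra_simps)
qed simp

text \<open>The name of the next leaf is carried along and doubled. Names are exponential numbers
  with codes of linear size, so the whole enumeration adds only quadratically many nodes.\<close>

lemma ptime_enum_leaves:
  assumes xs: "ptime D c (\<lambda>x. code_list ce (xs x))"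
  shows "ptime D c (\<lambda>x. code_list (code_pair code_nat ce) (enum_leaves (xs x)))"
proof -
  let ?g = "\<lambda>e (st :: nat \<times> (nat \<times> 'c) list). (of_bool False + 2 * fst st, (fst st, e) # snd st)"
  let ?cl = "code_list (code_pair code_nat ce)"
  let ?cb = "code_pair code_nat ?cl"
  have fold: "fold ?g ys (1, []) = (2 ^ length ys, rev (enum_leaves ys))" for ys
    by (induction ys rule: rev_induct) simp_all
  have size_rev: "size (code_list cc (rev ys)) = size (code_list cc ys)" for cc :: "'x \<Rightarrow> data" and ys
    by (simp add: size_code_list flip: rev_map)
  have "ptime D c (\<lambda>x. ?cb (fold ((\<lambda>_. ?g) x) (xs x) (1, [])))"
  proof (rule ptime_fold[where cb = ?cb and ce = ce and xs = xs and a = "\<lambda>_. (1, [])" and g = "\<lambda>_. ?g", OF xs])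
    let ?E = "{(x, ys). x \<in> D \<and> (\<exists>zs. xs x = ys @ zs)}"
    obtain Q where Q: "\<forall>x\<in>D. size (code_list ce (xs x)) \<le> poly Q (size (c x))"
      using ptime_poly_bounded[OF xs] unfolding poly_bounded_def by blast
    show "poly_bounded ?E (\<lambda>y. size (c (fst y))) (\<lambda>y. size (?cb (fold ?g (snd y) (1, []))))"
    proof (rule poly_boundedI)
      fix y assume "y \<in> ?E"
      then obtain x ys zs where y: "y = (x, ys)" "x \<in> D" "xs x = ys @ zs" by auto
      let ?q = "poly Q (size (c x))"
      have s: "size (code_list ce ys) \<le> ?q"
        using Q y(2) unfolding y(3)[symmetric] by (force simp: y(3) size_code_list_append)
      then have l: "length ys \<le> ?q" using length_le_size_code_list[of ys ce] by linarith
      have "size (code_nat (2 ^ length ys)) \<le> 2 * Suc (length ys)" by (rule size_code_nat_less) simp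
      moreover have "length ys * (2 * length ys + 4) \<le> ?q * (2 * ?q + 4)"
        using l by (intro mult_mono) auto
      ultimately have "size (?cb (2 ^ length ys, rev (enum_leaves ys))) \<le> 3 + 2 * ?q + ?q * (2 * ?q + 4) + ?q"
        using size_enum_leaves[of ce ys] s l by (simp add: code_pair_def size_rev)
      then show "size (?cb (fold ?g (snd y) (1, []))) \<le> poly (3 + 2 * Q + Q * (2 * Q + 4) + Q) (size (c (fst y)))"
        unfolding y(1) fst_conv snd_conv fold by (simp add: poly_add poly_mult)
    qed
  qed (intro ptime_const ptime_Pair ptime_Nil ptime_Cons ptime_double ptime_False ptime_step_elem
      ptime_fst[where cb = ?cl] ptime_snd[where ca = code_nat] ptime_step_acc)+
  then have "ptime D c (\<lambda>x. ?cb (2 ^ length (xs x), rev (enum_leaves (xs x))))"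
    unfolding fold .
  from ptime_rev[OF ptime_snd[OF this]] show ?thesis by simp
qed

lemma ptime_parts: "ptime D code_necklace (\<lambda>N. code_nat (parts N))"
  by (rule ptime_cong[OF ptime_hd[OF ptime_id]]) (simp add: code_necklace_def)

lemma ptime_shares: "ptime D code_necklace (\<lambda>N. code_list code_nat (shares N))"
  by (rule ptime_cong[OF ptime_hd[OF ptime_tl[OF ptime_id]]]) (simp add: code_necklace_def)

lemma ptime_beads: "ptime D code_necklace (\<lambda>N. code_list code_nat (beads N))"
  by (rule ptime_cong[OF ptime_hd[OF ptime_tl[OF ptime_tl[OF ptime_id]]]]) (simp add: code_necklace_def)

lemma size_code_necklace:
  "size (code_list code_nat (beads N)) \<le> size (code_necklace N)"
  "size (code_list code_nat (shares N)) \<le> size (code_necklace N)"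
  by (simp_all add: code_necklace_def)

lemma ptime_share_weight: "ptime D code_necklace (\<lambda>N. code_nat (share_weight N))"
proof -
  let ?g = "\<lambda>N a w. a mod 2 ^ length (beads N) + 2 ^ length (beads N) * w"
  have "ptime D code_necklace (\<lambda>N. code_nat (fold (?g N) (rev (shares N)) 0))"
  proof (rule ptime_fold_increment[where cb = code_nat and ce = code_nat and xs = "\<lambda>N. rev (shares N)" and
      a = "\<lambda>_. 0" and g = ?g and K = "\<lambda>N. 2 * size (code_list code_nat (beads N))"])
    show "ptime D code_necklace (\<lambda>N. code_list code_nat (rev (shares N)))"
      by (intro ptime_rev ptime_shares)
    show "ptime {(N, a, w). N \<in> D \<and> a \<in> set (rev (shares N))} (step_code code_necklace code_nat code_nat)
        (\<lambda>y. code_nat (?g (fst y) (fst (snd y)) (snd (snd y))))"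
      by (rule ptime_add_shift[where ce = code_nat], rule ptime_step_input[OF ptime_beads])
        (auto intro: ptime_step_elem ptime_step_acc)
    show "poly_bounded D (\<lambda>x. size (code_necklace x)) (\<lambda>N. 2 * size (code_list code_nat (beads N)))"
      by (intro poly_bounded_mult poly_bounded_const ptime_poly_bounded ptime_beads)
    show "size (code_nat (?g N a w)) \<le> size (code_nat w) + 2 * size (code_list code_nat (beads N))" for N a w
      using size_code_nat_add_shift[of "a mod 2 ^ length (beads N)" "length (beads N)" w]
        length_le_size_code_list[of "beads N" code_nat] by simp
  qed (rule ptime_const)
  moreover have "fold (?g N) (rev (shares N)) 0 = share_weight N" for N
    unfolding share_weight_def by (simp add: foldr_conv_fold)
  ultimately show ?thesis by simp
qed

lemma ptime_leaf_specs:
  "ptime {N. necklace_wf N} code_necklace (\<lambda>N. code_list (code_pair code_nat code_nat) (leaf_specs N))"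
  unfolding leaf_specs_def
proof (intro ptime_Cons ptime_Pair ptime_const ptime_Suc ptime_parts ptime_share_weight)
  let ?D = "{N. necklace_wf N}"
  let ?E = "{(N, c). N \<in> ?D \<and> c \<in> set (beads N)}"
  have "ptime ?E (code_pair code_necklace code_nat)
      (\<lambda>y. code_pair code_nat code_nat ((2 ^ length (beads (fst y))) ^ snd y, 1))"
  proof (intro ptime_Pair ptime_const ptime_power_shift[where ce = code_nat] ptime_unary)
    show "ptime ?E (code_pair code_necklace code_nat) (\<lambda>y. code_list code_nat (beads (fst y)))"
      by (rule ptime_pair_input[OF ptime_beads]) auto
    show "ptime ?E (code_pair code_necklace code_nat) (\<lambda>y. code_nat (snd y))"
      by (rule ptime_pair_elem)
    show "poly_bounded ?E (\<lambda>y. size (code_pair code_necklace code_nat y)) snd"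
    proof (rule poly_bounded_le[OF poly_bounded_self])
      fix y assume "y \<in> ?E"
      then obtain N c where y: "y = (N, c)" "necklace_wf N" "c \<in> set (beads N)" by auto
      \<comment> \<open>Colours are indices into the list of shares, which is part of the code, so a
        colour may be used as a unary exponent.\<close>
      then have "c < length (shares N)" by (auto simp: necklace_wf_def)
      then show "snd y \<le> size (code_pair code_necklace code_nat y)"
        using length_le_size_code_list[of "shares N" code_nat] size_code_necklace(2)[of N]
        by (simp add: y(1) code_pair_def)
    qed
  qed
  then show "ptime ?D code_necklace (\<lambda>N. code_list (code_pair code_nat code_nat)
      (map (\<lambda>c. ((2 ^ length (beads N)) ^ c, 1)) (beads N)))"
    by (intro ptime_map[where f = "\<lambda>N c. ((2 ^ length (beads N)) ^ c, 1)", OF ptime_beads])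
qed

text \<open>The entry of \<open>code_routing\<close> for an edge from the centre \<open>0\<close>;
  the argument is the leaf together with length and frequency.\<close>

definition code_star_edge :: "nat \<times> nat \<times> nat \<Rightarrow> data" where
  "code_star_edge e = code_data_list [code_nat 0, code_nat (fst e), code_bool False,
     code_nat (fst (snd e)), code_nat 1, code_nat (snd (snd e))]"

lemma sorted_leaves: "sorted_list_of_set (insert 0 ((^) 2 ` {..<n})) = 0 # map ((^) (2 :: nat)) [0..<n]"
proof -
  have "sorted (map ((^) (2 :: nat)) [0..<n])"
    unfolding sorted_map by (rule sorted_wrt_mono_rel[OF _ sorted_upt]) simp
  then have "sorted (0 # map ((^) (2 :: nat)) [0..<n])" by simp
  moreover have "distinct (0 # map ((^) (2 :: nat)) [0..<n])" by (auto simp: distinct_map inj_on_def)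
  moreover have "set (0 # map ((^) (2 :: nat)) [0..<n]) = insert 0 ((^) 2 ` {..<n})"
    by (simp add: atLeast0LessThan)
  ultimately show ?thesis by (metis sorted_list_of_set.idem_if_sorted_distinct)
qed

text \<open>The centre \<open>0\<close> is the smaller end of every edge, so only the row
  \<open>u = 0\<close> of the comprehension contributes.\<close>

lemma star_edge_list:
  "[(u, v). u \<leftarrow> 0 # map ((^) 2) [0..<n], v \<leftarrow> 0 # map ((^) 2) [0..<n],
     u < v \<and> {u, v} \<in> (\<lambda>j. {0, 2 ^ j :: nat}) ` {..<n}] = map (\<lambda>j. (0, 2 ^ j)) [0..<n]"
proof -
  define ps where "ps = map ((^) (2 :: nat)) [0..<n]"
  define r where "r = (\<lambda>u. concat (map (\<lambda>v. if u < v \<and> {u, v} \<in> (\<lambda>j. {0, 2 ^ j :: nat}) ` {..<n}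
      then [(u, v)] else []) (0 # ps)))"
  have "r u = []" if "u \<in> set ps" for u
  proof -
    have "u > 0" using that unfolding ps_def by auto
    then have "\<not> (u < v \<and> {u, v} \<in> (\<lambda>j. {0, 2 ^ j :: nat}) ` {..<n})" for v
      unfolding star_edge_iff_arc by auto
    then show ?thesis unfolding r_def by (simp only: if_False) simp
  qed
  moreover have "concat (map h xs) = []" if "\<And>u. u \<in> set xs \<Longrightarrow> h u = []"
    for h :: "nat \<Rightarrow> (nat \<times> nat) list" and xs
    using that by (induction xs) auto
  ultimately have 1: "concat (map r ps) = []" by blast
  have "concat (map (\<lambda>v. if 0 < v \<and> {0, v} \<in> (\<lambda>j. {0, 2 ^ j :: nat}) ` {..<n} then [(0, v)] else [])
      (map ((^) 2) js)) = map (\<lambda>j. (0, 2 ^ j)) js" if "set js \<subseteq> {..<n}" for js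
    using that by (induction js) (simp_all del: image_iff)
  from this[of "[0..<n]"] have 2: "r 0 = map (\<lambda>j. (0, 2 ^ j)) [0..<n]"
    unfolding r_def ps_def by (simp add: atLeast0LessThan)
  have "concat (map r (0 # ps)) = map (\<lambda>j. (0, 2 ^ j)) [0..<n]" by (simp add: 1 2)
  then show ?thesis unfolding r_def ps_def .
qed

text \<open>Gaps are listed for the indices from \<open>1\<close> up to, but excluding, twice the
  maximal frequency \<open>Suc f\<close>, which makes \<open>Suc (f + f)\<close> entries.\<close>

lemma code_star_routing:
  assumes F: "Max (snd ` set sp) = Suc f" and sp: "sp \<noteq> []"
  shows "code_routing (star_routing sp L C) = code_data_list
    [code_list code_nat (0 # map fst (enum_leaves sp)), code_list code_star_edge (enum_leaves sp),
     code_nat 1, code_nat 1, code_nat L, code_rat C,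
     code_list (code_list (\<lambda>_. code_rat 1)) [replicate (Suc (f + f)) ()],
     code_list (code_list code_nat) (map fst (enum_leaves sp) # map (\<lambda>_. [0]) sp)]"
proof -
  let ?n = "length sp" and ?I = "star_routing sp L C"
  have fst: "map fst (enum_leaves sp) = map ((^) 2) [0..<?n]" by simp
  have "freq ?I ` edges ?I = snd ` set sp"
  proof -
    have "freq ?I ` edges ?I = (\<lambda>j. snd (sp ! j)) ` {..<?n}" by (simp add: image_image)
    also have "\<dots> = snd ` (!) sp ` {..<?n}" by (simp add: image_image)
    also have "(!) sp ` {..<?n} = set sp" unfolding set_conv_nth by blast
    finally show ?thesis .
  qed
  then have gap: "code_list (\<lambda>q. code_list (\<lambda>i. code_rat (gap ?I q i)) [1..<2 * Max (freq ?I ` edges ?I)])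
      [1..<Suc (levels ?I)] = code_list (code_list (\<lambda>_. code_rat 1)) [replicate (Suc (f + f)) ()]"
    by (simp add: F code_list_def map_replicate_const mult_2 del: upt_Suc)
  have edges: "code_list (\<lambda>(u, v). code_data_list
           [code_nat u, code_nat v, code_bool ({u, v} \<in> prio_edges ?I), code_nat (len ?I {u, v}),
            code_nat (prio ?I {u, v}), code_nat (freq ?I {u, v})]) (map (\<lambda>j. (0, 2 ^ j)) [0..<?n]) =
      code_list code_star_edge (enum_leaves sp)"
    unfolding code_list_def map_map
    by (rule arg_cong[where f = code_data_list], rule nth_equalityI) (simp_all add: code_star_edge_def)
  have order: "code_list (\<lambda>v. code_list code_nat (nbr_order ?I v)) (0 # map ((^) 2) [0..<?n]) =
      code_list (code_list code_nat) (map fst (enum_leaves sp) # map (\<lambda>_. [0]) sp)"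
    unfolding fst code_list_simps(2)
    by (simp add: code_list_def map_replicate_const comp_def)
  have vs: "sorted_list_of_set (vertices ?I) = 0 # map ((^) 2) [0..<?n]"
    by (simp add: sorted_leaves)
  have es: "[(u, v). u \<leftarrow> 0 # map ((^) 2) [0..<?n], v \<leftarrow> 0 # map ((^) 2) [0..<?n], u < v \<and> {u, v} \<in> edges ?I]
      = map (\<lambda>j. (0, 2 ^ j)) [0..<?n]"
    unfolding star_routing_simps by (rule star_edge_list)
  show ?thesis
    unfolding code_routing_def Let_def vs es gap edges order fst
    by simp
qed

lemma code_rat_inverse: "0 < n \<Longrightarrow> code_rat (1 / of_nat n) = code_pair code_nat code_nat (1, n)"
proof -
  assume "0 < n"
  then have "quotient_of (1 / rat_of_nat n) = (1, int n)"
    using quotient_of_Fract[of 1 "int n"] by (simp add: Fract_of_int_quotient normalize_def)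
  then show ?thesis by (simp add: code_rat_def code_pair_def)
qed

lemma ptime_plan_of_necklace:
  "ptime {N. necklace_wf N} code_necklace (\<lambda>N. code_routing (plan_of_necklace N))"
proof -
  let ?D = "{N. necklace_wf N}"
  let ?cp = "code_pair code_nat code_nat"
  \<comment> \<open>The right-hand side is phrased with operations that have been programmed:
    doubling in the form \<open>of_bool False + 2 * n\<close>, powers of two as shifts of
    \<open>1\<close>.\<close>
  have eq: "code_routing (plan_of_necklace N) = code_data_list
    [code_list code_nat (0 # map fst (enum_leaves (leaf_specs N))),
     code_list code_star_edge (map (\<lambda>e. e) (enum_leaves (leaf_specs N))),
     code_nat 1, code_nat 1, code_nat (2 ^ length (beads N) * (of_bool False + 2 * Suc (share_weight N))),
     code_pair code_nat code_nat (1, 2 ^ length (beads N) * 1),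
     code_list (code_list (\<lambda>_. code_rat 1)) [replicate (Suc (parts N + parts N)) ()],
     code_list (code_list code_nat) (map fst (enum_leaves (leaf_specs N)) # map (\<lambda>_. [0]) (leaf_specs N))]" for N
  proof -
    \<comment> \<open>The maximal frequency is attained at the depot edge.\<close>
    have "snd ` set (leaf_specs N) \<subseteq> {1, Suc (parts N)}" "Suc (parts N) \<in> snd ` set (leaf_specs N)"
      by (auto simp: leaf_specs_def)
    then have "Max (snd ` set (leaf_specs N)) = Suc (parts N)"
      by (intro Max_eqI) auto
    then show ?thesis
      unfolding plan_of_necklace_def
      by (subst code_star_routing) (simp_all add: leaf_specs_def code_rat_inverse[of "2 ^ length (beads N)", simplified])
  qed
  have sp: "ptime ?D code_necklace (\<lambda>N. code_list (code_pair code_nat ?cp) (enum_leaves (leaf_specs N)))"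
    by (rule ptime_enum_leaves[OF ptime_leaf_specs])
  have leaves: "ptime ?D code_necklace (\<lambda>N. code_list code_nat (map fst (enum_leaves (leaf_specs N))))"
    by (rule ptime_map[where f = "\<lambda>_. fst", OF sp]) (rule ptime_fst[OF ptime_pair_elem])
  have edges: "ptime ?D code_necklace (\<lambda>N. code_list code_star_edge (map (\<lambda>e. e) (enum_leaves (leaf_specs N))))"
  proof (rule ptime_map[where f = "\<lambda>_ e. e", OF sp])
    let ?E = "{(N, e). N \<in> ?D \<and> e \<in> set (enum_leaves (leaf_specs N))}"
    have e: "ptime ?E (code_pair code_necklace (code_pair code_nat ?cp)) (\<lambda>y. code_pair code_nat ?cp (snd y))"
      by (rule ptime_pair_elem)
    show "ptime ?E (code_pair code_necklace (code_pair code_nat ?cp)) (\<lambda>y. code_star_edge (snd y))"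
      unfolding code_star_edge_def code_data_list.simps
      by (intro ptime_Node ptime_const ptime_fst[OF e] ptime_fst[OF ptime_snd[OF e]] ptime_snd[OF ptime_snd[OF e]])
  qed
  have parts: "ptime ?D code_necklace (\<lambda>N. code_unary (parts N))"
  proof (rule ptime_unary[OF ptime_parts])
    show "poly_bounded ?D (\<lambda>N. size (code_necklace N)) parts"
    proof (rule poly_bounded_le[OF poly_bounded_self])
      fix N assume "N \<in> ?D"
      then interpret necklace_instance N by unfold_locales simp
      show "parts N \<le> size (code_necklace N)"
        using k_le_m length_le_size_code_list[of "beads N" code_nat] size_code_necklace(1)[of N] by linarith
    qed
  qed
  have orders: "ptime ?D code_necklace (\<lambda>N. code_list (code_list code_nat) (map (\<lambda>_. [0]) (leaf_specs N)))"
    by (rule ptime_map[where f = "\<lambda>_ _. [0]", OF ptime_leaf_specs]) (rule ptime_const)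
  show ?thesis
    unfolding eq code_data_list.simps
    by (intro ptime_Node ptime_Pair ptime_const ptime_Cons leaves edges orders ptime_Nil
        ptime_shift[where ce = code_nat] ptime_beads ptime_double ptime_False ptime_Suc ptime_share_weight
        ptime_replicate ptime_unary_Suc ptime_unary_add parts)
qed

section \<open>Decoding a route in polynomial time\<close>

lemma mark_table:
  "map snd (mark v p tab) = map snd tab" "fst ` set (mark v p tab) \<subseteq> insert p (fst ` set tab)"
proof -
  let ?g = "\<lambda>e (st :: nat \<times> (nat \<times> nat) list). (fst st div 2, (if odd (fst st) then (p, snd e) else e) # snd st)"
  have "map snd (rev (snd (fold ?g tab (v, out)))) = map snd (rev out) @ map snd tab" for out
    by (induction tab arbitrary: v out) auto
  then show "map snd (mark v p tab) = map snd tab" unfolding mark_def by simp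
  have "fst ` set (snd (fold ?g tab (v, out))) \<subseteq> insert p (fst ` set out \<union> fst ` set tab)" for out
  proof (induction tab arbitrary: v out)
    case (Cons e tab)
    show ?case unfolding fold_simps fst_conv snd_conv by (rule order_trans[OF Cons.IH]) auto
  qed auto
  from this[of "[]"] show "fst ` set (mark v p tab) \<subseteq> insert p (fst ` set tab)"
    unfolding mark_def by simp
qed

lemma ptime_mark:
  assumes v: "ptime D c (\<lambda>x. code_nat (v x))" and p: "ptime D c (\<lambda>x. code_nat (p x))"
    and tab: "ptime D c (\<lambda>x. code_list (code_pair code_nat code_nat) (tab x))"
  shows "ptime D c (\<lambda>x. code_list (code_pair code_nat code_nat) (mark (v x) (p x) (tab x)))"
proof -
  let ?cp = "code_pair code_nat code_nat"
  let ?cb = "code_pair code_nat (code_list ?cp)"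
  let ?g = "\<lambda>x e (st :: nat \<times> (nat \<times> nat) list).
     (fst st div 2, (if odd (fst st) then (p x, snd e) else e) # snd st)"
  have "ptime D c (\<lambda>x. ?cb (fold (?g x) (tab x) (v x, [])))"
  proof (rule ptime_fold_increment[where cb = ?cb and ce = ?cp and xs = tab and a = "\<lambda>x. (v x, [])" and
      g = ?g and K = "\<lambda>x. 2 + size (code_nat (p x)) + size (code_list ?cp (tab x))", OF tab])
    show "ptime D c (\<lambda>x. ?cb (v x, []))" by (intro ptime_Pair v ptime_Nil)
    show "poly_bounded D (\<lambda>x. size (c x)) (\<lambda>x. 2 + size (code_nat (p x)) + size (code_list ?cp (tab x)))"
      by (intro poly_bounded_add poly_bounded_const ptime_poly_bounded p tab)
    show "size (?cb (?g x e st)) \<le> size (?cb st) + (2 + size (code_nat (p x)) + size (code_list ?cp (tab x)))"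
      if "e \<in> set (tab x)" for x e st
      using size_elem_le_code_list[OF that, of ?cp] size_code_nat_div2[of "fst st"]
      by (simp add: code_pair_def)
    let ?E = "{(x, e, b). x \<in> D \<and> e \<in> set (tab x)}"
    have acc: "ptime ?E (step_code c ?cp ?cb) (\<lambda>y. ?cb (snd (snd y)))" by (rule ptime_step_acc)
    have el: "ptime ?E (step_code c ?cp ?cb) (\<lambda>y. ?cp (fst (snd y)))" by (rule ptime_step_elem)
    have "ptime ?E (step_code c ?cp ?cb) (\<lambda>y. code_nat (p (fst y)))" by (rule ptime_step_input[OF p]) auto
    then show "ptime ?E (step_code c ?cp ?cb) (\<lambda>y. ?cb (?g (fst y) (fst (snd y)) (snd (snd y))))"
      by (intro ptime_Pair ptime_Cons ptime_div2 ptime_If[where cb = ?cp] ptime_odd ptime_fst[OF acc]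
          ptime_snd[OF acc] ptime_snd[OF el] el)
  qed
  from ptime_rev[OF ptime_snd[OF this]] show ?thesis unfolding mark_def by simp
qed

text \<open>Valid for every list of arcs, route or not: the counter rises by at most one per arc, so
  new labels are at most the length of the list, and the table keeps its colours.\<close>

lemma read_arcs_bound:
  "\<exists>p f tab'. fold read_arc w (0, False, tab) = (p, f, tab') \<and> p \<le> length w \<and> map snd tab' = map snd tab \<and>
     fst ` set tab' \<subseteq> fst ` set tab \<union> {..length w}"
proof (induction w rule: rev_induct)
  case (snoc a w)
  then obtain p f tab' where IH: "fold read_arc w (0, False, tab) = (p, f, tab')" "p \<le> length w"
    "map snd tab' = map snd tab" "fst ` set tab' \<subseteq> fst ` set tab \<union> {..length w}" by blast
  let ?p = "if odd (snd a) \<and> \<not> f then Suc p else p"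
  let ?f = "if odd (snd a) then False else if odd (snd a div 2) then True else f"
  let ?t = "mark (snd a div 2 div 2) p tab'"
  have "fold read_arc (w @ [a]) (0, False, tab) = read_arc a (p, f, tab')" using IH(1) by simp
  also have "\<dots> = (?p, ?f, ?t)" by (simp only: read_arc_def fst_conv snd_conv)
  finally have "fold read_arc (w @ [a]) (0, False, tab) = (?p, ?f, ?t)" .
  moreover have "?p \<le> length (w @ [a])" using IH(2) by simp
  moreover have "map snd ?t = map snd tab" using IH(3) by (simp only: mark_table(1))
  moreover have "fst ` set ?t \<subseteq> fst ` set tab \<union> {..length (w @ [a])}"
    by (rule order_trans[OF mark_table(2)]) (use IH(2,4) in auto)
  ultimately show ?case by (intro exI conjI)
qed auto

lemma size_table_le:
  assumes "\<forall>e\<in>set tab. fst e \<le> b"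
  shows "size (code_list (code_pair code_nat code_nat) tab) \<le>
    length tab * (1 + 2 * b) + size (code_list code_nat (map snd tab))"
  using assms
proof (induction tab)
  case (Cons e tab)
  have "size (code_nat (fst e)) \<le> 2 * b" using size_code_nat_le[of "fst e"] Cons.prems by simp
  with Cons show ?case by (simp add: code_pair_def)
qed simp

lemma ptime_not_Nil: "ptime D c (\<lambda>x. code_list ce (xs x)) \<Longrightarrow> ptime D c (\<lambda>x. code_bool (xs x \<noteq> []))"
proof -
  have "code_list ce ys \<noteq> Leaf \<longleftrightarrow> ys \<noteq> []" for ys by (cases ys) auto
  then show "ptime D c (\<lambda>x. code_list ce (xs x)) \<Longrightarrow> ptime D c (\<lambda>x. code_bool (xs x \<noteq> []))"
    using ptime_not_Leaf[of D c "\<lambda>x. code_list ce (xs x)"] by simp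
qed

lemma ptime_list_tl: "ptime D c (\<lambda>x. code_list ce (xs x)) \<Longrightarrow> ptime D c (\<lambda>x. code_list ce (tl (xs x)))"
proof -
  have "tl_data (code_list ce ys) = code_list ce (tl ys)" for ys by (cases ys) auto
  then show "ptime D c (\<lambda>x. code_list ce (xs x)) \<Longrightarrow> ptime D c (\<lambda>x. code_list ce (tl (xs x)))"
    using ptime_tl[of D c "\<lambda>x. code_list ce (xs x)"] by simp
qed

lemma ptime_list_hd:
  assumes "ptime D c (\<lambda>x. code_list ce (xs x))" and "\<And>x. x \<in> D \<Longrightarrow> xs x \<noteq> []"
  shows "ptime D c (\<lambda>x. ce (hd (xs x)))"
proof (rule ptime_cong[OF ptime_hd[OF assms(1)]])
  show "ce (hd (xs x)) = hd_data (code_list ce (xs x))" if "x \<in> D" for x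
    using assms(2)[OF that] by (cases "xs x") auto
qed

abbreviation code_run :: "nat \<times> nat list \<Rightarrow> data" where
  "code_run \<equiv> code_pair code_nat (code_list code_nat)"

lemma ptime_add_run:
  assumes e: "ptime D c (\<lambda>x. code_pair code_nat code_nat (e x))" and S: "ptime D c (\<lambda>x. code_list code_run (S x))"
  shows "ptime D c (\<lambda>x. code_list code_run (add_run (e x) (S x)))"
proof -
  let ?D = "{x \<in> D. S x \<noteq> []}"
  let ?new = "\<lambda>x. code_list code_run ((fst (e x), [snd (e x)]) # S x)"
  have new: "ptime D c ?new"
    by (intro ptime_Cons ptime_Pair ptime_Nil S ptime_fst[OF e] ptime_snd[OF e])
  have e': "ptime ?D c (\<lambda>x. code_pair code_nat code_nat (e x))" by (rule ptime_subset[OF e]) auto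
  have S': "ptime ?D c (\<lambda>x. code_list code_run (S x))" by (rule ptime_subset[OF S]) auto
  have h: "ptime ?D c (\<lambda>x. code_run (hd (S x)))" by (rule ptime_list_hd[OF S']) auto
  \<comment> \<open>The head of \<open>S x\<close> is inspected only where \<open>S x\<close> is
    nonempty; the outer conditional restricts the domain accordingly.\<close>
  have "ptime ?D c (\<lambda>x. code_list code_run (if fst (e x) = fst (hd (S x))
      then (fst (e x), snd (e x) # snd (hd (S x))) # tl (S x) else (fst (e x), [snd (e x)]) # S x))"
    by (intro ptime_If[where cb = "code_list code_run"] ptime_nat_eq ptime_Cons ptime_Pair ptime_Nil ptime_list_tl
        S' ptime_fst[OF e'] ptime_snd[OF e'] ptime_fst[OF h] ptime_snd[OF h])
  from ptime_if[OF ptime_not_Nil[OF S] this ptime_subset[OF new]]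
  show ?thesis by (rule ptime_cong) (auto simp: add_run_def)
qed

lemma size_add_run:
  "size (code_list code_run (add_run e S)) \<le> size (code_list code_run S) + (3 + size (code_pair code_nat code_nat e))"
  by (cases S) (auto simp: add_run_def code_pair_def)

lemma ptime_def_of:
  assumes es: "ptime D c (\<lambda>x. code_list (code_pair code_nat code_nat) (es x))"
  shows "ptime D c (\<lambda>x. code_list code_run (runs_of (es x)))"
proof -
  let ?cp = "code_pair code_nat code_nat"
  have "ptime D c (\<lambda>x. code_list code_run (fold ((\<lambda>_. add_run) x) (rev (es x)) []))"
  proof (rule ptime_fold_increment[where cb = "code_list code_run" and ce = ?cp and xs = "\<lambda>x. rev (es x)" and
      a = "\<lambda>_. []" and g = "\<lambda>_. add_run" and K = "\<lambda>x. 3 + size (code_list ?cp (es x))"])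
    show "ptime D c (\<lambda>x. code_list ?cp (rev (es x)))" by (rule ptime_rev[OF es])
    show "poly_bounded D (\<lambda>x. size (c x)) (\<lambda>x. 3 + size (code_list ?cp (es x)))"
      by (intro poly_bounded_add poly_bounded_const ptime_poly_bounded es)
    show "size (code_list code_run (add_run e S)) \<le> size (code_list code_run S) + (3 + size (code_list ?cp (es x)))"
      if "e \<in> set (rev (es x))" for x e S
    proof -
      have "size (?cp e) \<le> size (code_list ?cp (es x))" using that by (intro size_elem_le_code_list) simp
      then show ?thesis using size_add_run[of e S] by linarith
    qed
  qed (intro ptime_Nil ptime_add_run ptime_step_elem ptime_step_acc)+
  then show ?thesis by (simp add: runs_of_def foldr_conv_fold)
qed

lemma ptime_splitting_of_route:
  "ptime D (code_pair code_necklace (code_list (code_pair code_nat code_nat)))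
     (\<lambda>y. code_list code_run (splitting_of_route (fst y) (snd y)))"
proof -
  let ?cp = "code_pair code_nat code_nat"
  let ?c = "code_pair code_necklace (code_list ?cp)"
  let ?cf = "code_pair code_bool (code_list ?cp)"
  let ?cb = "code_pair code_nat ?cf"
  have beads: "ptime D ?c (\<lambda>y. code_list code_nat (beads (fst y)))"
    by (rule ptime_pair_input[OF ptime_beads[of UNIV]]) simp
  have w: "ptime D ?c (\<lambda>y. code_list ?cp (snd y))" by (rule ptime_pair_elem)
  have tab: "ptime D ?c (\<lambda>y. code_list ?cp (map (Pair 0) (beads (fst y))))"
    by (rule ptime_map[where f = "\<lambda>_. Pair 0", OF beads]) (intro ptime_Pair ptime_const ptime_pair_elem)
  \<comment> \<open>A step may write the current part number into several entries, so growth is not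
    bounded for arbitrary states. The general \<open>ptime_fold\<close> is used, with the bound on
    reachable states from \<open>read_arcs_bound\<close>.\<close>
  have "ptime D ?c (\<lambda>y. ?cb (fold ((\<lambda>_. read_arc) y) (snd y) (0, False, map (Pair 0) (beads (fst y)))))"
  proof (rule ptime_fold[where cb = ?cb and ce = ?cp and xs = snd and g = "\<lambda>_. read_arc" and
      a = "\<lambda>y. (0, False, map (Pair 0) (beads (fst y)))", OF w])
    show "ptime D ?c (\<lambda>y. ?cb (0, False, map (Pair 0) (beads (fst y))))"
      by (intro ptime_Pair ptime_const tab ptime_False)
    define E where "E = {(x, e, b). x \<in> D \<and> (\<exists>ys zs. snd x = ys @ e # zs \<and>
        b = fold read_arc ys (0, False, map (Pair 0) (beads (fst x))))}"
    have acc: "ptime E (step_code ?c ?cp ?cb) (\<lambda>y. ?cb (snd (snd y)))" by (rule ptime_step_acc)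
    have el: "ptime E (step_code ?c ?cp ?cb) (\<lambda>y. ?cp (fst (snd y)))" by (rule ptime_step_elem)
    have not: "ptime E (step_code ?c ?cp ?cb) (\<lambda>y. code_bool (\<not> fst (snd (snd (snd y)))))"
      using ptime_iff[OF ptime_fst[OF ptime_snd[OF acc]] ptime_False] by simp
    have "ptime E (step_code ?c ?cp ?cb) (\<lambda>y. ?cb (read_arc (fst (snd y)) (snd (snd y))))"
      unfolding read_arc_def
      by (intro ptime_Pair ptime_If[where cb = code_nat] ptime_If[where cb = code_bool] ptime_conj ptime_odd
          ptime_Suc ptime_mark ptime_div2 ptime_True ptime_False not el
          ptime_fst[OF acc] ptime_snd[OF el] ptime_fst[OF ptime_snd[OF acc]] ptime_snd[OF ptime_snd[OF acc]])
    then show "ptime {(x, e, b). x \<in> D \<and> (\<exists>ys zs. snd x = ys @ e # zs \<and>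
        b = fold read_arc ys (0, False, map (Pair 0) (beads (fst x))))} (step_code ?c ?cp ?cb)
        (\<lambda>y. ?cb (read_arc (fst (snd y)) (snd (snd y))))"
      unfolding E_def .
    let ?F = "{(x, ys). x \<in> D \<and> (\<exists>zs. snd x = ys @ zs)}"
    show "poly_bounded ?F (\<lambda>y. size (?c (fst y)))
        (\<lambda>y. size (?cb (fold read_arc (snd y) (0, False, map (Pair 0) (beads (fst (fst y)))))))"
    proof (rule poly_boundedI)
      fix y assume "y \<in> ?F"
      then obtain N ws ys zs where y: "y = ((N, ws), ys)" "ws = ys @ zs" by auto
      let ?s = "size (?c (N, ws))"
      have l: "length ys \<le> ?s"
        using length_le_size_code_list[of ws ?cp] y(2) by (simp add: code_pair_def)
      have b: "size (code_list code_nat (beads N)) \<le> ?s"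
        using size_code_necklace(1)[of N] by (simp add: code_pair_def)
      obtain p f tab where st: "fold read_arc ys (0, False, map (Pair 0) (beads N)) = (p, f, tab)"
        "p \<le> length ys" "map snd tab = map snd (map (Pair (0 :: nat)) (beads N))"
        "fst ` set tab \<subseteq> fst ` set (map (Pair 0) (beads N)) \<union> {..length ys}"
        using read_arcs_bound[of ys "map (Pair 0) (beads N)"] by blast
      have snd_tab: "map snd tab = beads N" using st(3) by (simp add: comp_def)
      then have "length tab = length (beads N)" by (metis length_map)
      then have lt: "length tab \<le> ?s" using b length_le_size_code_list[of "beads N" code_nat] by linarith
      have "\<forall>e\<in>set tab. fst e \<le> ?s"
      proof
        fix e assume "e \<in> set tab"
        then have "fst e = 0 \<or> fst e \<le> length ys" using st(4) by auto
        then show "fst e \<le> ?s" using l by auto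
      qed
      then have "size (code_list ?cp tab) \<le> length tab * (1 + 2 * ?s) + size (code_list code_nat (beads N))"
        using size_table_le[of tab ?s] snd_tab by simp
      moreover have "length tab * (1 + 2 * ?s) \<le> ?s * (1 + 2 * ?s)" using lt by (rule mult_right_mono) simp
      moreover have "size (code_nat p) \<le> 2 * ?s" using size_code_nat_le[of p] st(2) l by linarith
      ultimately have "size (?cb (p, f, tab)) \<le> 3 + 2 * ?s + ?s * (1 + 2 * ?s) + ?s"
        using b size_code_bool[of f] by (simp add: code_pair_def)
      also have "\<dots> = poly (3 + 2 * [:0, 1:] + [:0, 1:] * (1 + 2 * [:0, 1:]) + [:0, 1:]) ?s"
        by (simp add: algebra_simps)
      finally show "size (?cb (fold read_arc (snd y) (0, False, map (Pair 0) (beads (fst (fst y))))))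
          \<le> poly (3 + 2 * [:0, 1:] + [:0, 1:] * (1 + 2 * [:0, 1:]) + [:0, 1:]) (size (?c (fst y)))"
        unfolding y(1) fst_conv snd_conv st(1) .
    qed
  qed
  from ptime_def_of[OF ptime_snd[OF ptime_snd[OF this]]]
  show ?thesis unfolding splitting_of_route_def .
qed

text \<open>Two inequalities give optimality: the number of cuts read off a route \<open>w\<close>
  is at most the unfairness of \<open>w\<close> minus \<open>2\<close>, and every splitting
  \<open>S\<close> has a route of unfairness at most \<open>2 + splitting_size S\<close>, which an
  optimal \<open>w\<close> cannot exceed.\<close>

lemma reducible_to_class:
  assumes C: "\<And>N. necklace_wf N \<Longrightarrow> C (plan_of_necklace N)"
  shows "polytime_reducible necklace_splitting (unfairness_minimisation C)"
  unfolding polytime_reducible_def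
proof (intro exI conjI ballI)
  let ?A = necklace_splitting and ?B = "unfairness_minimisation C"
  let ?b = "\<lambda>y. splitting_of_route (fst y) (snd y)"
  show "polytime (code_inst ?A) (code_inst ?B) (instances ?A) plan_of_necklace"
    unfolding necklace_splitting_def unfairness_minimisation_def min_problem.simps
    by (rule ptime_imp_polytime[where cout = code_routing and h = plan_of_necklace, OF ptime_plan_of_necklace])
  show "polytime (code_pair (code_inst ?A) (code_sol ?B)) (code_sol ?A)
      {(x, w). x \<in> instances ?A \<and> w \<in> optimal ?B (plan_of_necklace x)} ?b"
    unfolding necklace_splitting_def unfairness_minimisation_def min_problem.simps
    by (rule ptime_imp_polytime[where cout = "code_list code_run" and h = ?b, OF ptime_splitting_of_route])
  fix N assume "N \<in> instances ?A"
  then have wf: "necklace_wf N" by (simp add: necklace_splitting_def)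
  then interpret necklace_instance N by unfold_locales
  show "plan_of_necklace N \<in> instances ?B"
    using plan_wf C[OF wf] by (simp add: unfairness_minimisation_def)
  show "solutions ?A N \<noteq> {} \<longleftrightarrow> solutions ?B (plan_of_necklace N) \<noteq> {}"
    using splitting_of_route(1) route_of_splitting
    by (auto simp: necklace_splitting_def unfairness_minimisation_def)
  fix w assume "w \<in> optimal ?B (plan_of_necklace N)"
  then have w: "vehicle_route (plan_of_necklace N) w"
    and min: "\<And>w'. vehicle_route (plan_of_necklace N) w' \<Longrightarrow>
      unfairness (plan_of_necklace N) w \<le> unfairness (plan_of_necklace N) w'"
    by (auto simp: optimal_def unfairness_minimisation_def)
  have "splitting_size (splitting_of_route N w) \<le> splitting_size S" if S: "k_splitting N S" for S
  proof -
    obtain w' where "vehicle_route (plan_of_necklace N) w'"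
      "unfairness (plan_of_necklace N) w' \<le> 2 + splitting_size S"
      using route_of_splitting[OF S] by blast
    with min[of w'] splitting_of_route(2)[OF w] show ?thesis by linarith
  qed
  with splitting_of_route(1)[OF w] show "?b (N, w) \<in> optimal ?A N"
    by (simp add: optimal_def necklace_splitting_def)
qed

theorem theorem4:
  shows "polytime_reducible necklace_splitting (unfairness_minimisation is_tree) \<and>
         polytime_reducible necklace_splitting (unfairness_minimisation is_star)"
proof
  show "polytime_reducible necklace_splitting (unfairness_minimisation is_tree)"
    by (rule reducible_to_class)
      (simp add: plan_of_necklace_def star_routing_is_tree leaf_specs_def)
  show "polytime_reducible necklace_splitting (unfairness_minimisation is_star)"
    by (rule reducible_to_class) (simp add: plan_of_necklace_def star_routing_is_star)
qed

end
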